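(* Let $S_3\subset A_5$ be a subgroup isomorphic to the symmetric group on three letters, acting on Bring's curve $\mathcal{B}$ by even permutations of coordinates. The quotient curve $\mathcal{B}/_{S_3}$ is given by (i.e. is isomorphic over $\mathbb{C}$ to the curve with) the equation $$y^2 = x^4 + 80x^3 + 125x^2 + 50x.$$
   Context: Bring's curve $\mathcal{B}\subset\mathbb{CP}^4$ is the genus-4 curve defined by $\sum_{i=1}^5 x_i=\sum_{i=1}^5 x_i^2=\sum_{i=1}^5 x_i^3=0$. The group $A_5$ acts on $\mathcal{B}$ by even permutations of the five homogeneous coordinates (it is the automorphism group of the dessin d'enfant $I_4$, the icosahedron of genus 4, embedded in $\mathcal{B}$); e.g. one may take $S_3=\langle(123),(12)(45)\rangle$. For a subgroup $G\subset A_5$, $\mathcal{B}/_G$ denotes the quotient compact Riemann surface. The curve given by an affine equation $y^2=P(x)$ means the compact Riemann surface (smooth projective model) of that affine curve over $\mathbb{C}$. *)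

theory Defs
  imports
    "HOL-Analysis.Analysis"
    "HOL-Computational_Algebra.Polynomial"
    "HOL-Algebra.Sym_Groups"
begin

section \<open>Quotient topology\<close>

definition quotient_topology :: "'a topology \<Rightarrow> ('a \<Rightarrow> 'b) \<Rightarrow> 'b topology" where
  "quotient_topology X q =
     topology (\<lambda>U. U \<subseteq> q ` topspace X \<and> openin X {x \<in> topspace X. q x \<in> U})"

lemma openin_quotient_topology:
  "openin (quotient_topology X q) U \<longleftrightarrow>
     U \<subseteq> q ` topspace X \<and> openin X {x \<in> topspace X. q x \<in> U}"
proof -
  let ?L = "\<lambda>U. U \<subseteq> q ` topspace X \<and> openin X {x \<in> topspace X. q x \<in> U}"
  have 1: "?L (S \<inter> T)" if "?L S" "?L T" for S T
  proof -
    have "{x \<in> topspace X. q x \<in> S \<inter> T} =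
        {x \<in> topspace X. q x \<in> S} \<inter> {x \<in> topspace X. q x \<in> T}" by auto
    then show ?thesis using that by (auto simp: openin_Int)
  qed
  have 2: "?L (\<Union>\<K>)" if "\<And>K. K \<in> \<K> \<Longrightarrow> ?L K" for \<K>
  proof -
    have "{x \<in> topspace X. q x \<in> \<Union>\<K>} = (\<Union>K\<in>\<K>. {x \<in> topspace X. q x \<in> K})" by auto
    moreover have "openin X (\<Union>K\<in>\<K>. {x \<in> topspace X. q x \<in> K})"
      using that by (intro openin_Union) auto
    moreover have "\<Union>\<K> \<subseteq> q ` topspace X"
      using that by (intro Union_least) blast
    ultimately show ?thesis by simp
  qed
  have "istopology ?L"
    unfolding istopology_def by (intro conjI[OF allI[OF allI] allI] impI 1 2) (assumption | erule (1) bspec)+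
  then show ?thesis by (simp add: quotient_topology_def topology_inverse')
qed

lemma topspace_quotient_topology: "topspace (quotient_topology X q) = q ` topspace X"
proof -
  have "{x \<in> topspace X. q x \<in> q ` topspace X} = topspace X" by auto
  then have "openin (quotient_topology X q) (q ` topspace X)"
    by (simp add: openin_quotient_topology)
  then have "q ` topspace X \<subseteq> topspace (quotient_topology X q)"
    by (rule openin_subset)
  moreover have "topspace (quotient_topology X q) \<subseteq> q ` topspace X"
    using openin_topspace[of "quotient_topology X q"]
    unfolding openin_quotient_topology by (rule conjunct1)
  ultimately show ?thesis by (rule subset_antisym[rotated])
qed

lemma quotient_map_quotient_topology: "quotient_map X (quotient_topology X q) q"
  unfolding quotient_map_def topspace_quotient_topology openin_quotient_topology by simp


section \<open>Riemann surfaces\<close>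

text \<open>A chart is a pair of its domain and a coordinate function; the values of the
  coordinate function outside the domain are irrelevant.\<close>

record 'a surface =
  surf_top :: "'a topology"
  surf_atlas :: "('a set \<times> ('a \<Rightarrow> complex)) set"

definition complex_chart :: "'a topology \<Rightarrow> 'a set \<Rightarrow> ('a \<Rightarrow> complex) \<Rightarrow> bool" where
  "complex_chart X U \<phi> \<longleftrightarrow>
     openin X U \<and> open (\<phi> ` U) \<and>
     homeomorphic_map (subtopology X U) (top_of_set (\<phi> ` U)) \<phi>"

definition riemann_surface :: "'a surface \<Rightarrow> bool" where
  "riemann_surface R \<longleftrightarrow>
     topspace (surf_top R) \<noteq> {} \<and>
     connected_space (surf_top R) \<and>
     Hausdorff_space (surf_top R) \<and>
     (\<forall>(U, \<phi>) \<in> surf_atlas R. complex_chart (surf_top R) U \<phi>) \<and>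
     topspace (surf_top R) = (\<Union>(U, \<phi>) \<in> surf_atlas R. U) \<and>
     (\<forall>(U, \<phi>) \<in> surf_atlas R. \<forall>(V, \<psi>) \<in> surf_atlas R.
        (\<psi> \<circ> inv_into U \<phi>) holomorphic_on \<phi> ` (U \<inter> V))"

definition holomorphic_function :: "'a surface \<Rightarrow> 'a set \<Rightarrow> ('a \<Rightarrow> complex) \<Rightarrow> bool" where
  "holomorphic_function R W f \<longleftrightarrow>
     (\<forall>(U, \<phi>) \<in> surf_atlas R. (f \<circ> inv_into U \<phi>) holomorphic_on \<phi> ` (U \<inter> W))"

definition holomorphic_map :: "'a surface \<Rightarrow> 'b surface \<Rightarrow> ('a \<Rightarrow> 'b) \<Rightarrow> bool" where
  "holomorphic_map R S f \<longleftrightarrow>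
     continuous_map (surf_top R) (surf_top S) f \<and>
     (\<forall>(U, \<phi>) \<in> surf_atlas R. \<forall>(V, \<psi>) \<in> surf_atlas S.
        (\<psi> \<circ> f \<circ> inv_into U \<phi>) holomorphic_on \<phi> ` {x \<in> U. f x \<in> V})"

definition isomorphic_surfaces :: "'a surface \<Rightarrow> 'b surface \<Rightarrow> bool" where
  "isomorphic_surfaces R S \<longleftrightarrow>
     riemann_surface R \<and> riemann_surface S \<and>
     (\<exists>f g. homeomorphic_maps (surf_top R) (surf_top S) f g \<and>
            holomorphic_map R S f \<and> holomorphic_map S R g)"


section \<open>Quotient by a group action\<close>

definition group_orbit :: "'g set \<Rightarrow> ('g \<Rightarrow> 'a \<Rightarrow> 'a) \<Rightarrow> 'a \<Rightarrow> 'a set" where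
  "group_orbit G act x = (\<lambda>g. act g x) ` G"

text \<open>The complex structure on the orbit space is the one for which a function is
  holomorphic iff its pullback to \<open>R\<close> is; its charts are therefore the homeomorphisms
  from open sets onto open subsets of the plane whose pullback is holomorphic.\<close>

definition quotient_surface ::
    "'a surface \<Rightarrow> 'g set \<Rightarrow> ('g \<Rightarrow> 'a \<Rightarrow> 'a) \<Rightarrow> 'a set surface" where
  "quotient_surface R G act =
     (let q = group_orbit G act; Q = quotient_topology (surf_top R) q in
      \<lparr> surf_top = Q,
        surf_atlas = {(U, \<phi>). complex_chart Q U \<phi> \<and>
           holomorphic_function R {x \<in> topspace (surf_top R). q x \<in> U} (\<phi> \<circ> q)} \<rparr>)"


section \<open>Projective spaces and smooth projective curves\<close>

text \<open>Homogeneous coordinates are indexed by a finite set \<open>I\<close> of naturals; a vector is a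
  function vanishing outside \<open>I\<close>, and a point of projective space is a line through \<open>0\<close>.
  On such vectors the product topology of \<^typ>\<open>nat \<Rightarrow> complex\<close> is the usual one.\<close>

type_synonym cvec = "nat \<Rightarrow> complex"

definition nonzero_vecs :: "nat set \<Rightarrow> cvec set" where
  "nonzero_vecs I = {v. (\<forall>i. i \<notin> I \<longrightarrow> v i = 0) \<and> (\<exists>i. v i \<noteq> 0)}"

definition proj_point :: "cvec \<Rightarrow> cvec set" where
  "proj_point v = range (\<lambda>c i. c * v i)"

definition projective_space :: "nat set \<Rightarrow> cvec set topology" where
  "projective_space I = quotient_topology (top_of_set (nonzero_vecs I)) proj_point"

text \<open>A parametrization \<open>p\<close> of a subset of projective space is a holomorphic immersion on
  \<open>D\<close> if it locally lifts to a holomorphic vector function \<open>h\<close> with \<open>h\<close> and \<open>h'\<close> linearly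
  independent, i.e. not all of their \<open>2 \<times> 2\<close> minors vanish.\<close>

definition holomorphic_immersion :: "nat set \<Rightarrow> complex set \<Rightarrow> (complex \<Rightarrow> cvec set) \<Rightarrow> bool" where
  "holomorphic_immersion I D p \<longleftrightarrow>
     (\<forall>t0 \<in> D. \<exists>W (h :: complex \<Rightarrow> cvec). open W \<and> t0 \<in> W \<and> W \<subseteq> D \<and>
        (\<forall>i. (\<lambda>t. h t i) holomorphic_on W) \<and>
        (\<forall>t \<in> W. h t \<in> nonzero_vecs I \<and> p t = proj_point (h t) \<and>
           (\<exists>i j. h t i * deriv (\<lambda>s. h s j) t \<noteq> h t j * deriv (\<lambda>s. h s i) t)))"

text \<open>The structure of a one-dimensional complex submanifold \<open>C\<close> of projective space.  If
  \<open>C\<close> is not a submanifold, the charts do not cover \<open>C\<close>, and the result is not a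
  \<^const>\<open>riemann_surface\<close>.\<close>

definition projective_curve :: "nat set \<Rightarrow> cvec set set \<Rightarrow> cvec set surface" where
  "projective_curve I C =
     (let X = subtopology (projective_space I) C in
      \<lparr> surf_top = X,
        surf_atlas = {(U, \<phi>). complex_chart X U \<phi> \<and>
           holomorphic_immersion I (\<phi> ` U) (inv_into U \<phi>)} \<rparr>)"


section \<open>Bring's curve and its permutation action\<close>

definition brings_curve :: "cvec set surface" where
  "brings_curve = projective_curve {1..5}
     (proj_point ` {x \<in> nonzero_vecs {1..5}.
        (\<Sum>i=1..5. x i) = 0 \<and> (\<Sum>i=1..5. x i ^ 2) = 0 \<and> (\<Sum>i=1..5. x i ^ 3) = 0})"

text \<open>\<open>\<sigma>\<close> moves the \<open>i\<close>-th coordinate to position \<open>\<sigma> i\<close>.\<close>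

definition permute_point :: "(nat \<Rightarrow> nat) \<Rightarrow> cvec set \<Rightarrow> cvec set" where
  "permute_point \<sigma> L = (\<lambda>v. v \<circ> Hilbert_Choice.inv \<sigma>) ` L"


section \<open>The curve with affine equation \<open>y\<^sup>2 = P(x)\<close>\<close>

text \<open>For a squarefree polynomial \<open>P\<close> of degree \<open>2g + 1\<close> or \<open>2g + 2\<close>, the smooth projective
  model is the closure of the affine curve embedded by \<open>[1 : x : \<dots> : x\<^bsup>g+1\<^esup> : y]\<close> (the
  closure of \<open>[1 : x : y]\<close> in the plane would be singular at infinity for degree at least 4).\<close>

definition square_root_curve :: "complex poly \<Rightarrow> cvec set surface" where
  "square_root_curve P =
     (let g = (degree P - 1) div 2;
          emb = (\<lambda>x y i. if i \<le> g + 1 then x ^ i else if i = g + 2 then y else 0)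
      in projective_curve {0..g + 2}
           (Abstract_Topology.closure_of (projective_space {0..g + 2})
              {proj_point (emb x y) | x y. y ^ 2 = poly P x}))"

end

theory Submission
  imports
    Defs
    "HOL-Complex_Analysis.Complex_Analysis"
    "HOL-Computational_Algebra.Fundamental_Theorem_Algebra"
begin

text \<open>Every subgroup of \<open>A\<^sub>5\<close> isomorphic to \<open>S\<^sub>3\<close> consists, for a suitable labelling
  \<open>a, b, c, d, e\<close> of the coordinates, of the even permutations that preserve \<open>{a, b, c}\<close>.  Its
  invariants on Bring's curve are generated by \<open>s = x\<^sub>d + x\<^sub>e\<close>, \<open>D\<^sup>2\<close> and \<open>\<Delta> D\<close>, where \<open>D = x\<^sub>d - x\<^sub>e\<close> and
  \<open>\<Delta>\<close> is the product of the differences of \<open>x\<^sub>a, x\<^sub>b, x\<^sub>c\<close>: the equations of the curve express the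
  elementary symmetric functions of \<open>x\<^sub>a, x\<^sub>b, x\<^sub>c\<close> by \<open>s\<close> and \<open>D\<^sup>2\<close>, and the discriminant of the cubic
  yields \<open>(4 \<i> \<Delta> D)\<^sup>2 = D\<^sup>8 + 80 s\<^sup>2 D\<^sup>6 + 125 s\<^sup>4 D\<^sup>4 + 50 s\<^sup>6 D\<^sup>2\<close>.  Hence
  \<open>[s\<^sup>4 : s\<^sup>2 D\<^sup>2 : D\<^sup>4 : 4 \<i> \<Delta> D]\<close> maps Bring's curve holomorphically onto the smooth model of
  \<open>y\<^sup>2 = x\<^sup>4 + 80 x\<^sup>3 + 125 x\<^sup>2 + 50 x\<close>, with \<open>x = D\<^sup>2 / s\<^sup>2\<close>, and its fibres are exactly the orbits.\<close>

section \<open>Charts\<close>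

text \<open>The charts of a quotient surface are all homeomorphisms with holomorphic pullback;
  nothing describes them near a point with non-trivial stabilizer, where the orbit map ramifies. No
  charts are built from stabilizers here. The bijection induced by the quotient map is a
  homeomorphism because Bring's curve is compact and the target is Hausdorff; the charts of the
  target are pulled back along it, and an arbitrary chart of the quotient is compared with them by
  removing singularities. What remains is algebra. All four forms have degree 4, the degree of
  \<open>\<Delta> D\<close>. A transposition of \<open>a, b, c\<close> comes with the exchange of
  \<open>d\<close> and \<open>e\<close>, so \<open>\<Delta>\<close> and \<open>D\<close> change sign
  together. The factor \<open>4 \<i>\<close> makes the quartic monic, since 16 times the
  discriminant is minus a sextic form in \<open>s\<close> and \<open>D\<close> with leading
  coefficient 1. The price of degree 4 is that the forms determine \<open>s\<close> and
  \<open>D\<close> only up to fourth roots of unity and signs, which have to be absorbed by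
  rescaling the point or reordering its coordinates.\<close>

lemma complex_chart_openin: "complex_chart X U \<phi> \<Longrightarrow> openin X U"
  and complex_chart_open_image: "complex_chart X U \<phi> \<Longrightarrow> open (\<phi> ` U)"
  by (simp_all add: complex_chart_def)

lemma complex_chart_subset: "complex_chart X U \<phi> \<Longrightarrow> U \<subseteq> topspace X"
  by (simp add: complex_chart_def openin_subset)

lemma complex_chart_inj: "complex_chart X U \<phi> \<Longrightarrow> inj_on \<phi> U"
  using complex_chart_subset[of X U \<phi>]
  by (auto simp: complex_chart_def inf_absorb2 dest!: homeomorphic_imp_injective_map)

lemma complex_chart_inv:
  assumes "complex_chart X U \<phi>"
  shows "x \<in> U \<Longrightarrow> inv_into U \<phi> (\<phi> x) = x"
    and "t \<in> \<phi> ` U \<Longrightarrow> \<phi> (inv_into U \<phi> t) = t"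
    and "t \<in> \<phi> ` U \<Longrightarrow> inv_into U \<phi> t \<in> U"
  using complex_chart_inj[OF assms] by (auto simp: f_inv_into_f inv_into_into)

lemma complex_chart_continuous:
  assumes "complex_chart X U \<phi>"
  shows "continuous_map (subtopology X U) euclidean \<phi>"
  using assms unfolding complex_chart_def
  by (auto dest!: homeomorphic_imp_continuous_map simp: continuous_map_in_subtopology)

lemma complex_chart_continuous_compose:
  assumes "complex_chart X U \<phi>" "continuous_map Z X \<gamma>" "\<gamma> ` topspace Z \<subseteq> U"
  shows "continuous_map Z euclidean (\<phi> \<circ> \<gamma>)"
  by (rule continuous_map_compose[OF _ complex_chart_continuous[OF assms(1)]])
     (use assms in \<open>auto simp: continuous_map_in_subtopology\<close>)

lemma complex_chart_continuous_inv:
  assumes "complex_chart X U \<phi>"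
  shows "continuous_map (top_of_set (\<phi> ` U)) X (inv_into U \<phi>)"
proof -
  have hm: "homeomorphic_map (subtopology X U) (top_of_set (\<phi> ` U)) \<phi>"
    using assms by (simp add: complex_chart_def)
  have ts: "topspace (subtopology X U) = U"
    using complex_chart_subset[OF assms] by (simp add: inf_absorb2)
  obtain g where g: "homeomorphic_maps (subtopology X U) (top_of_set (\<phi> ` U)) \<phi> g"
    using hm homeomorphic_map_maps by blast
  have "g t = inv_into U \<phi> t" if "t \<in> \<phi> ` U" for t
    using g that ts complex_chart_inv(1)[OF assms] unfolding homeomorphic_maps_def
    by auto
  moreover have "continuous_map (top_of_set (\<phi> ` U)) X g"
    using g by (simp add: homeomorphic_maps_def continuous_map_in_subtopology)
  ultimately show ?thesis
    by (metis (no_types, lifting) continuous_map_eq topspace_euclidean_subtopology)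
qed

lemma complex_chart_open_subimage:
  assumes "complex_chart X U \<phi>" "openin X W" "W \<subseteq> U"
  shows "open (\<phi> ` W)"
proof -
  have "openin (subtopology X U) W"
    using assms by (auto simp: openin_subtopology)
  then have "openin (top_of_set (\<phi> ` U)) (\<phi> ` W)"
    using assms(1) unfolding complex_chart_def
    by (metis homeomorphic_map_openness_eq)
  then show ?thesis
    using assms(1) by (simp add: complex_chart_def openin_open_eq)
qed

text \<open>Identifies the abstract \<open>inv_into U \<phi>\<close> with an explicit continuous
  inverse \<open>p\<close>, so that the conditions on a chart can be checked on a parametrization
  given by formulas.\<close>

lemma complex_chartI:
  assumes "openin X U" "open D"
    and "continuous_map (subtopology X U) euclidean \<phi>" "continuous_map (top_of_set D) X p"
    and "\<And>x. x \<in> U \<Longrightarrow> \<phi> x \<in> D \<and> p (\<phi> x) = x" "\<And>t. t \<in> D \<Longrightarrow> p t \<in> U \<and> \<phi> (p t) = t"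
  shows "complex_chart X U \<phi>" "\<phi> ` U = D" "t \<in> D \<Longrightarrow> inv_into U \<phi> t = p t"
proof -
  show im: "\<phi> ` U = D"
    using assms(5,6) by (auto, metis image_eqI)
  have inj: "inj_on \<phi> U"
    using assms(5) by (metis inj_onI)
  show "t \<in> D \<Longrightarrow> inv_into U \<phi> t = p t"
    using assms(6)[of t] inv_into_f_eq[OF inj] by simp
  have ts: "topspace (subtopology X U) = U"
    using openin_subset[OF assms(1)] by (simp add: inf_absorb2)
  have "homeomorphic_maps (subtopology X U) (top_of_set D) \<phi> p"
    unfolding homeomorphic_maps_def ts
    using assms(3-6) by (simp add: continuous_map_in_subtopology image_subset_iff)
  then show "complex_chart X U \<phi>"
    unfolding complex_chart_def im using assms(1,2) homeomorphic_map_maps by blast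
qed

section \<open>Quotients by holomorphic maps\<close>

lemma holomorphic_on_local:
  assumes "\<And>z. z \<in> S \<Longrightarrow> \<exists>N. open N \<and> z \<in> N \<and> f holomorphic_on N"
  shows "f holomorphic_on S"
  unfolding holomorphic_on_def
  by (meson assms field_differentiable_at_within holomorphic_on_imp_differentiable_at)

text \<open>Away from the critical points of \<open>m\<close>, \<open>g\<close> is
  \<open>g \<circ> m\<close> composed with a local holomorphic inverse of \<open>m\<close>.\<close>

lemma holomorphic_via_local_inverse:
  assumes "m holomorphic_on M" "open M" "z \<in> M" "deriv m z \<noteq> 0"
    and "(g \<circ> m) holomorphic_on M"
  shows "\<exists>N. open N \<and> m z \<in> N \<and> g holomorphic_on N"
proof -
  obtain r where r: "r > 0" "ball z r \<subseteq> M" "open (m ` ball z r)" "inj_on m (ball z r)"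
    using has_complex_derivative_locally_invertible[OF assms(1,3,2,4)] .
  obtain k where k: "k holomorphic_on m ` ball z r" "\<And>x. x \<in> ball z r \<Longrightarrow> k (m x) = x"
    using holomorphic_has_inverse[OF holomorphic_on_subset[OF assms(1) r(2)] open_ball r(4)] by metis
  have "(g \<circ> m \<circ> k) holomorphic_on m ` ball z r"
    by (rule holomorphic_on_compose[OF k(1)])
       (rule holomorphic_on_subset[OF assms(5)], use r k in auto)
  then have "g holomorphic_on m ` ball z r"
    by (rule holomorphic_transform) (auto simp: k)
  then show ?thesis
    using r by (intro exI[of _ "m ` ball z r"]) auto
qed

text \<open>At a critical point of \<open>m\<close> the function \<open>g\<close> has a removable singularity.\<close>

lemma holomorphic_of_compose:
  assumes m: "m holomorphic_on M" "open M" "z0 \<in> M"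
    and nc: "\<And>r. r > 0 \<Longrightarrow> \<not> m constant_on ball z0 r"
    and g: "continuous_on (m ` M) g" "(g \<circ> m) holomorphic_on M"
  shows "\<exists>N. open N \<and> m z0 \<in> N \<and> g holomorphic_on N"
proof -
  obtain r where r: "r > 0" "ball z0 r \<subseteq> M"
    using m openE by blast
  have hm: "m holomorphic_on ball z0 r" and hd: "deriv m holomorphic_on ball z0 r"
    using holomorphic_on_subset[OF m(1) r(2)] by (auto intro: holomorphic_deriv)
  \<comment> \<open>One non-zero value keeps \<open>deriv m\<close> from vanishing identically,
    which is what isolates a possible zero at \<open>z0\<close>.\<close>
  have "\<exists>b\<in>ball z0 r. deriv m b \<noteq> 0"
  proof (rule ccontr)
    assume "\<not> ?thesis"
    then have "(m has_field_derivative 0) (at x)" if "x \<in> ball z0 r" for x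
      using holomorphic_derivI[OF hm open_ball that] that by auto
    then have "m constant_on ball z0 r"
      unfolding constant_on_def
      by (intro has_field_derivative_zero_constant[OF convex_ball]) (auto intro: has_field_derivative_at_within)
    then show False using nc r by auto
  qed
  then obtain b where b: "b \<in> ball z0 r" "deriv m b \<noteq> 0" by blast
  obtain e where e: "0 < e" "ball z0 e \<subseteq> ball z0 r" "\<And>z. z \<in> ball z0 e - {z0} \<Longrightarrow> deriv m z \<noteq> 0"
  proof (cases "deriv m z0 = 0")
    case True
    then show ?thesis
      using isolated_zeros[OF hd open_ball connected_ball _ True b] r that by auto
  next
    case False
    then have "eventually (\<lambda>z. deriv m z \<noteq> 0) (at z0)"
      using hd r(1) continuous_on_eq_continuous_at[of "ball z0 r" "deriv m"]
      by (intro tendsto_imp_eventually_ne[of _ "deriv m z0"])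
         (auto simp: isCont_def holomorphic_on_imp_continuous_on)
    then obtain d where d: "d > 0" "\<And>z. z \<noteq> z0 \<Longrightarrow> dist z z0 < d \<Longrightarrow> deriv m z \<noteq> 0"
      by (auto simp: eventually_at)
    show ?thesis
      by (rule that[of "min d r"]) (use d r in \<open>auto simp: dist_commute\<close>)
  qed
  have hme: "m holomorphic_on ball z0 e"
    using hm e(2) holomorphic_on_subset by blast
  have op: "open (m ` ball z0 e)"
    using open_mapping_thm[OF hme open_ball connected_ball open_ball] nc[OF e(1)] by blast
  have eM: "ball z0 e \<subseteq> M" using e r by blast
  \<comment> \<open>A preimage in the ball of a value other than \<open>m z0\<close> differs from
    \<open>z0\<close>, so the derivative there is non-zero.\<close>
  have "g holomorphic_on m ` ball z0 e - {m z0}"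
  proof (rule holomorphic_on_local)
    fix w assume "w \<in> m ` ball z0 e - {m z0}"
    then obtain z where z: "z \<in> ball z0 e - {z0}" "w = m z" by blast
    show "\<exists>N. open N \<and> w \<in> N \<and> g holomorphic_on N"
      unfolding z(2)
      by (rule holomorphic_via_local_inverse[OF m(1,2) _ e(3)[OF z(1)] g(2)]) (use z eM in auto)
  qed
  then have "g holomorphic_on m ` ball z0 e"
    by (rule no_isolated_singularity[OF continuous_on_subset[OF g(1) image_mono[OF eM]] _ op]) simp
  then show ?thesis using op e(1) by (intro exI[of _ "m ` ball z0 e"]) auto
qed

text \<open>A left inverse forces injectivity, and the inverse of an injective holomorphic function
  on an open set is holomorphic on the image.\<close>

lemma holomorphic_inv_of_holomorphic:
  assumes "g holomorphic_on S" "open S" "\<And>z. z \<in> S \<Longrightarrow> k (g z) = z"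
  shows "k holomorphic_on g ` S"
proof -
  have "inj_on g S" by (metis assms(3) inj_onI)
  then obtain h where "h holomorphic_on g ` S" "\<And>z. z \<in> S \<Longrightarrow> h (g z) = z"
    using holomorphic_has_inverse[OF assms(1,2)] by metis
  then show ?thesis using assms(3) by (auto elim: holomorphic_transform)
qed

text \<open>Because the fibres of \<open>F\<close> are the orbits, \<open>F\<close> descends to a
  continuous bijection from the compact orbit space to a Hausdorff space, hence to a homeomorphism.
  Finite fibres prevent \<open>F\<close> from being constant near a point, so that holomorphy
  descends even through ramification points.\<close>

theorem quotient_surface_iso:
  assumes S: "riemann_surface S"
    and compact: "compact_space (surf_top R)"
    and atlas_charts: "\<And>U \<phi>. (U, \<phi>) \<in> surf_atlas R \<Longrightarrow> complex_chart (surf_top R) U \<phi>"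
    and cover: "topspace (surf_top R) \<subseteq> (\<Union>(U, \<phi>) \<in> surf_atlas R. U)"
    and F: "holomorphic_map R S F"
    and surj: "F ` topspace (surf_top R) = topspace (surf_top S)"
    and fibre: "\<And>x y. x \<in> topspace (surf_top R) \<Longrightarrow> y \<in> topspace (surf_top R) \<Longrightarrow>
        F x = F y \<longleftrightarrow> group_orbit G act x = group_orbit G act y"
    and fin: "\<And>x. x \<in> topspace (surf_top R) \<Longrightarrow> finite {y \<in> topspace (surf_top R). F y = F x}"
  shows "isomorphic_surfaces (quotient_surface R G act) S"
proof -
  define q where "q = group_orbit G act"
  define X where "X = surf_top R"
  define Y where "Y = surf_top S"
  define Q where "Q = quotient_topology X q"
  define QS where "QS = quotient_surface R G act"
  have top_QS: "surf_top QS = Q"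
    by (simp add: QS_def quotient_surface_def Let_def Q_def X_def q_def)
  have atlas_QS: "(U, \<phi>) \<in> surf_atlas QS \<longleftrightarrow> complex_chart Q U \<phi> \<and>
           holomorphic_function R {x \<in> topspace X. q x \<in> U} (\<phi> \<circ> q)" for U \<phi>
    by (simp add: QS_def quotient_surface_def Let_def Q_def X_def q_def)
  have qm: "quotient_map X Q q"
    unfolding Q_def by (rule quotient_map_quotient_topology)
  have top_Q: "topspace Q = q ` topspace X"
    by (simp add: Q_def topspace_quotient_topology)
  have contF: "continuous_map X Y F"
    using F by (simp add: holomorphic_map_def X_def Y_def)
  obtain f where f: "continuous_map Q Y f" "f ` topspace Q = F ` topspace X"
      "\<And>x. x \<in> topspace X \<Longrightarrow> f (q x) = F x"
    using quotient_map_lift_exists[OF qm contF] fibre unfolding q_def X_def by metis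
  have inj_f: "inj_on f (topspace Q)"
    unfolding top_Q using f(3) fibre by (auto simp: inj_on_def q_def X_def)
  have Y_haus: "Hausdorff_space Y" using S by (simp add: riemann_surface_def Y_def)
  have Q_comp: "compact_space Q"
    using image_compactin[OF _ quotient_imp_continuous_map[OF qm]] compact
    unfolding compact_space_def top_Q X_def by blast
  have "homeomorphic_map Q Y f"
    by (rule continuous_imp_homeomorphic_map[OF f(1) Q_comp Y_haus _ inj_f])
       (use f(2) surj in \<open>simp add: X_def Y_def\<close>)
  then obtain k where fk: "homeomorphic_maps Q Y f k"
    using homeomorphic_map_maps by blast
  have contk: "continuous_map Y Q k"
    and kf: "\<And>u. u \<in> topspace Q \<Longrightarrow> k (f u) = u" and fk': "\<And>y. y \<in> topspace Y \<Longrightarrow> f (k y) = y"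
    using fk by (auto simp: homeomorphic_maps_def)
  have fY: "f u \<in> topspace Y" if "u \<in> topspace Q" for u
    using f(1) that by (auto simp: continuous_map_def)
  have kQ: "k y \<in> topspace Q" if "y \<in> topspace Y" for y
    using contk that by (auto simp: continuous_map_def)
  have S_chart: "complex_chart Y V \<psi>" if "(V, \<psi>) \<in> surf_atlas S" for V \<psi>
    using S that by (auto simp: riemann_surface_def Y_def)
  have R_chart: "complex_chart X T c" if "(T, c) \<in> surf_atlas R" for T c
    using atlas_charts that by (auto simp: X_def)
  have S_cover: "\<exists>V \<psi>. (V, \<psi>) \<in> surf_atlas S \<and> y \<in> V" if "y \<in> topspace Y" for y
    using S that unfolding riemann_surface_def Y_def by blast
  have R_cover: "\<exists>T c. (T, c) \<in> surf_atlas R \<and> x \<in> T" if "x \<in> topspace X" for x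
    using cover that unfolding X_def by blast

  \<comment> \<open>The transition function is continuous, but its holomorphy is known only after
    composition with \<open>m\<close>, the local expression of \<open>F\<close>, which may ramify.
    This is where \<open>holomorphic_of_compose\<close> enters.\<close>
  have out_hol: "(\<phi> \<circ> k \<circ> inv_into V \<psi>) holomorphic_on \<psi> ` {y \<in> V. k y \<in> U}"
    and out_open: "open (\<psi> ` {y \<in> V. k y \<in> U})"
    if U: "(U, \<phi>) \<in> surf_atlas QS" and V: "(V, \<psi>) \<in> surf_atlas S" for U \<phi> V \<psi>
  proof -
    let ?O = "\<psi> ` {y \<in> V. k y \<in> U}" and ?g = "\<phi> \<circ> k \<circ> inv_into V \<psi>"
    have Uc: "complex_chart Q U \<phi>" and Uh: "holomorphic_function R {x \<in> topspace X. q x \<in> U} (\<phi> \<circ> q)"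
      using U by (simp_all add: atlas_QS)
    note Vc = S_chart[OF V]
    have VY: "V \<subseteq> topspace Y" by (rule complex_chart_subset[OF Vc])
    have "{y \<in> V. k y \<in> U} = V \<inter> {y \<in> topspace Y. k y \<in> U}" using VY by auto
    then have "openin Y {y \<in> V. k y \<in> U}"
      using openin_continuous_map_preimage[OF contk complex_chart_openin[OF Uc]]
        complex_chart_openin[OF Vc] by auto
    then show oO: "open ?O"
      by (rule complex_chart_open_subimage[OF Vc]) auto
    have Oim: "?O \<subseteq> \<psi> ` V" by auto
    have Oinv: "inv_into V \<psi> w \<in> V" "k (inv_into V \<psi> w) \<in> U" "\<psi> (inv_into V \<psi> w) = w"
      if "w \<in> ?O" for w
      using that complex_chart_inv[OF Vc] by auto
    have "continuous_map (top_of_set ?O) Y (inv_into V \<psi>)"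
      using continuous_map_from_subtopology_mono[OF complex_chart_continuous_inv[OF Vc] Oim] .
    then have "continuous_map (top_of_set ?O) Q (k \<circ> inv_into V \<psi>)"
      using contk continuous_map_compose by blast
    then have "continuous_map (top_of_set ?O) euclidean (\<phi> \<circ> (k \<circ> inv_into V \<psi>))"
      by (rule complex_chart_continuous_compose[OF Uc]) (use Oinv in auto)
    then have cg: "continuous_on ?O ?g"
      by (simp add: comp_assoc)
    show "?g holomorphic_on ?O"
    proof (rule holomorphic_on_local)
      fix w0 assume w0: "w0 \<in> ?O"
      let ?y0 = "inv_into V \<psi> w0"
      have y0: "?y0 \<in> topspace Y" using Oinv[OF w0] VY by auto
      then obtain x0 where x0: "x0 \<in> topspace X" "F x0 = ?y0"
        using surj by (metis X_def Y_def imageE)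
      obtain T c where T: "(T, c) \<in> surf_atlas R" "x0 \<in> T" using R_cover x0 by blast
      note Tc = R_chart[OF T(1)]
      have TX: "T \<subseteq> topspace X" by (rule complex_chart_subset[OF Tc])
      define m where "m = \<psi> \<circ> F \<circ> inv_into T c"
      define A where "A = {x \<in> T. F x \<in> V \<and> k (F x) \<in> U}"
      have "A = T \<inter> {x \<in> topspace X. F x \<in> {y \<in> V. k y \<in> U}}" using TX by (auto simp: A_def)
      then have oA: "openin X A"
        using openin_continuous_map_preimage[OF contF \<open>openin Y {y \<in> V. k y \<in> U}\<close>]
          complex_chart_openin[OF Tc] by auto
      have AT: "A \<subseteq> T" by (auto simp: A_def)
      have oM: "open (c ` A)" by (rule complex_chart_open_subimage[OF Tc oA AT])
      have kF: "k (F x) = q x" if "x \<in> topspace X" for x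
        using f(3)[OF that] kf[of "q x"] that by (auto simp: top_Q)
      have x0A: "x0 \<in> A" using T x0 Oinv[OF w0] by (auto simp: A_def)
      have "(\<psi> \<circ> F \<circ> inv_into T c) holomorphic_on c ` {x \<in> T. F x \<in> V}"
        using F T(1) V unfolding holomorphic_map_def by blast
      then have hm: "m holomorphic_on c ` A"
        unfolding m_def by (rule holomorphic_on_subset) (auto simp: A_def)
      have cA: "inv_into T c (c x) = x" if "x \<in> A" for x
        using that AT complex_chart_inv(1)[OF Tc] by auto
      have mA: "m (c x) = \<psi> (F x)" if "x \<in> A" for x
        using cA[OF that] by (simp add: m_def)
      have "m (c x0) = w0"
        using mA[OF x0A] x0 Oinv[OF w0] by simp
      moreover have "\<exists>N. open N \<and> m (c x0) \<in> N \<and> ?g holomorphic_on N"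
      proof (rule holomorphic_of_compose[OF hm oM])
        show "c x0 \<in> c ` A" using x0A by auto
        have "m ` c ` A \<subseteq> ?O" using mA by (auto simp: A_def)
        then show "continuous_on (m ` c ` A) ?g" using cg continuous_on_subset by blast
        have "(\<phi> \<circ> q \<circ> inv_into T c) holomorphic_on c ` (T \<inter> {x \<in> topspace X. q x \<in> U})"
          using Uh T(1) unfolding holomorphic_function_def by (auto simp: comp_assoc)
        then have "(\<phi> \<circ> q \<circ> inv_into T c) holomorphic_on c ` A"
          by (rule holomorphic_on_subset) (use TX kF in \<open>auto simp: A_def\<close>)
        then show "(?g \<circ> m) holomorphic_on c ` A"
        proof (rule holomorphic_transform)
          fix z assume "z \<in> c ` A"
          then obtain x where x: "x \<in> A" "z = c x" by auto
          have xV: "F x \<in> V" and xX: "x \<in> topspace X" using x TX by (auto simp: A_def)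
          show "(\<phi> \<circ> q \<circ> inv_into T c) z = (?g \<circ> m) z"
            using mA[OF x(1)] cA[OF x(1)] complex_chart_inv(1)[OF Vc xV] kF[OF xX] x by simp
        qed
        fix r :: real assume r: "r > 0"
        \<comment> \<open>If \<open>m\<close> were constant on the ball, infinitely many points near
          \<open>x0\<close> would lie in a single fibre of \<open>F\<close>.\<close>
        show "\<not> m constant_on ball (c x0) r"
        proof
          assume "m constant_on ball (c x0) r"
          then have const: "m z = m (c x0)" if "z \<in> ball (c x0) r" for z
            using that r unfolding constant_on_def by (metis centre_in_ball)
          let ?B = "ball (c x0) r \<inter> c ` A"
          have "open ?B" "c x0 \<in> ?B" using oM r x0A by auto
          then have "infinite ?B"
            by (metis finite_imp_not_open empty_iff)
          moreover have "?B \<subseteq> c ` {y \<in> topspace X. F y = F x0}"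
          proof
            fix z assume z: "z \<in> ?B"
            then obtain x where x: "x \<in> A" "z = c x" by auto
            have "\<psi> (F x) = \<psi> (F x0)" using const[of z] z mA x x0A by auto
            moreover have "F x \<in> V" "F x0 \<in> V" using x x0A by (auto simp: A_def)
            ultimately have "F x = F x0" using complex_chart_inj[OF Vc] by (auto simp: inj_on_def)
            then show "z \<in> c ` {y \<in> topspace X. F y = F x0}" using x AT TX by auto
          qed
          moreover have "finite {y \<in> topspace X. F y = F x0}" using fin[of x0] x0(1) by (simp add: X_def)
          ultimately show False by (meson finite_imageI finite_subset)
        qed
      qed
      ultimately show "\<exists>N. open N \<and> w0 \<in> N \<and> ?g holomorphic_on N" by simp
    qed
  qed
  \<comment> \<open>This transition inverts the preceding one, so its holomorphy follows from
    injectivity without a second descent.\<close>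
  have in_hol: "(\<psi> \<circ> f \<circ> inv_into U \<phi>) holomorphic_on \<phi> ` {u \<in> U. f u \<in> V}"
    if U: "(U, \<phi>) \<in> surf_atlas QS" and V: "(V, \<psi>) \<in> surf_atlas S" for U \<phi> V \<psi>
  proof -
    have Uc: "complex_chart Q U \<phi>" using U by (simp add: atlas_QS)
    note Vc = S_chart[OF V]
    have UQ: "U \<subseteq> topspace Q" and VY: "V \<subseteq> topspace Y"
      using complex_chart_subset[OF Vc] complex_chart_subset[OF Uc] by auto
    have "(\<psi> \<circ> f \<circ> inv_into U \<phi>) holomorphic_on (\<phi> \<circ> k \<circ> inv_into V \<psi>) ` \<psi> ` {y \<in> V. k y \<in> U}"
      by (rule holomorphic_inv_of_holomorphic[OF out_hol[OF U V] out_open[OF U V]])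
         (use complex_chart_inv[OF Uc] complex_chart_inv[OF Vc] fk' VY in auto)
    moreover have "\<phi> ` {u \<in> U. f u \<in> V} \<subseteq> (\<phi> \<circ> k \<circ> inv_into V \<psi>) ` \<psi> ` {y \<in> V. k y \<in> U}"
    proof clarify
      fix u assume u: "u \<in> U" "f u \<in> V"
      then have "k (f u) = u" using kf UQ by auto
      then show "\<phi> u \<in> (\<phi> \<circ> k \<circ> inv_into V \<psi>) ` \<psi> ` {y \<in> V. k y \<in> U}"
        using u complex_chart_inv(1)[OF Vc u(2)]
        by (intro image_eqI[of _ _ "\<psi> (f u)"]) auto
    qed
    ultimately show ?thesis by (rule holomorphic_on_subset)
  qed
  have pullback: "(f -` V \<inter> topspace Q, \<psi> \<circ> f) \<in> surf_atlas QS" if V: "(V, \<psi>) \<in> surf_atlas S" for V \<psi>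
  proof -
    note Vc = S_chart[OF V]
    have VY: "V \<subseteq> topspace Y" using complex_chart_subset[OF Vc] by auto
    let ?U = "f -` V \<inter> topspace Q"
    have "?U = {u \<in> topspace Q. f u \<in> V}" by auto
    then have oU: "openin Q ?U"
      using openin_continuous_map_preimage[OF f(1) complex_chart_openin[OF Vc]] by simp
    have "complex_chart Q ?U (\<psi> \<circ> f)"
    proof (rule complex_chartI(1))
      show "openin Q ?U" by fact
      show "open (\<psi> ` V)" using complex_chart_open_image[OF Vc] .
      show "continuous_map (subtopology Q ?U) euclidean (\<psi> \<circ> f)"
        by (rule complex_chart_continuous_compose[OF Vc])
           (use f(1) in \<open>auto intro: continuous_map_from_subtopology\<close>)
      show "continuous_map (top_of_set (\<psi> ` V)) Q (k \<circ> inv_into V \<psi>)"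
        using complex_chart_continuous_inv[OF Vc] contk continuous_map_compose by blast
      show "(\<psi> \<circ> f) u \<in> \<psi> ` V \<and> (k \<circ> inv_into V \<psi>) ((\<psi> \<circ> f) u) = u" if "u \<in> ?U" for u
        using that complex_chart_inv(1)[OF Vc] kf by auto
      show "(k \<circ> inv_into V \<psi>) t \<in> ?U \<and> (\<psi> \<circ> f) ((k \<circ> inv_into V \<psi>) t) = t" if "t \<in> \<psi> ` V" for t
        using that complex_chart_inv[OF Vc] fk' VY kQ by auto
    qed
    \<comment> \<open>On \<open>R\<close> the pulled back coordinate
      \<open>\<psi> \<circ> f \<circ> q\<close> is \<open>\<psi> \<circ> F\<close>, which is
      holomorphic by hypothesis.\<close>
    moreover have "holomorphic_function R {x \<in> topspace X. q x \<in> ?U} (\<psi> \<circ> f \<circ> q)"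
      unfolding holomorphic_function_def
    proof (clarify)
      fix T c assume T: "(T, c) \<in> surf_atlas R"
      note Tc = R_chart[OF T]
      have TX: "T \<subseteq> topspace X" by (rule complex_chart_subset[OF Tc])
      have "(\<psi> \<circ> F \<circ> inv_into T c) holomorphic_on c ` {x \<in> T. F x \<in> V}"
        using F T V unfolding holomorphic_map_def by blast
      then have "(\<psi> \<circ> F \<circ> inv_into T c) holomorphic_on c ` (T \<inter> {x \<in> topspace X. q x \<in> ?U})"
        by (rule holomorphic_on_subset) (use f(3) in auto)
      then show "(\<psi> \<circ> f \<circ> q \<circ> inv_into T c) holomorphic_on c ` (T \<inter> {x \<in> topspace X. q x \<in> ?U})"
        by (rule holomorphic_transform) (use complex_chart_inv(1)[OF Tc] f(3) TX in auto)
    qed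
    ultimately show ?thesis by (simp add: atlas_QS)
  qed
  have "riemann_surface QS"
    unfolding riemann_surface_def top_QS
  proof (intro conjI)
    have hom: "Y homeomorphic_space Q"
      using fk homeomorphic_maps_imp_homeomorphic_space homeomorphic_space_sym by blast
    have Y: "topspace Y \<noteq> {}" "connected_space Y" "Hausdorff_space Y"
      using S unfolding riemann_surface_def Y_def by blast+
    show "topspace Q \<noteq> {}" using Y(1) kQ by blast
    show "connected_space Q" using Y(2) homeomorphic_connected_space[OF hom] by simp
    show "Hausdorff_space Q" using Y(3) homeomorphic_Hausdorff_space[OF hom] by simp
    show "\<forall>(U, \<phi>)\<in>surf_atlas QS. complex_chart Q U \<phi>"
      by (auto simp: atlas_QS)
    show "topspace Q = (\<Union>(U, \<phi>)\<in>surf_atlas QS. U)"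
    proof
      show "(\<Union>(U, \<phi>)\<in>surf_atlas QS. U) \<subseteq> topspace Q"
        using complex_chart_subset by (fastforce simp: atlas_QS)
      show "topspace Q \<subseteq> (\<Union>(U, \<phi>)\<in>surf_atlas QS. U)"
      proof
        fix u assume u: "u \<in> topspace Q"
        then obtain V \<psi> where "(V, \<psi>) \<in> surf_atlas S" "f u \<in> V" using S_cover fY by blast
        then show "u \<in> (\<Union>(U, \<phi>)\<in>surf_atlas QS. U)" using pullback u by blast
      qed
    qed
    show "\<forall>(U, \<phi>)\<in>surf_atlas QS. \<forall>(V, \<psi>)\<in>surf_atlas QS.
        (\<psi> \<circ> inv_into U \<phi>) holomorphic_on \<phi> ` (U \<inter> V)"
    proof clarify
      fix U1 \<phi>1 U2 \<phi>2 assume U1: "(U1, \<phi>1) \<in> surf_atlas QS" and U2: "(U2, \<phi>2) \<in> surf_atlas QS"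
      have c1: "complex_chart Q U1 \<phi>1" and c2: "complex_chart Q U2 \<phi>2"
        using U1 U2 by (simp_all add: atlas_QS)
      show "(\<phi>2 \<circ> inv_into U1 \<phi>1) holomorphic_on \<phi>1 ` (U1 \<inter> U2)"
      proof (rule holomorphic_on_local)
        fix w assume "w \<in> \<phi>1 ` (U1 \<inter> U2)"
        then obtain u where u: "u \<in> U1" "u \<in> U2" "w = \<phi>1 u" by auto
        have uQ: "u \<in> topspace Q" using u complex_chart_subset[OF c1] by auto
        then obtain V \<psi> where V: "(V, \<psi>) \<in> surf_atlas S" "f u \<in> V" using S_cover fY by blast
        note Vc = S_chart[OF V(1)]
        \<comment> \<open>A chart of \<open>S\<close> around \<open>f u\<close> mediates: on
          \<open>B\<close> the change between the two quotient charts factors through it.\<close>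
        define B where "B = U1 \<inter> U2 \<inter> {u \<in> topspace Q. f u \<in> V}"
        have oB: "openin Q B"
          unfolding B_def
          using openin_continuous_map_preimage[OF f(1) complex_chart_openin[OF Vc]]
            complex_chart_openin[OF c1] complex_chart_openin[OF c2] by blast
        have "open (\<phi>1 ` B)" by (rule complex_chart_open_subimage[OF c1 oB]) (auto simp: B_def)
        moreover have "w \<in> \<phi>1 ` B" using u uQ V by (auto simp: B_def)
        moreover have "((\<phi>2 \<circ> k \<circ> inv_into V \<psi>) \<circ> (\<psi> \<circ> f \<circ> inv_into U1 \<phi>1)) holomorphic_on \<phi>1 ` B"
        proof (rule holomorphic_on_compose)
          show "(\<psi> \<circ> f \<circ> inv_into U1 \<phi>1) holomorphic_on \<phi>1 ` B"
            by (rule holomorphic_on_subset[OF in_hol[OF U1 V(1)]]) (auto simp: B_def)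
          show "(\<phi>2 \<circ> k \<circ> inv_into V \<psi>) holomorphic_on (\<psi> \<circ> f \<circ> inv_into U1 \<phi>1) ` \<phi>1 ` B"
            by (rule holomorphic_on_subset[OF out_hol[OF U2 V(1)]])
               (use complex_chart_inv(1)[OF c1] kf in \<open>auto simp: B_def\<close>)
        qed
        then have "(\<phi>2 \<circ> inv_into U1 \<phi>1) holomorphic_on \<phi>1 ` B"
          by (rule holomorphic_transform)
             (use complex_chart_inv(1)[OF c1] complex_chart_inv(1)[OF Vc] kf in \<open>auto simp: B_def\<close>)
        ultimately show "\<exists>N. open N \<and> w \<in> N \<and> (\<phi>2 \<circ> inv_into U1 \<phi>1) holomorphic_on N" by blast
      qed
    qed
  qed
  moreover have "holomorphic_map QS S f" "holomorphic_map S QS k"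
    using f(1) contk in_hol out_hol by (auto simp: holomorphic_map_def top_QS Y_def)
  moreover have "homeomorphic_maps (surf_top QS) (surf_top S) f k"
    using fk by (simp add: top_QS Y_def)
  ultimately show ?thesis
    using S unfolding isomorphic_surfaces_def QS_def by blast
qed

section \<open>Projective space\<close>

lemma nonzero_vecs_scale:
  "v \<in> nonzero_vecs I \<Longrightarrow> c \<noteq> 0 \<Longrightarrow> (\<lambda>i. c * v i) \<in> nonzero_vecs I"
  by (auto simp: nonzero_vecs_def)

lemma proj_point_scale:
  assumes "c \<noteq> 0"
  shows "proj_point (\<lambda>i. c * v i) = proj_point v"
proof -
  have "(\<lambda>d i. d * v i) = (\<lambda>d i. d * (c * v i)) \<circ> (\<lambda>d. d / c)" using assms by (auto simp: fun_eq_iff)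
  moreover have "surj (\<lambda>d. d / c)" using assms by (intro surjI[of _ "\<lambda>d. d * c"]) simp
  ultimately show ?thesis unfolding proj_point_def by (metis (no_types, lifting) image_comp)
qed

lemma proj_point_eqD:
  assumes "proj_point v = proj_point w" "w \<in> nonzero_vecs I"
  shows "\<exists>c. c \<noteq> 0 \<and> w = (\<lambda>i. c * v i)"
proof -
  have "w \<in> proj_point v"
    unfolding assms(1) by (auto simp: proj_point_def intro!: image_eqI[of _ _ 1])
  then obtain c where c: "w = (\<lambda>i. c * v i)" by (auto simp: proj_point_def)
  moreover have "c \<noteq> 0" using assms(2) c by (auto simp: nonzero_vecs_def)
  ultimately show ?thesis by blast
qed

lemma continuous_on_coordinate: "continuous_on S (\<lambda>v::cvec. v i)"
  by (rule continuous_on_product_then_coordinatewise[OF continuous_on_id])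

lemma quotient_map_proj_point:
  "quotient_map (top_of_set (nonzero_vecs I)) (projective_space I) proj_point"
  unfolding projective_space_def by (rule quotient_map_quotient_topology)

lemma topspace_projective_space: "topspace (projective_space I) = proj_point ` nonzero_vecs I"
  by (simp add: projective_space_def topspace_quotient_topology)

lemma continuous_map_proj_point:
  assumes "continuous_on D h" "\<And>t. t \<in> D \<Longrightarrow> h t \<in> nonzero_vecs I"
  shows "continuous_map (top_of_set D) (projective_space I) (\<lambda>t. proj_point (h t))"
proof -
  have "continuous_map (top_of_set D) (top_of_set (nonzero_vecs I)) h"
    using assms by (auto simp: continuous_map_in_subtopology)
  from continuous_map_compose[OF this quotient_imp_continuous_map[OF quotient_map_proj_point]]
  show ?thesis by (simp add: o_def)
qed

text \<open>The ratios do not depend on the chosen representative; where the \<open>k\<close>-th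
  coordinate vanishes, all of them are 0 by the convention for division.\<close>

definition affine_coords :: "nat \<Rightarrow> cvec set \<Rightarrow> cvec" where
  "affine_coords k L = (let v = SOME v. L = proj_point v \<and> (\<exists>i. v i \<noteq> 0) in (\<lambda>i. v i / v k))"

lemma affine_coords_proj_point:
  assumes "v \<in> nonzero_vecs I"
  shows "affine_coords k (proj_point v) = (\<lambda>i. v i / v k)"
proof -
  define w where "w = (SOME w. proj_point v = proj_point w \<and> (\<exists>i. w i \<noteq> 0))"
  have "\<exists>w. proj_point v = proj_point w \<and> (\<exists>i. w i \<noteq> 0)"
    using assms by (auto simp: nonzero_vecs_def)
  then have "proj_point v = proj_point w \<and> (\<exists>i. w i \<noteq> 0)"
    unfolding w_def by (rule someI_ex)
  then obtain c where "c \<noteq> 0" "v = (\<lambda>i. c * w i)" using proj_point_eqD[OF _ assms, of w] by auto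
  then show ?thesis unfolding affine_coords_def w_def[symmetric] by (simp add: Let_def)
qed

text \<open>The conditions are invariant under scaling, so the set of vectors is saturated and its
  openness passes to the quotient.\<close>

lemma openin_projective_space_affine:
  assumes "open N"
  shows "openin (projective_space I) (proj_point ` {v \<in> nonzero_vecs I. v k \<noteq> 0 \<and> (\<lambda>i. v i / v k) \<in> N})"
    (is "openin _ (proj_point ` ?V)")
proof -
  have "{v \<in> nonzero_vecs I. proj_point v \<in> proj_point ` ?V} = ?V"
  proof (intro equalityI subsetI)
    fix v assume "v \<in> {v \<in> nonzero_vecs I. proj_point v \<in> proj_point ` ?V}"
    then obtain w where w: "v \<in> nonzero_vecs I" "proj_point w = proj_point v" "w \<in> ?V" by auto
    then obtain c where "c \<noteq> 0" "v = (\<lambda>i. c * w i)"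
      using proj_point_eqD by blast
    then show "v \<in> ?V" using w by simp
  qed auto
  moreover have "openin (top_of_set (nonzero_vecs I)) ?V"
  proof -
    let ?O = "{v::cvec. v k \<noteq> 0}"
    have "?O = (\<lambda>v. v k) -` (- {0})" by auto
    then have O: "open ?O"
      by (metis continuous_on_coordinate open_vimage open_Compl closed_singleton)
    have "continuous_on ?O (\<lambda>v i. v i / v k)"
      by (intro continuous_on_coordinatewise_then_product continuous_on_divide continuous_on_coordinate) auto
    from continuous_open_preimage[OF this O assms]
    have o: "open (?O \<inter> (\<lambda>v i. v i / v k) -` N)" .
    have "?V = nonzero_vecs I \<inter> (?O \<inter> (\<lambda>v i. v i / v k) -` N)" by auto
    with openin_open_Int[OF o] show ?thesis by simp
  qed
  ultimately show ?thesis
    unfolding projective_space_def openin_quotient_topology by auto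
qed

text \<open>Over an open saturated set \<open>proj_point\<close> remains a quotient map, so
  continuity can be tested on vectors, where it is that of division.\<close>

lemma continuous_map_affine_coords:
  "continuous_map (subtopology (projective_space I) (proj_point ` {v \<in> nonzero_vecs I. v k \<noteq> 0}))
     euclidean (affine_coords k)"
proof -
  let ?V = "{v \<in> nonzero_vecs I. v k \<noteq> 0}"
  have op: "openin (projective_space I) (proj_point ` ?V)"
    using openin_projective_space_affine[of UNIV] by simp
  have "{v \<in> nonzero_vecs I. proj_point v \<in> proj_point ` ?V} = ?V"
  proof (intro equalityI subsetI)
    fix v assume "v \<in> {v \<in> nonzero_vecs I. proj_point v \<in> proj_point ` ?V}"
    then obtain w where w: "v \<in> nonzero_vecs I" "proj_point w = proj_point v" "w \<in> ?V" by auto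
    then obtain c where "c \<noteq> 0" "v = (\<lambda>i. c * w i)"
      using proj_point_eqD by blast
    then show "v \<in> ?V" using w by simp
  qed auto
  then have "quotient_map (subtopology (top_of_set (nonzero_vecs I)) ?V)
      (subtopology (projective_space I) (proj_point ` ?V)) proj_point"
    by (intro quotient_map_restriction[OF quotient_map_proj_point]) (use op in auto)
  moreover have "subtopology (top_of_set (nonzero_vecs I)) ?V = top_of_set ?V"
    by (simp add: subtopology_subtopology Int_absorb1 Collect_mono_iff subset_eq)
  ultimately have qm: "quotient_map (top_of_set ?V) (subtopology (projective_space I) (proj_point ` ?V)) proj_point"
    by simp
  have "continuous_map (top_of_set ?V) euclidean (affine_coords k \<circ> proj_point)"
  proof (rule continuous_map_eq[where f = "\<lambda>v i. v i / v k"])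
    show "continuous_map (top_of_set ?V) euclidean (\<lambda>v i. v i / v k)"
      unfolding continuous_map_iff_continuous
      by (intro continuous_on_coordinatewise_then_product continuous_on_divide continuous_on_coordinate) auto
  qed (auto simp: affine_coords_proj_point)
  then show ?thesis by (rule continuous_compose_quotient_map[OF qm])
qed

text \<open>The hermitian projections \<open>v v\<^sup>*/|v|\<^sup>2\<close> embed projective space into a Hausdorff space.\<close>

lemma Hausdorff_projective_space:
  assumes "finite I"
  shows "Hausdorff_space (projective_space I)"
proof -
  define S :: "cvec \<Rightarrow> complex" where "S v = (\<Sum>i\<in>I. of_real ((norm (v i))\<^sup>2))" for v
  define H where "H v = (\<lambda>i j. v i * cnj (v j) / S v)" for v :: cvec
  have S0: "S v \<noteq> 0" if v: "v \<in> nonzero_vecs I" for v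
  proof -
    obtain i where i: "i \<in> I" "v i \<noteq> 0" using v unfolding nonzero_vecs_def by blast
    have "(\<Sum>i\<in>I. (norm (v i))\<^sup>2) > 0"
      by (rule sum_pos2[OF assms i(1)]) (use i in auto)
    then show ?thesis unfolding S_def by (metis less_irrefl of_real_eq_0_iff of_real_sum)
  qed
  have HS: "H v = H w" if vw: "v \<in> nonzero_vecs I" "w \<in> nonzero_vecs I" "proj_point v = proj_point w" for v w
  proof -
    obtain c where c: "c \<noteq> 0" "w = (\<lambda>i. c * v i)"
      using vw proj_point_eqD by blast
    have "S w = c * cnj c * S v"
      unfolding S_def c(2) norm_mult power_mult_distrib sum_distrib_left
      by (simp add: complex_norm_square flip: of_real_power)
    then show ?thesis using c(1) S0[OF vw(1)] unfolding H_def c(2) by (simp add: fun_eq_iff)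
  qed
  have contH: "continuous_on (nonzero_vecs I) H"
    unfolding H_def S_def
    by (intro continuous_on_coordinatewise_then_product continuous_on_divide continuous_on_mult
        continuous_on_cnj continuous_on_coordinate continuous_on_sum continuous_on_of_real
        continuous_on_power continuous_on_norm ballI S0[unfolded S_def])
  have cH: "continuous_map (top_of_set (nonzero_vecs I)) euclidean H" using contH by simp
  have HS': "H v = H w" if "v \<in> topspace (top_of_set (nonzero_vecs I))"
      "w \<in> topspace (top_of_set (nonzero_vecs I))" "proj_point v = proj_point w" for v w
    by (rule HS) (use that in simp_all)
  obtain g where g: "continuous_map (projective_space I) euclidean g"
      and "g ` topspace (projective_space I) = H ` topspace (top_of_set (nonzero_vecs I))"
      and "\<And>v. v \<in> topspace (top_of_set (nonzero_vecs I)) \<Longrightarrow> g (proj_point v) = H v"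
    by (rule quotient_map_lift_exists[OF quotient_map_proj_point cH]) (rule HS', assumption+, rule that, assumption, assumption, simp)
  then have gH: "\<And>v. v \<in> nonzero_vecs I \<Longrightarrow> g (proj_point v) = H v" by simp
  have "inj_on g (topspace (projective_space I))"
  proof (rule inj_onI)
    fix L M assume "L \<in> topspace (projective_space I)" "M \<in> topspace (projective_space I)" and e: "g L = g M"
    then obtain v w where vw: "v \<in> nonzero_vecs I" "w \<in> nonzero_vecs I" "L = proj_point v" "M = proj_point w"
      by (auto simp: topspace_projective_space)
    then have H: "v i * cnj (v j) / S v = w i * cnj (w j) / S w" for i j
      using e gH by (auto simp: H_def fun_eq_iff)
    obtain j where j: "v j \<noteq> 0" using vw by (auto simp: nonzero_vecs_def)
    have "w j \<noteq> 0" using H[of j j] j S0 vw by auto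
    \<comment> \<open>The factor is read off from the \<open>j\<close>-th columns of the two equal
      projections.\<close>
    define c where "c = cnj (w j) * S v / (S w * cnj (v j))"
    have "c \<noteq> 0" using j \<open>w j \<noteq> 0\<close> S0 vw by (simp add: c_def)
    moreover have "v = (\<lambda>i. c * w i)"
      using H[of _ j] j S0[OF vw(1)] S0[OF vw(2)] by (auto simp: c_def fun_eq_iff field_simps)
    ultimately show "L = M" using vw proj_point_scale by auto
  qed
  then show ?thesis
    using Hausdorff_space_injective_preimage[OF _ g] Hausdorff_space_euclidean by blast
qed

text \<open>A cone meets the non-zero vectors in a saturated set, so its closedness passes to the
  quotient.\<close>

lemma closedin_projective_cone:
  assumes "closed Z" "\<And>v c. v \<in> Z \<Longrightarrow> (\<lambda>i. c * v i) \<in> Z"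
  shows "closedin (projective_space I) (proj_point ` {v \<in> nonzero_vecs I. v \<in> Z})"
proof -
  let ?C = "proj_point ` {v \<in> nonzero_vecs I. v \<in> Z}"
  have "{v \<in> nonzero_vecs I. proj_point v \<in> ?C} = nonzero_vecs I \<inter> Z"
  proof (intro equalityI subsetI)
    fix v assume "v \<in> {v \<in> nonzero_vecs I. proj_point v \<in> ?C}"
    then obtain w where w: "v \<in> nonzero_vecs I" "proj_point w = proj_point v" "w \<in> Z" by auto
    then obtain c where "v = (\<lambda>i. c * w i)"
      using proj_point_eqD by blast
    then show "v \<in> nonzero_vecs I \<inter> Z" using w assms by simp
  qed auto
  moreover have "closedin (top_of_set (nonzero_vecs I)) (nonzero_vecs I \<inter> Z)"
    using assms(1) by (simp add: closedin_closed_Int)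
  moreover have sub: "?C \<subseteq> topspace (projective_space I)"
    by (auto simp: topspace_projective_space)
  have "closedin (top_of_set (nonzero_vecs I))
      {v \<in> topspace (top_of_set (nonzero_vecs I)). proj_point v \<in> ?C} = closedin (projective_space I) ?C"
    using quotient_map_proj_point[of I] sub unfolding quotient_map_closedin by blast
  ultimately show ?thesis by simp
qed

text \<open>Dividing by a coordinate of largest modulus represents each point by a vector with one
  coordinate 1 and all others in the closed unit disc. Such vectors form finitely many compact
  products, one for each position of the 1.\<close>

lemma compactin_projective_cone:
  assumes "finite I" "closed Z" "\<And>v c. v \<in> Z \<Longrightarrow> (\<lambda>i. c * v i) \<in> Z"
  shows "compactin (projective_space I) (proj_point ` {v \<in> nonzero_vecs I. v \<in> Z})"
proof -
  define B where "B k = (\<Pi>\<^sub>E i\<in>UNIV. if i = k then {1} else if i \<in> I then cball (0::complex) 1 else {0})" for k :: nat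
  have cB: "compact (B k)" for k
  proof -
    have "compactin (product_topology (\<lambda>i. euclidean) UNIV) (B k)"
      unfolding B_def compactin_PiE by auto
    then show ?thesis by (simp add: euclidean_product_topology)
  qed
  have BD: "v k = 1" "v i \<in> (if i = k then {1} else if i \<in> I then cball (0::complex) 1 else {0})" if "v \<in> B k" for v k i
    using PiE_mem[OF that[unfolded B_def], of k] PiE_mem[OF that[unfolded B_def], of i] by auto
  define K where "K = (\<Union>k\<in>I. B k \<inter> Z)"
  have cK: "compact K" unfolding K_def
    using assms cB by (intro compact_UN) (auto intro: compact_Int_closed)
  have KI: "K \<subseteq> {v \<in> nonzero_vecs I. v \<in> Z}"
  proof
    fix v assume "v \<in> K"
    then obtain k where k: "k \<in> I" "v \<in> B k" "v \<in> Z" by (auto simp: K_def)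
    have "v i = 0" if "i \<notin> I" for i using BD(2)[OF k(2), of i] that k(1) by (auto split: if_splits)
    then show "v \<in> {v \<in> nonzero_vecs I. v \<in> Z}"
      using BD(1)[OF k(2)] k(3) by (auto simp: nonzero_vecs_def intro!: exI[of _ k])
  qed
  have "proj_point ` {v \<in> nonzero_vecs I. v \<in> Z} = proj_point ` K"
  proof (intro equalityI subsetI)
    fix L assume "L \<in> proj_point ` {v \<in> nonzero_vecs I. v \<in> Z}"
    then obtain v where v: "v \<in> nonzero_vecs I" "v \<in> Z" "L = proj_point v" by auto
    then obtain j where j: "j \<in> I" "v j \<noteq> 0" unfolding nonzero_vecs_def by blast
    let ?M = "Max ((\<lambda>i. norm (v i)) ` I)"
    have "?M \<in> (\<lambda>i. norm (v i)) ` I" using assms(1) j by (intro Max_in) auto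
    then obtain k where k: "k \<in> I" "norm (v k) = ?M" by auto
    have le: "norm (v i) \<le> norm (v k)" if "i \<in> I" for i
      unfolding k(2) using assms(1) that by (intro Max_ge) auto
    have vk: "v k \<noteq> 0" using le[OF j(1)] j(2) by auto
    let ?w = "\<lambda>i. inverse (v k) * v i"
    have "?w \<in> B k"
      using le vk v(1) by (auto simp: B_def PiE_iff norm_mult norm_inverse norm_divide divide_simps nonzero_vecs_def)
    then have "?w \<in> K" using k assms(3)[OF v(2)] by (auto simp: K_def)
    moreover have "L = proj_point ?w" using v vk proj_point_scale[of "inverse (v k)" v] by simp
    ultimately show "L \<in> proj_point ` K" by blast
  qed (use KI in auto)
  moreover have "compactin (projective_space I) (proj_point ` K)"
    by (rule image_compactin[OF _ quotient_imp_continuous_map[OF quotient_map_proj_point]])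
       (use cK KI in \<open>auto simp: compactin_subtopology\<close>)
  ultimately show ?thesis by simp
qed

section \<open>Curves in projective space\<close>

text \<open>Weaker than \<open>holomorphic_immersion\<close>: the condition on the minors is
  dropped, because it is lost when a parametrization is followed by a ramified map.\<close>

definition projective_holomorphic :: "nat set \<Rightarrow> complex set \<Rightarrow> (complex \<Rightarrow> cvec set) \<Rightarrow> bool" where
  "projective_holomorphic I D p \<longleftrightarrow>
     (\<forall>t0 \<in> D. \<exists>W (h :: complex \<Rightarrow> cvec). open W \<and> t0 \<in> W \<and> W \<subseteq> D \<and>
        (\<forall>i. (\<lambda>t. h t i) holomorphic_on W) \<and>
        (\<forall>t \<in> W. h t \<in> nonzero_vecs I \<and> p t = proj_point (h t)))"

lemma projective_holomorphic_immersion: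
  "holomorphic_immersion I D p \<Longrightarrow> projective_holomorphic I D p"
  unfolding holomorphic_immersion_def projective_holomorphic_def by meson

lemma projective_holomorphic_subset:
  assumes "projective_holomorphic I D p" "open E" "E \<subseteq> D"
  shows "projective_holomorphic I E p"
  unfolding projective_holomorphic_def
proof
  fix t0 assume t0: "t0 \<in> E"
  then obtain W h where W: "open W" "t0 \<in> W" "W \<subseteq> D" "\<And>i. (\<lambda>t. h t i) holomorphic_on W"
      "\<And>t. t \<in> W \<Longrightarrow> h t \<in> nonzero_vecs I \<and> p t = proj_point (h t)"
    using assms(1,3) unfolding projective_holomorphic_def by (meson subsetD)
  then show "\<exists>W (h :: complex \<Rightarrow> cvec). open W \<and> t0 \<in> W \<and> W \<subseteq> E \<and>
        (\<forall>i. (\<lambda>t. h t i) holomorphic_on W) \<and>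
        (\<forall>t \<in> W. h t \<in> nonzero_vecs I \<and> p t = proj_point (h t))"
    using assms(2) t0
    by (intro exI[of _ "W \<inter> E"] exI[of _ h]) (auto intro: holomorphic_on_subset)
qed

lemma surf_top_projective_curve: "surf_top (projective_curve I C) = subtopology (projective_space I) C"
  by (simp add: projective_curve_def Let_def)

lemma surf_atlas_projective_curve:
  "(U, \<phi>) \<in> surf_atlas (projective_curve I C) \<longleftrightarrow>
     complex_chart (subtopology (projective_space I) C) U \<phi> \<and>
     holomorphic_immersion I (\<phi> ` U) (inv_into U \<phi>)"
  by (simp add: projective_curve_def Let_def)

lemma proj_point_cross_ratio:
  assumes "proj_point v = proj_point w" "v \<in> nonzero_vecs I" "w \<in> nonzero_vecs I" "v i \<noteq> 0"
  shows "w i \<noteq> 0" "w j / w i = v j / v i"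
proof -
  obtain c where "c \<noteq> 0" "w = (\<lambda>i. c * v i)"
    using assms proj_point_eqD by blast
  then show "w i \<noteq> 0" "w j / w i = v j / v i" using assms(4) by auto
qed

text \<open>Along an immersed chart some ratio of homogeneous coordinates has non-zero derivative,
  so the chart coordinate is locally a holomorphic function of that ratio. Along
  \<open>\<gamma>\<close> the same ratio is holomorphic, whichever lift is used to compute
  it.\<close>

lemma projective_chart_holomorphic:
  assumes V: "(V, \<psi>) \<in> surf_atlas (projective_curve I C)"
    and \<gamma>: "projective_holomorphic I S \<gamma>" "\<gamma> ` S \<subseteq> V"
  shows "(\<psi> \<circ> \<gamma>) holomorphic_on S"
proof (rule holomorphic_on_local)
  let ?X = "subtopology (projective_space I) C"
  fix t0 assume t0: "t0 \<in> S"
  have Vc: "complex_chart ?X V \<psi>" and Vi: "holomorphic_immersion I (\<psi> ` V) (inv_into V \<psi>)"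
    using V by (simp_all add: surf_atlas_projective_curve)
  obtain W k where W: "open W" "t0 \<in> W" "W \<subseteq> S" "\<And>i. (\<lambda>t. k t i) holomorphic_on W"
      and k: "\<And>t. t \<in> W \<Longrightarrow> k t \<in> nonzero_vecs I \<and> \<gamma> t = proj_point (k t)"
    using \<gamma>(1) t0 unfolding projective_holomorphic_def by meson
  define w0 where "w0 = \<psi> (\<gamma> t0)"
  have \<gamma>V: "\<gamma> t \<in> V" if "t \<in> W" for t using \<gamma>(2) W(3) that by auto
  have "w0 \<in> \<psi> ` V" using \<gamma>V W(2) by (auto simp: w0_def)
  then obtain W' h i j where W': "open W'" "w0 \<in> W'" "W' \<subseteq> \<psi> ` V" "\<And>i. (\<lambda>t. h t i) holomorphic_on W'"
      and h: "\<And>t. t \<in> W' \<Longrightarrow> h t \<in> nonzero_vecs I \<and> inv_into V \<psi> t = proj_point (h t)"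
      and ij: "h w0 i * deriv (\<lambda>s. h s j) w0 \<noteq> h w0 j * deriv (\<lambda>s. h s i) w0"
    using Vi unfolding holomorphic_immersion_def by metis
  \<comment> \<open>If the minor is non-zero, one of its two coordinates is non-zero at
    \<open>w0\<close>; after exchanging the indices it can serve as denominator.\<close>
  have "\<exists>i j. h w0 i \<noteq> 0 \<and> h w0 i * deriv (\<lambda>s. h s j) w0 \<noteq> h w0 j * deriv (\<lambda>s. h s i) w0"
    using ij by (metis mult_zero_left)
  then obtain i j where i0: "h w0 i \<noteq> 0"
      and ij: "h w0 i * deriv (\<lambda>s. h s j) w0 \<noteq> h w0 j * deriv (\<lambda>s. h s i) w0"
    by blast
  define W1 where "W1 = {t \<in> W'. h t i \<noteq> 0}"
  have "W1 = W' \<inter> (\<lambda>t. h t i) -` (- {0})" by (auto simp: W1_def)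
  then have oW1: "open W1"
    using continuous_open_preimage[OF holomorphic_on_imp_continuous_on[OF W'(4)] W'(1), of "- {0}"] by auto
  define \<rho> where "\<rho> t = h t j / h t i" for t
  have h\<rho>: "\<rho> holomorphic_on W1"
    unfolding \<rho>_def
    by (intro holomorphic_on_divide holomorphic_on_subset[OF W'(4)]) (auto simp: W1_def)
  have w01: "w0 \<in> W1" using W' i0 by (auto simp: W1_def)
  have dj: "((\<lambda>t. h t l) has_field_derivative deriv (\<lambda>t. h t l) w0) (at w0)" for l
    using holomorphic_derivI[OF W'(4,1,2)] .
  \<comment> \<open>The numerator in the quotient rule is the minor of the immersion
    condition.\<close>
  have "(\<rho> has_field_derivative (deriv (\<lambda>t. h t j) w0 * h w0 i - h w0 j * deriv (\<lambda>t. h t i) w0) / (h w0 i * h w0 i)) (at w0)"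
    unfolding \<rho>_def by (rule DERIV_divide[OF dj dj i0])
  then have "deriv \<rho> w0 = (deriv (\<lambda>t. h t j) w0 * h w0 i - h w0 j * deriv (\<lambda>t. h t i) w0) / (h w0 i * h w0 i)"
    by (rule DERIV_imp_deriv)
  then have "deriv \<rho> w0 \<noteq> 0" using ij i0 by (simp add: mult.commute)
  then obtain r where r: "r > 0" "ball w0 r \<subseteq> W1" "open (\<rho> ` ball w0 r)" "inj_on \<rho> (ball w0 r)"
    using has_complex_derivative_locally_invertible[OF h\<rho> w01 oW1] by metis
  obtain \<tau> where \<tau>: "\<tau> holomorphic_on \<rho> ` ball w0 r" "\<And>x. x \<in> ball w0 r \<Longrightarrow> \<tau> (\<rho> x) = x"
    using holomorphic_has_inverse[OF holomorphic_on_subset[OF h\<rho> r(2)] open_ball r(4)] by metis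
  have VC: "V \<subseteq> C" using complex_chart_subset[OF Vc] by auto
  have "continuous_on W k"
    using W(4) by (intro continuous_on_coordinatewise_then_product holomorphic_on_imp_continuous_on)
  then have "continuous_map (top_of_set W) (projective_space I) (\<lambda>t. proj_point (k t))"
    by (rule continuous_map_proj_point) (use k in auto)
  then have "continuous_map (top_of_set W) (projective_space I) \<gamma>"
    by (rule continuous_map_eq) (use k in auto)
  then have "continuous_map (top_of_set W) ?X \<gamma>"
    using \<gamma>V VC by (auto simp: continuous_map_in_subtopology)
  then have "continuous_map (top_of_set W) euclidean (\<psi> \<circ> \<gamma>)"
    by (rule complex_chart_continuous_compose[OF Vc]) (use \<gamma>V in auto)
  then have c: "continuous_on W (\<psi> \<circ> \<gamma>)" by simp
  \<comment> \<open>Continuity of \<open>\<psi> \<circ> \<gamma>\<close>, established beforehand,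
    makes \<open>N\<close> open; on it the chart coordinate stays where \<open>\<tau>\<close>
    inverts \<open>\<rho>\<close>.\<close>
  define N where "N = W \<inter> (\<psi> \<circ> \<gamma>) -` ball w0 r"
  have oN: "open N" unfolding N_def using c W(1) continuous_open_preimage by blast
  have tN: "t0 \<in> N" using W(2) r(1) by (simp add: N_def w0_def)
  have eq: "k t i \<noteq> 0 \<and> k t j / k t i = \<rho> (\<psi> (\<gamma> t))" if "t \<in> N" for t
  proof -
    let ?u = "\<psi> (\<gamma> t)"
    have u: "?u \<in> W1" "t \<in> W" using that r(2) by (auto simp: N_def)
    then have uW: "?u \<in> W'" "h ?u i \<noteq> 0" by (auto simp: W1_def)
    have "proj_point (h ?u) = proj_point (k t)"
      using h[OF uW(1)] k[OF u(2)] complex_chart_inv(1)[OF Vc \<gamma>V[OF u(2)]] by metis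
    from proj_point_cross_ratio(1)[OF this, of I i] proj_point_cross_ratio(2)[OF this, of I i j] show ?thesis
      using h[OF uW(1)] k[OF u(2)] uW(2) by (simp add: \<rho>_def)
  qed
  have hk: "(\<lambda>t. k t j / k t i) holomorphic_on N"
    by (intro holomorphic_on_divide holomorphic_on_subset[OF W(4)]) (use eq in \<open>auto simp: N_def\<close>)
  have "(\<tau> \<circ> (\<lambda>t. k t j / k t i)) holomorphic_on N"
    by (rule holomorphic_on_compose[OF hk], rule holomorphic_on_subset[OF \<tau>(1)])
       (use eq in \<open>auto simp: N_def\<close>)
  then have "(\<psi> \<circ> \<gamma>) holomorphic_on N"
    by (rule holomorphic_transform) (use eq \<tau>(2) in \<open>auto simp: N_def\<close>)
  then show "\<exists>N. open N \<and> t0 \<in> N \<and> (\<psi> \<circ> \<gamma>) holomorphic_on N"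
    using oN tN by blast
qed

text \<open>Compatibility of charts is automatic, since the inverse of a chart is a holomorphic
  parametrization, and the Hausdorff property comes from projective space. For a concrete curve only
  connectedness and a covering by charts have to be supplied.\<close>

lemma riemann_surface_projective_curve:
  assumes "finite I" "C \<noteq> {}" "C \<subseteq> topspace (projective_space I)"
    and "connected_space (subtopology (projective_space I) C)"
    and cover: "\<And>L. L \<in> C \<Longrightarrow> \<exists>U \<phi>. (U, \<phi>) \<in> surf_atlas (projective_curve I C) \<and> L \<in> U"
  shows "riemann_surface (projective_curve I C)"
  unfolding riemann_surface_def surf_top_projective_curve
proof (intro conjI)
  let ?X = "subtopology (projective_space I) C"
  have ts: "topspace ?X = C" using assms(3) by (auto simp: inf_absorb2)
  show "topspace ?X \<noteq> {}" using assms(2) ts by simp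
  show "connected_space ?X" by fact
  show "Hausdorff_space ?X" using Hausdorff_projective_space[OF assms(1)] Hausdorff_space_subtopology by blast
  show "\<forall>(U, \<phi>)\<in>surf_atlas (projective_curve I C). complex_chart ?X U \<phi>"
    by (auto simp: surf_atlas_projective_curve)
  show "topspace ?X = (\<Union>(U, \<phi>)\<in>surf_atlas (projective_curve I C). U)"
  proof
    show "topspace ?X \<subseteq> (\<Union>(U, \<phi>)\<in>surf_atlas (projective_curve I C). U)"
      unfolding ts using cover by blast
    show "(\<Union>(U, \<phi>)\<in>surf_atlas (projective_curve I C). U) \<subseteq> topspace ?X"
      using complex_chart_subset by (fastforce simp: surf_atlas_projective_curve)
  qed
  show "\<forall>(U, \<phi>)\<in>surf_atlas (projective_curve I C). \<forall>(V, \<psi>)\<in>surf_atlas (projective_curve I C).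
      (\<psi> \<circ> inv_into U \<phi>) holomorphic_on \<phi> ` (U \<inter> V)"
  proof clarify
    fix U \<phi> V \<psi>
    assume U: "(U, \<phi>) \<in> surf_atlas (projective_curve I C)" and V: "(V, \<psi>) \<in> surf_atlas (projective_curve I C)"
    have Uc: "complex_chart ?X U \<phi>" and Vc: "complex_chart ?X V \<psi>"
      using U V by (simp_all add: surf_atlas_projective_curve)
    have "open (\<phi> ` (U \<inter> V))"
      by (rule complex_chart_open_subimage[OF Uc]) (use complex_chart_openin[OF Uc] complex_chart_openin[OF Vc] in auto)
    moreover have "projective_holomorphic I (\<phi> ` U) (inv_into U \<phi>)"
      using U projective_holomorphic_immersion by (simp add: surf_atlas_projective_curve)
    ultimately have "projective_holomorphic I (\<phi> ` (U \<inter> V)) (inv_into U \<phi>)"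
      using projective_holomorphic_subset by (metis Int_lower1 image_mono)
    then show "(\<psi> \<circ> inv_into U \<phi>) holomorphic_on \<phi> ` (U \<inter> V)"
      by (rule projective_chart_holomorphic[OF V]) (use complex_chart_inv(1)[OF Uc] in auto)
  qed
qed

text \<open>A recipe for charts in the affine piece where the \<open>k\<close>-th coordinate is 1:
  \<open>h\<close> parametrizes the curve inside the open set \<open>N\<close>, and
  \<open>\<Phi>\<close> recovers the parameter from the affine coordinates.\<close>

lemma projective_curve_chartI:
  assumes C: "C \<subseteq> topspace (projective_space I)"
    and D: "open D" and N: "open N"
    and \<Phi>: "continuous_on N \<Phi>"
    and h: "\<And>i. (\<lambda>t. h t i) holomorphic_on D"
    and hC: "\<And>t. t \<in> D \<Longrightarrow> h t \<in> nonzero_vecs I \<and> h t k = 1 \<and> proj_point (h t) \<in> C \<and> h t \<in> N \<and> \<Phi> (h t) = t"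
    and minor: "\<And>t. t \<in> D \<Longrightarrow> \<exists>i j. h t i * deriv (\<lambda>s. h s j) t \<noteq> h t j * deriv (\<lambda>s. h s i) t"
    and \<Phi>D: "\<And>v. v \<in> nonzero_vecs I \<Longrightarrow> v k = 1 \<Longrightarrow> v \<in> N \<Longrightarrow> proj_point v \<in> C \<Longrightarrow> \<Phi> v \<in> D \<and> h (\<Phi> v) = v"
    and L: "v0 \<in> nonzero_vecs I" "v0 k = 1" "v0 \<in> N" "proj_point v0 \<in> C"
  shows "\<exists>U \<phi>. (U, \<phi>) \<in> surf_atlas (projective_curve I C) \<and> proj_point v0 \<in> U"
proof -
  let ?X = "subtopology (projective_space I) C"
  let ?V = "{v \<in> nonzero_vecs I. v k \<noteq> 0 \<and> (\<lambda>i. v i / v k) \<in> N}"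
  define U where "U = proj_point ` ?V \<inter> C"
  define \<phi> where "\<phi> = \<Phi> \<circ> affine_coords k"
  have oU: "openin ?X U"
    unfolding U_def using openin_projective_space_affine[OF N] by (rule openin_subtopology_Int)
  have UE: "\<exists>v. v \<in> nonzero_vecs I \<and> v k = 1 \<and> v \<in> N \<and> proj_point v = L \<and> proj_point v \<in> C \<and> affine_coords k L = v"
    if LU: "L \<in> U" for L
  proof -
    obtain v where v: "v \<in> ?V" "L = proj_point v" "L \<in> C" using LU by (auto simp: U_def)
    let ?w = "\<lambda>i. inverse (v k) * v i"
    have w: "?w = (\<lambda>i. v i / v k)" by (auto simp: field_simps)
    have "?w \<in> nonzero_vecs I" using v nonzero_vecs_scale[of v I "inverse (v k)"] by auto
    moreover have "proj_point ?w = L" using v proj_point_scale[of "inverse (v k)" v] by auto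
    moreover have "affine_coords k L = ?w" using v affine_coords_proj_point[of v I k] w by auto
    ultimately show ?thesis using v w by (intro exI[of _ ?w]) auto
  qed
  have hU: "proj_point (h t) \<in> U" "affine_coords k (proj_point (h t)) = h t" if "t \<in> D" for t
    using hC[OF that] affine_coords_proj_point[of "h t" I k] by (auto simp: U_def)
  have "continuous_map (subtopology ?X U) euclidean (affine_coords k)"
  proof -
    have "subtopology ?X U = subtopology (projective_space I) U"
      by (simp add: subtopology_subtopology U_def Int_absorb1)
    moreover have "U \<subseteq> proj_point ` {v \<in> nonzero_vecs I. v k \<noteq> 0}" by (auto simp: U_def)
    ultimately show "continuous_map (subtopology ?X U) euclidean (affine_coords k)"
      using continuous_map_from_subtopology_mono[OF continuous_map_affine_coords[of I k], of U] by simp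
  qed
  then have "continuous_map (subtopology ?X U) (top_of_set N) (affine_coords k)"
    using UE by (auto simp: continuous_map_in_subtopology image_subset_iff)
  then have c\<phi>: "continuous_map (subtopology ?X U) euclidean \<phi>"
    unfolding \<phi>_def by (rule continuous_map_compose) (use \<Phi> in auto)
  have ch: "continuous_map (top_of_set D) ?X (\<lambda>t. proj_point (h t))"
    unfolding continuous_map_in_subtopology
  proof
    show "continuous_map (top_of_set D) (projective_space I) (\<lambda>t. proj_point (h t))"
      by (rule continuous_map_proj_point)
         (use h hC in \<open>auto intro!: continuous_on_coordinatewise_then_product holomorphic_on_imp_continuous_on\<close>)
  qed (use hC in auto)
  have 1: "\<phi> L \<in> D \<and> proj_point (h (\<phi> L)) = L" if "L \<in> U" for L
    using UE[OF that] \<Phi>D by (auto simp: \<phi>_def)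
  have 2: "proj_point (h t) \<in> U \<and> \<phi> (proj_point (h t)) = t" if "t \<in> D" for t
    using hU[OF that] hC[OF that] by (auto simp: \<phi>_def)
  have im: "\<phi> ` U = D" by (rule complex_chartI(2)[OF oU D c\<phi> ch 1 2])
  have inv: "inv_into U \<phi> t = proj_point (h t)" if "t \<in> D" for t
    by (rule complex_chartI(3)[OF oU D c\<phi> ch 1 2 that])
  have "holomorphic_immersion I (\<phi> ` U) (inv_into U \<phi>)"
    unfolding holomorphic_immersion_def im
    using D h hC minor inv by (intro ballI exI[of _ D] exI[of _ h]) auto
  then have "(U, \<phi>) \<in> surf_atlas (projective_curve I C)"
    using complex_chartI(1)[OF oU D c\<phi> ch 1 2] by (simp add: surf_atlas_projective_curve)
  moreover have "proj_point v0 \<in> U"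
    using L by (auto simp: U_def)
  ultimately show ?thesis by blast
qed

section \<open>The elliptic curve\<close>

text \<open>A nonempty clopen subset projects onto the whole plane, hence contains the only point above \<open>x0\<close>.\<close>

lemma connected_double_cover:
  fixes p :: "complex \<Rightarrow> complex"
  assumes p: "continuous_on UNIV p" "p x0 = 0"
  shows "connected {(x, y). y\<^sup>2 = p x}"
proof -
  let ?S = "{(x, y). y\<^sup>2 = p x}"
  have cS: "closed ?S"
  proof -
    have "closed {z. (snd z)\<^sup>2 = p (fst z)}"
      by (intro closed_Collect_eq continuous_intros continuous_on_compose2[OF p(1)]) auto
    moreover have "{z. (snd z)\<^sup>2 = p (fst z)} = ?S" by auto
    ultimately show ?thesis by simp
  qed
  have all: "fst ` T = UNIV" if T: "openin (top_of_set ?S) T" "closedin (top_of_set ?S) T" "T \<noteq> {}" for T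
  proof -
    have TS: "T \<subseteq> ?S" using T(1) openin_imp_subset by blast
    have cT: "closed T" using T(2) cS closedin_closed_trans by blast
    obtain O' where O': "open O'" "T = ?S \<inter> O'" using T(1) by (auto simp: openin_open)
    have "open (fst ` T)"
      unfolding open_dist
    proof
      fix x assume "x \<in> fst ` T"
      then obtain y where xy: "(x, y) \<in> T" by auto
      obtain e where e: "e > 0" "\<And>z. dist z (x, y) < e \<Longrightarrow> z \<in> O'"
        using O' xy unfolding open_dist by blast
      have "isCont p x" using p(1) by (simp add: continuous_on_eq_continuous_at)
      then obtain d where d: "d > 0" "\<And>x'. dist x' x < d \<Longrightarrow> dist (p x') (p x) < (e / 2)\<^sup>2"
        using e(1) unfolding continuous_at_eps_delta by (metis half_gt_zero zero_less_power)
      show "\<exists>d>0. \<forall>x'. dist x' x < d \<longrightarrow> x' \<in> fst ` T"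
      proof (intro exI[of _ "min d (e / 2)"] conjI allI impI)
        fix x' assume x': "dist x' x < min d (e / 2)"
        let ?r = "csqrt (p x')"
        \<comment> \<open>A small product has a small factor, so one of the two square roots over
          \<open>x'\<close> is close to \<open>y\<close>; hence the projection is open.\<close>
        have "(?r - y) * (?r + y) = p x' - p x"
          using xy TS by (auto simp: algebra_simps power2_eq_square[symmetric])
        then have "norm (?r - y) * norm (?r + y) < (e / 2)\<^sup>2"
          using d(2)[of x'] x' by (simp add: dist_norm flip: norm_mult)
        then have "norm (?r - y) < e / 2 \<or> norm (?r + y) < e / 2"
          using mult_mono[of "e / 2" "norm (?r - y)" "e / 2" "norm (?r + y)"] e(1)
          by (force simp: power2_eq_square not_less)
        then obtain y' where y': "y'\<^sup>2 = p x'" "norm (y' - y) < e / 2"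
        proof
          assume "norm (?r + y) < e / 2"
          moreover have "- ?r - y = - (?r + y)" by simp
          ultimately have "norm (- ?r - y) < e / 2" by (simp only: norm_minus_cancel)
          then show ?thesis by (intro that[of "- ?r"]) simp_all
        qed (use that[of ?r] in simp)
        have "dist (x', y') (x, y) < e"
          using x' y'(2) sqrt_sum_squares_le_sum[of "dist x' x" "dist y' y"]
          by (simp add: dist_Pair_Pair flip: dist_norm)
        then have "(x', y') \<in> T" using e(2) y'(1) O'(2) by auto
        then show "x' \<in> fst ` T" by force
      qed (use d e in simp)
    qed
    moreover have "closed (fst ` T)"
    proof -
      have "l \<in> fst ` T" if l: "l \<in> closure (fst ` T)" for l
      proof -
        \<comment> \<open>Over a disc the values of \<open>p\<close>, hence their square roots, are
          bounded; this properness makes the projection closed.\<close>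
        have "compact (p ` cball l 1)"
          by (intro compact_continuous_image continuous_on_subset[OF p(1)] subset_UNIV compact_cball)
        then obtain M where M: "\<And>x. x \<in> cball l 1 \<Longrightarrow> norm (p x) \<le> M"
          by (metis compact_imp_bounded bounded_iff imageI)
        let ?K = "T \<inter> (cball l 1 \<times> cball 0 (sqrt M))"
        have "compact ?K"
          using cT by (intro closed_Int_compact compact_Times compact_cball)
        then have "compact (fst ` ?K)"
          by (intro compact_continuous_image continuous_intros)
        then have cK: "closed (fst ` ?K)" by (rule compact_imp_closed)
        have K: "x \<in> fst ` ?K" if x: "x \<in> fst ` T" "x \<in> cball l 1" for x
        proof -
          obtain y where y: "(x, y) \<in> T" using x by auto
          then have "(norm y)\<^sup>2 \<le> M" using TS M[OF x(2)] by (auto simp flip: norm_power)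
          then have "norm y \<le> sqrt M" by (rule real_le_rsqrt)
          then show ?thesis using x(2) y by (intro image_eqI[of _ _ "(x, y)"]) auto
        qed
        have "l \<in> closure (fst ` ?K)"
          unfolding closure_approachable
        proof (intro allI impI)
          fix e :: real assume "e > 0"
          then obtain x where "x \<in> fst ` T" "dist x l < min e 1"
            using l unfolding closure_approachable by (metis min_less_iff_conj zero_less_one)
          moreover from this have "x \<in> fst ` ?K" by (intro K) (auto simp: dist_commute)
          ultimately show "\<exists>y\<in>fst ` ?K. dist y l < e" by (meson min_less_iff_conj)
        qed
        then have "l \<in> fst ` ?K" using cK by simp
        then show ?thesis by auto
      qed
      then show ?thesis using closure_subset_eq by blast
    qed
    ultimately have "fst ` T = {} \<or> fst ` T = UNIV" using clopen[of "fst ` T"] by simp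
    then show ?thesis using T(3) by simp
  qed
  show ?thesis
    unfolding connected_clopen
  proof (intro allI impI)
    fix T assume T: "openin (top_of_set ?S) T \<and> closedin (top_of_set ?S) T"
    show "T = {} \<or> T = ?S"
    proof (rule ccontr)
      assume nT: "\<not> (T = {} \<or> T = ?S)"
      have TS: "T \<subseteq> ?S" using T openin_imp_subset by blast
      have "openin (top_of_set ?S) (?S - T)" "closedin (top_of_set ?S) (?S - T)"
        using T by (auto intro: openin_diff closedin_diff)
      then have "x0 \<in> fst ` (?S - T)" "x0 \<in> fst ` T"
        using all[of "?S - T"] all[of T] T nT TS by auto
      then obtain y y' where "(x0, y) \<in> ?S - T" "(x0, y') \<in> T" by auto
      then show False using TS p(2) by auto
    qed
  qed
qed

text \<open>Dividing by \<open>y^2\<close> moves the value at \<open>x\<close> to 1, off the branch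
  cut. Positivity of \<open>Re (s t / y)\<close> singles out one sheet, which later serves as the
  open condition cutting out the graph of \<open>s\<close> as a chart domain.\<close>

lemma local_holomorphic_sqrt:
  fixes p :: "complex \<Rightarrow> complex"
  assumes p: "p holomorphic_on UNIV" and y: "y \<noteq> 0" "y\<^sup>2 = p x"
  shows "\<exists>S s. open S \<and> x \<in> S \<and> s holomorphic_on S \<and>
    (\<forall>t\<in>S. (s t)\<^sup>2 = p t \<and> 0 < Re (s t / y)) \<and>
    (\<forall>t\<in>S. \<forall>w. w\<^sup>2 = p t \<longrightarrow> 0 < Re (w / y) \<longrightarrow> s t = w)"
proof (intro exI conjI ballI allI impI)
  let ?S = "(\<lambda>t. p t / y\<^sup>2) -` (- \<real>\<^sub>\<le>\<^sub>0)" and ?s = "\<lambda>t. y * csqrt (p t / y\<^sup>2)"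
  have h: "(\<lambda>t. p t / y\<^sup>2) holomorphic_on S" for S
    by (intro holomorphic_intros holomorphic_on_subset[OF p]) (use y in auto)
  show "open ?S"
    by (intro open_vimage holomorphic_on_imp_continuous_on h open_Compl closed_nonpos_Reals_complex)
  show "x \<in> ?S" using y by auto
  have "csqrt holomorphic_on (- \<real>\<^sub>\<le>\<^sub>0)" by (rule holomorphic_on_csqrt)
  from holomorphic_on_compose_gen[OF h this, of ?S]
  show "?s holomorphic_on ?S" by (auto simp: o_def intro!: holomorphic_intros)
  fix t assume t: "t \<in> ?S"
  show "(?s t)\<^sup>2 = p t" using y(1) by (simp add: power_mult_distrib)
  show "0 < Re (?s t / y)"
  proof -
    let ?u = "csqrt (p t / y\<^sup>2)"
    \<comment> \<open>A purely imaginary root would have its square on the branch cut, which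
      \<open>?S\<close> excludes.\<close>
    have "Re ?u \<noteq> 0"
    proof
      assume "Re ?u = 0"
      then have "?u\<^sup>2 = of_real (- (Im ?u)\<^sup>2)" by (simp add: complex_eq_iff power2_eq_square)
      then have "p t / y\<^sup>2 = of_real (- (Im ?u)\<^sup>2)" by simp
      then have "p t / y\<^sup>2 \<in> \<real>\<^sub>\<le>\<^sub>0"
        by (metis nonpos_Reals_of_real_iff neg_le_0_iff_le zero_le_power2)
      then show False using t by simp
    qed
    then show "0 < Re (?s t / y)" using Re_csqrt[of "p t / y\<^sup>2"] y by simp
  qed
  fix w assume w: "w\<^sup>2 = p t" "0 < Re (w / y)"
  show "?s t = w"
  proof -
    have "csqrt ((w / y)\<^sup>2) = w / y" by (rule csqrt_square) (use w in auto)
    then show ?thesis using w y by (simp add: power_divide)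
  qed
qed

section \<open>The smooth model as an intersection of two quadrics in projective 3-space\<close>

definition vec4 :: "complex \<Rightarrow> complex \<Rightarrow> complex \<Rightarrow> complex \<Rightarrow> cvec" where
  "vec4 a b c d = (\<lambda>i. if i = 0 then a else if i = 1 then b else if i = 2 then c else if i = 3 then d else 0)"

lemma vec4_simps [simp]:
  "vec4 a b c d 0 = a" "vec4 a b c d 1 = b" "vec4 a b c d (Suc 0) = b" "vec4 a b c d 2 = c" "vec4 a b c d 3 = d"
  "i \<notin> {0..3} \<Longrightarrow> vec4 a b c d i = 0"
  by (auto simp: vec4_def)

lemma vec4_nonzero_vecs:
  "vec4 a b c d \<in> nonzero_vecs {0..3} \<longleftrightarrow> a \<noteq> 0 \<or> b \<noteq> 0 \<or> c \<noteq> 0 \<or> d \<noteq> 0"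
proof -
  have "(\<exists>i. vec4 a b c d i \<noteq> 0) \<longleftrightarrow> a \<noteq> 0 \<or> b \<noteq> 0 \<or> c \<noteq> 0 \<or> d \<noteq> 0"
  proof
    show "a \<noteq> 0 \<or> b \<noteq> 0 \<or> c \<noteq> 0 \<or> d \<noteq> 0 \<Longrightarrow> \<exists>i. vec4 a b c d i \<noteq> 0"
      by (metis vec4_simps(1,2,4,5))
  qed (auto simp: vec4_def split: if_splits)
  then show ?thesis by (simp add: nonzero_vecs_def)
qed

lemma vec4_eta:
  assumes "v \<in> nonzero_vecs {0..3}"
  shows "v = vec4 (v 0) (v 1) (v 2) (v 3)"
proof
  fix i :: nat
  consider "i = 0" | "i = 1" | "i = 2" | "i = 3" | "i \<notin> {0..3}" by (cases "i \<le> 3") (auto simp: numeral_eq_Suc le_Suc_eq)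
  then show "v i = vec4 (v 0) (v 1) (v 2) (v 3) i"
    using assms by cases (auto simp: nonzero_vecs_def)
qed

lemma vec4_holomorphic:
  assumes "a holomorphic_on D" "b holomorphic_on D" "c holomorphic_on D" "d holomorphic_on D"
  shows "(\<lambda>t. vec4 (a t) (b t) (c t) (d t) i) holomorphic_on D"
  by (cases "i = 0"; cases "i = 1"; cases "i = 2"; cases "i = 3"; simp add: vec4_def assms)

lemma vec4_continuous:
  assumes "continuous_on D a" "continuous_on D b" "continuous_on D c" "continuous_on D d"
  shows "continuous_on D (\<lambda>t. vec4 (a t) (b t) (c t) (d t))"
proof (rule continuous_on_coordinatewise_then_product)
  show "continuous_on D (\<lambda>t. vec4 (a t) (b t) (c t) (d t) i)" for i
    by (cases "i = 0"; cases "i = 1"; cases "i = 2"; cases "i = 3"; simp add: vec4_def assms)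
qed

lemma vec4_scale: "(\<lambda>i. k * vec4 a b c d i) = vec4 (k * a) (k * b) (k * c) (k * d)"
  by (auto simp: vec4_def)

definition elliptic_poly :: "complex \<Rightarrow> complex" where
  "elliptic_poly x = x ^ 4 + 80 * x ^ 3 + 125 * x ^ 2 + 50 * x"

text \<open>The coordinates stand for \<open>[1 : x : x^2 : y]\<close>. One quadric is the relation
  between the powers of \<open>x\<close>; the other homogenizes the quartic by writing
  \<open>x^4\<close>, \<open>x^3\<close>, \<open>x^2\<close>, \<open>x\<close> as products of two
  coordinates.\<close>

definition elliptic_cone :: "cvec set" where
  "elliptic_cone = {v. v 0 * v 2 = (v 1)\<^sup>2 \<and>
     (v 3)\<^sup>2 = (v 2)\<^sup>2 + 80 * v 1 * v 2 + 125 * (v 1)\<^sup>2 + 50 * v 0 * v 1}"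

definition elliptic_points :: "cvec set set" where
  "elliptic_points = proj_point ` {v \<in> nonzero_vecs {0..3}. v \<in> elliptic_cone}"

text \<open>The quartic has non-zero discriminant: it and its derivative generate the unit ideal.
  This gives smoothness at the points with \<open>y = 0\<close>.\<close>

lemma elliptic_poly_simple_root:
  assumes "elliptic_poly x = 0"
  shows "4 * x ^ 3 + 240 * x ^ 2 + 250 * x + 50 \<noteq> 0"
proof
  assume "4 * x ^ 3 + 240 * x ^ 2 + 250 * x + 50 = 0"
  with assms show False unfolding elliptic_poly_def by algebra
qed

lemma elliptic_poly_holomorphic: "elliptic_poly holomorphic_on S"
  unfolding elliptic_poly_def by (intro holomorphic_intros)

lemma elliptic_poly_derivative:
  "(elliptic_poly has_field_derivative 4 * x ^ 3 + 240 * x ^ 2 + 250 * x + 50) (at x)"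
  unfolding elliptic_poly_def by (auto intro!: derivative_eq_intros simp: algebra_simps)

lemma elliptic_cone_scale: "v \<in> elliptic_cone \<Longrightarrow> (\<lambda>i. c * v i) \<in> elliptic_cone"
  unfolding elliptic_cone_def by (auto; algebra)

lemma closed_elliptic_cone: "closed elliptic_cone"
  unfolding elliptic_cone_def
  by (intro closed_Collect_conj closed_Collect_eq continuous_on_mult continuous_on_power continuous_on_add
      continuous_on_const continuous_on_coordinate)

lemma elliptic_cone_affine: "vec4 1 x (x\<^sup>2) y \<in> elliptic_cone \<longleftrightarrow> y\<^sup>2 = elliptic_poly x"
  by (simp add: elliptic_cone_def elliptic_poly_def algebra_simps power_numeral_reduce)

text \<open>In the coordinates \<open>z = 1/x\<close> and \<open>y/x^2\<close> the quartic is
  reversed. The reversal has constant term 1, so two distinct points lie over \<open>z = 0\<close>,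
  and \<open>z\<close> is a parameter at both.\<close>

lemma elliptic_cone_infinity:
  "vec4 (z\<^sup>2) z 1 y \<in> elliptic_cone \<longleftrightarrow> y\<^sup>2 = 1 + 80 * z + 125 * z ^ 2 + 50 * z ^ 3"
  by (simp add: elliptic_cone_def algebra_simps power_numeral_reduce)

lemma proj_point_in_elliptic_points:
  assumes "v \<in> nonzero_vecs {0..3}"
  shows "proj_point v \<in> elliptic_points \<longleftrightarrow> v \<in> elliptic_cone"
proof
  assume "proj_point v \<in> elliptic_points"
  then obtain w where w: "w \<in> elliptic_cone" "proj_point w = proj_point v" by (auto simp: elliptic_points_def)
  with proj_point_eqD[OF w(2) assms] elliptic_cone_scale show "v \<in> elliptic_cone" by metis
qed (use assms in \<open>auto simp: elliptic_points_def\<close>)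

lemma elliptic_points_cases:
  assumes "L \<in> elliptic_points"
  obtains x y where "L = proj_point (vec4 1 x (x\<^sup>2) y)" "y\<^sup>2 = elliptic_poly x"
  | y where "L = proj_point (vec4 0 0 1 y)" "y\<^sup>2 = 1"
proof -
  obtain v where v: "v \<in> nonzero_vecs {0..3}" "v \<in> elliptic_cone" "L = proj_point v"
    using assms by (auto simp: elliptic_points_def)
  have s: "L = proj_point (vec4 (c * v 0) (c * v 1) (c * v 2) (c * v 3))"
          "vec4 (c * v 0) (c * v 1) (c * v 2) (c * v 3) \<in> elliptic_cone" if "c \<noteq> 0" for c
  proof -
    have "(\<lambda>i. c * v i) = vec4 (c * v 0) (c * v 1) (c * v 2) (c * v 3)"
      using vec4_eta[OF v(1)] vec4_scale by metis
    then show "L = proj_point (vec4 (c * v 0) (c * v 1) (c * v 2) (c * v 3))"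
          "vec4 (c * v 0) (c * v 1) (c * v 2) (c * v 3) \<in> elliptic_cone"
      using v proj_point_scale[OF that, of v] elliptic_cone_scale[OF v(2), of c] by simp_all
  qed
  show thesis
  proof (cases "v 0 = 0")
    case False
    let ?c = "inverse (v 0)"
    have "?c * v 2 = (?c * v 1)\<^sup>2"
      using v(2) False by (simp add: elliptic_cone_def field_simps power2_eq_square)
    then show thesis
      using that(1)[of "?c * v 1" "?c * v 3"] s[of ?c] False elliptic_cone_affine[of "?c * v 1" "?c * v 3"] by simp
  next
    case True
    then have 1: "v 1 = 0" "(v 3)\<^sup>2 = (v 2)\<^sup>2" using v(2) by (auto simp: elliptic_cone_def)
    have 2: "v 2 \<noteq> 0"
      using v(1) vec4_nonzero_vecs[of "v 0" "v 1" "v 2" "v 3"] vec4_eta[OF v(1)] True 1 by auto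
    show thesis
      using that(2)[of "inverse (v 2) * v 3"] s(1)[of "inverse (v 2)"] True 1 2
      by (simp add: power_mult_distrib power_inverse)
  qed
qed

lemma elliptic_points_subset: "elliptic_points \<subseteq> topspace (projective_space {0..3})"
  by (auto simp: elliptic_points_def topspace_projective_space)

definition affine_elliptic_points :: "cvec set set" where
  "affine_elliptic_points = (\<lambda>(x, y). proj_point (vec4 1 x (x\<^sup>2) y)) ` {(x, y). y\<^sup>2 = elliptic_poly x}"

text \<open>A branch of the root of the reversed quartic gives a curve through the point at
  infinity; its points with \<open>z \<noteq> 0\<close> are affine and tend to it.\<close>

lemma infinity_in_closure:
  assumes "y\<^sup>2 = 1"
  shows "proj_point (vec4 0 0 1 y) \<in> projective_space {0..3} closure_of affine_elliptic_points"
proof -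
  let ?q = "\<lambda>z::complex. 1 + 80 * z + 125 * z ^ 2 + 50 * z ^ 3"
  have q: "?q holomorphic_on UNIV" by (intro holomorphic_intros)
  have "y \<noteq> 0" "y\<^sup>2 = ?q 0" using assms by auto
  then obtain S s where S: "open S" "0 \<in> S" "s holomorphic_on S"
      and s: "\<And>t. t \<in> S \<Longrightarrow> (s t)\<^sup>2 = ?q t \<and> 0 < Re (s t / y)"
      and su: "\<And>t w. t \<in> S \<Longrightarrow> w\<^sup>2 = ?q t \<Longrightarrow> 0 < Re (w / y) \<Longrightarrow> s t = w"
    using local_holomorphic_sqrt[OF q, of y 0] by blast
  have s0: "s 0 = y" by (rule su) (use S assms \<open>y \<noteq> 0\<close> in auto)
  let ?h = "\<lambda>z. vec4 (z\<^sup>2) z 1 (s z)"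
  have cont: "continuous_map (top_of_set S) (projective_space {0..3}) (\<lambda>z. proj_point (?h z))"
  proof (rule continuous_map_proj_point)
    show "continuous_on S ?h"
      by (intro continuous_on_coordinatewise_then_product holomorphic_on_imp_continuous_on vec4_holomorphic
          holomorphic_intros S(3))
  qed (simp add: vec4_nonzero_vecs)
  have "0 islimpt S" using S by (simp add: interior_limit_point interior_open)
  then have "0 \<in> closure (S - {0})" by (simp add: islimpt_in_closure)
  then have "0 \<in> top_of_set S closure_of (S - {0})"
    using S(2) by (simp add: closure_of_subtopology Int_absorb1)
  then have "proj_point (?h 0) \<in> projective_space {0..3} closure_of ((\<lambda>z. proj_point (?h z)) ` (S - {0}))"
    using continuous_map_image_closure_subset[OF cont, of "S - {0}"] by auto
  moreover have "(\<lambda>z. proj_point (?h z)) ` (S - {0}) \<subseteq> affine_elliptic_points"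
  proof (rule image_subsetI)
    fix z assume "z \<in> S - {0}"
    then have z: "z \<in> S" "z \<noteq> 0" by auto
    \<comment> \<open>Rescaling by \<open>1/z^2\<close> makes the leading coordinate 1 and exhibits
      the affine point with \<open>x = 1/z\<close>.\<close>
    let ?c = "inverse (z\<^sup>2)"
    have "?h z \<in> elliptic_cone" using s[OF z(1)] elliptic_cone_infinity by simp
    then have v: "vec4 (?c * z\<^sup>2) (?c * z) (?c * 1) (?c * s z) \<in> elliptic_cone"
      using elliptic_cone_scale[of "?h z" ?c] by (simp add: vec4_scale)
    have c: "?c * z\<^sup>2 = 1" "?c * z = inverse z" "?c * 1 = (inverse z)\<^sup>2"
      using z by (simp_all add: power2_eq_square field_simps)
    have e: "vec4 (?c * z\<^sup>2) (?c * z) (?c * 1) (?c * s z) = vec4 1 (inverse z) ((inverse z)\<^sup>2) (?c * s z)"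
      by (simp only: c)
    from v have "(?c * s z)\<^sup>2 = elliptic_poly (inverse z)" by (simp only: e elliptic_cone_affine)
    moreover have "proj_point (?h z) = proj_point (vec4 1 (inverse z) ((inverse z)\<^sup>2) (?c * s z))"
      using z proj_point_scale[of ?c "?h z"] e by (simp add: vec4_scale)
    ultimately show "proj_point (?h z) \<in> affine_elliptic_points"
      unfolding affine_elliptic_points_def by (intro image_eqI[of _ _ "(inverse z, ?c * s z)"]) auto
  qed
  ultimately show ?thesis using closure_of_mono s0 by (metis (no_types, lifting) in_mono zero_power2)
qed

lemma affine_elliptic_points_subset: "affine_elliptic_points \<subseteq> elliptic_points"
proof -
  have "vec4 1 x (x\<^sup>2) y \<in> nonzero_vecs {0..3}" for x y by (simp add: vec4_nonzero_vecs)
  then show ?thesis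
    unfolding affine_elliptic_points_def
    by (auto simp: proj_point_in_elliptic_points elliptic_cone_affine)
qed

lemma closure_affine_elliptic_points:
  "projective_space {0..3} closure_of affine_elliptic_points = elliptic_points"
proof
  have "closedin (projective_space {0..3}) elliptic_points"
    unfolding elliptic_points_def
    using closed_elliptic_cone elliptic_cone_scale by (rule closedin_projective_cone)
  then show "projective_space {0..3} closure_of affine_elliptic_points \<subseteq> elliptic_points"
    using affine_elliptic_points_subset closure_of_minimal by metis
  have aff: "affine_elliptic_points \<subseteq> projective_space {0..3} closure_of affine_elliptic_points"
    using affine_elliptic_points_subset elliptic_points_subset by (intro closure_of_subset) blast
  show "elliptic_points \<subseteq> projective_space {0..3} closure_of affine_elliptic_points"
  proof
    fix L assume "L \<in> elliptic_points"
    then show "L \<in> projective_space {0..3} closure_of affine_elliptic_points"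
    proof (cases rule: elliptic_points_cases)
      case (1 x y)
      then have "L \<in> affine_elliptic_points"
        unfolding affine_elliptic_points_def by (intro image_eqI[of _ _ "(x, y)"]) auto
      then show ?thesis using aff by blast
    qed (use infinity_in_closure in blast)
  qed
qed

lemma square_root_curve_elliptic:
  "square_root_curve [:0, 50, 125, 80, 1:] = projective_curve {0..3} elliptic_points"
proof -
  have e: "(\<lambda>i::nat. if i \<le> 2 then x ^ i else if i = 3 then y else 0) = vec4 1 x (x\<^sup>2) y" for x y :: complex
    by (auto simp: vec4_def fun_eq_iff numeral_eq_Suc le_Suc_eq)
  have p: "poly [:0, 50, 125, 80, 1:] x = elliptic_poly x" for x
    by (simp add: elliptic_poly_def algebra_simps power_numeral_reduce)
  have a: "affine_elliptic_points = {proj_point (vec4 1 x (x\<^sup>2) y) | x y. y\<^sup>2 = poly [:0, 50, 125, 80, 1:] x}"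
    unfolding affine_elliptic_points_def p by auto
  have n: "1 + 1 = (2::nat)" "1 + 2 = (3::nat)" by simp_all
  \<comment> \<open>Degree 4 gives \<open>g = 1\<close>, so the embedding has the four coordinates
    \<open>1, x, x^2, y\<close> with index set \<open>{0..3}\<close>.\<close>
  have g: "(degree [:0, 50, 125, 80, 1 :: complex:] - 1) div 2 = 1" by simp
  show ?thesis
    unfolding square_root_curve_def Let_def closure_affine_elliptic_points[symmetric] a g
    by (simp only: n e)
qed

lemma elliptic_poly_0: "elliptic_poly 0 = 0"
  by (simp add: elliptic_poly_def)

text \<open>The affine part is a continuous image of a double cover of the plane that is branched
  over the root 0, hence connected, and the closure of a connected set is connected.\<close>

lemma connected_elliptic_points: "connected_space (subtopology (projective_space {0..3}) elliptic_points)"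
proof -
  let ?S = "{(x, y). y\<^sup>2 = elliptic_poly x}"
  have "connected ?S"
    by (rule connected_double_cover[of _ 0])
       (simp_all add: holomorphic_on_imp_continuous_on elliptic_poly_holomorphic elliptic_poly_0)
  then have "connectedin (top_of_set ?S) ?S" by (simp add: connectedin_subtopology)
  moreover have "continuous_map (top_of_set ?S) (projective_space {0..3}) (\<lambda>z. proj_point (vec4 1 (fst z) ((fst z)\<^sup>2) (snd z)))"
  proof (rule continuous_map_proj_point)
    show "continuous_on ?S (\<lambda>z. vec4 1 (fst z) ((fst z)\<^sup>2) (snd z))"
      by (intro vec4_continuous continuous_intros)
  qed (simp add: vec4_nonzero_vecs)
  ultimately have "connectedin (projective_space {0..3}) ((\<lambda>z. proj_point (vec4 1 (fst z) ((fst z)\<^sup>2) (snd z))) ` ?S)"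
    using connectedin_continuous_map_image by blast
  moreover have "(\<lambda>z. proj_point (vec4 1 (fst z) ((fst z)\<^sup>2) (snd z))) ` ?S = affine_elliptic_points"
    by (auto simp: affine_elliptic_points_def case_prod_unfold)
  ultimately have "connectedin (projective_space {0..3}) elliptic_points"
    using connectedin_closure_of closure_affine_elliptic_points by metis
  then show ?thesis by (simp add: connectedin_def)
qed

text \<open>The parameter is \<open>x\<close> where \<open>y \<noteq> 0\<close>, \<open>y\<close> at
  the roots of the quartic, and \<open>1/x\<close> at infinity.\<close>

lemma elliptic_chart:
  assumes L: "L \<in> elliptic_points"
  shows "\<exists>U \<phi>. (U, \<phi>) \<in> surf_atlas (projective_curve {0..3} elliptic_points) \<and> L \<in> U"
  using L
proof (cases rule: elliptic_points_cases)
  case (1 x y)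
  show ?thesis
  proof (cases "y = 0")
    case False
    obtain S s where S: "open S" "x \<in> S" "s holomorphic_on S"
        and s: "\<And>t. t \<in> S \<Longrightarrow> (s t)\<^sup>2 = elliptic_poly t \<and> 0 < Re (s t / y)"
        and su: "\<And>t w. t \<in> S \<Longrightarrow> w\<^sup>2 = elliptic_poly t \<Longrightarrow> 0 < Re (w / y) \<Longrightarrow> s t = w"
      using local_holomorphic_sqrt[OF elliptic_poly_holomorphic False 1(2)] by blast
    show ?thesis
      unfolding 1(1)
    proof (rule projective_curve_chartI[OF elliptic_points_subset S(1), where k = 0 and \<Phi> = "\<lambda>v. v 1"
          and h = "\<lambda>t. vec4 1 t (t\<^sup>2) (s t)"
          and N = "(\<lambda>v. v 1) -` S \<inter> (\<lambda>v. v 3 / y) -` {u. 0 < Re u}"])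
      show "open ((\<lambda>v::cvec. v 1) -` S \<inter> (\<lambda>v. v 3 / y) -` {u. 0 < Re u})"
        by (intro open_Int open_vimage S(1) open_halfspace_Re_gt continuous_on_coordinate continuous_on_divide
            continuous_on_const) (use False in auto)
      show "continuous_on ((\<lambda>v::cvec. v 1) -` S \<inter> (\<lambda>v. v 3 / y) -` {u. 0 < Re u}) (\<lambda>v. v 1)"
        by (rule continuous_on_coordinate)
      show "(\<lambda>t. vec4 1 t (t\<^sup>2) (s t) i) holomorphic_on S" for i
        by (intro vec4_holomorphic holomorphic_intros S(3))
      fix t assume t: "t \<in> S"
      show "vec4 1 t (t\<^sup>2) (s t) \<in> nonzero_vecs {0..3} \<and> vec4 1 t (t\<^sup>2) (s t) 0 = 1 \<and>
          proj_point (vec4 1 t (t\<^sup>2) (s t)) \<in> elliptic_points \<and>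
          vec4 1 t (t\<^sup>2) (s t) \<in> (\<lambda>v. v 1) -` S \<inter> (\<lambda>v. v 3 / y) -` {u. 0 < Re u} \<and>
          vec4 1 t (t\<^sup>2) (s t) 1 = t"
        using s[OF t] t by (simp add: vec4_nonzero_vecs proj_point_in_elliptic_points elliptic_cone_affine)
      show "\<exists>i j. vec4 1 t (t\<^sup>2) (s t) i * deriv (\<lambda>u. vec4 1 u (u\<^sup>2) (s u) j) t \<noteq>
          vec4 1 t (t\<^sup>2) (s t) j * deriv (\<lambda>u. vec4 1 u (u\<^sup>2) (s u) i) t"
        by (intro exI[of _ 0] exI[of _ 1]) simp
    next
      fix v assume v: "v \<in> nonzero_vecs {0..3}" "v 0 = 1"
        "v \<in> (\<lambda>v. v 1) -` S \<inter> (\<lambda>v. v 3 / y) -` {u. 0 < Re u}" "proj_point v \<in> elliptic_points"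
      then have e: "v \<in> elliptic_cone" by (simp add: proj_point_in_elliptic_points)
      then have "v 2 = (v 1)\<^sup>2" using v(2) by (simp add: elliptic_cone_def)
      then have v': "v = vec4 1 (v 1) ((v 1)\<^sup>2) (v 3)" using vec4_eta[OF v(1)] v(2) by simp
      then have "(v 3)\<^sup>2 = elliptic_poly (v 1)" using e elliptic_cone_affine by metis
      then have "s (v 1) = v 3" using su v(3) by auto
      then show "v 1 \<in> S \<and> vec4 1 (v 1) ((v 1)\<^sup>2) (s (v 1)) = v" using v(3) v' by simp
    qed (use S 1 False in \<open>auto simp: vec4_nonzero_vecs proj_point_in_elliptic_points elliptic_cone_affine\<close>)
  next
    case True
    then have "deriv elliptic_poly x \<noteq> 0"
      using elliptic_poly_simple_root[of x] 1(2) DERIV_imp_deriv[OF elliptic_poly_derivative] by simp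
    then obtain r where r: "r > 0" "open (elliptic_poly ` ball x r)" "inj_on elliptic_poly (ball x r)"
      using has_complex_derivative_locally_invertible[OF elliptic_poly_holomorphic[of UNIV] UNIV_I open_UNIV] by metis
    obtain \<xi> where \<xi>: "\<xi> holomorphic_on elliptic_poly ` ball x r" "\<And>t. t \<in> ball x r \<Longrightarrow> \<xi> (elliptic_poly t) = t"
      using holomorphic_has_inverse[OF elliptic_poly_holomorphic open_ball r(3)] by metis
    \<comment> \<open>As the root is simple, \<open>x\<close> is the holomorphic function
      \<open>\<xi>\<close> of \<open>y^2\<close>, defined where \<open>y^2\<close> is a value of the
      quartic near the root.\<close>
    let ?D = "(\<lambda>t. t\<^sup>2) -` (elliptic_poly ` ball x r)"
    have D: "open ?D" by (intro open_vimage r continuous_intros)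
    have \<xi>D: "\<xi> (t\<^sup>2) \<in> ball x r" "elliptic_poly (\<xi> (t\<^sup>2)) = t\<^sup>2" if "t \<in> ?D" for t using that \<xi>(2) by auto
    let ?h = "\<lambda>t. vec4 1 (\<xi> (t\<^sup>2)) ((\<xi> (t\<^sup>2))\<^sup>2) t"
    have h\<xi>: "(\<lambda>t. \<xi> (t\<^sup>2)) holomorphic_on ?D"
    proof -
      have "(\<lambda>t. t\<^sup>2) holomorphic_on ?D" by (intro holomorphic_intros)
      from holomorphic_on_compose_gen[OF this \<xi>(1)] show ?thesis by (auto simp: o_def)
    qed
    show ?thesis
      unfolding 1(1)
    proof (rule projective_curve_chartI[OF elliptic_points_subset D, where k = 0 and \<Phi> = "\<lambda>v. v 3"
          and h = ?h and N = "(\<lambda>v. v 1) -` ball x r"])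
      show "open ((\<lambda>v::cvec. v 1) -` ball x r)"
        by (intro open_vimage continuous_on_coordinate) auto
      show "continuous_on ((\<lambda>v::cvec. v 1) -` ball x r) (\<lambda>v. v 3)"
        by (rule continuous_on_coordinate)
      show "(\<lambda>t. ?h t i) holomorphic_on ?D" for i
        by (intro vec4_holomorphic holomorphic_intros h\<xi>)
      fix t assume t: "t \<in> ?D"
      show "?h t \<in> nonzero_vecs {0..3} \<and> ?h t 0 = 1 \<and> proj_point (?h t) \<in> elliptic_points \<and>
          ?h t \<in> (\<lambda>v. v 1) -` ball x r \<and> ?h t 3 = t"
        using \<xi>D[OF t] by (simp add: vec4_nonzero_vecs proj_point_in_elliptic_points elliptic_cone_affine)
      show "\<exists>i j. ?h t i * deriv (\<lambda>u. ?h u j) t \<noteq> ?h t j * deriv (\<lambda>u. ?h u i) t"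
        by (intro exI[of _ 0] exI[of _ 3]) simp
    next
      fix v assume v: "v \<in> nonzero_vecs {0..3}" "v 0 = 1"
        "v \<in> (\<lambda>v. v 1) -` ball x r" "proj_point v \<in> elliptic_points"
      then have e: "v \<in> elliptic_cone" by (simp add: proj_point_in_elliptic_points)
      then have "v 2 = (v 1)\<^sup>2" using v(2) by (simp add: elliptic_cone_def)
      then have v': "v = vec4 1 (v 1) ((v 1)\<^sup>2) (v 3)" using vec4_eta[OF v(1)] v(2) by simp
      then have "(v 3)\<^sup>2 = elliptic_poly (v 1)" using e elliptic_cone_affine by metis
      then show "v 3 \<in> ?D \<and> ?h (v 3) = v" using v(3) v' \<xi>(2)[of "v 1"] by auto
    qed (use r 1 True in \<open>auto simp: vec4_nonzero_vecs proj_point_in_elliptic_points elliptic_cone_affine\<close>)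
  qed
next
  case (2 y)
  let ?q = "\<lambda>z::complex. 1 + 80 * z + 125 * z ^ 2 + 50 * z ^ 3"
  have q: "?q holomorphic_on UNIV" by (intro holomorphic_intros)
  have y0: "y \<noteq> 0" "y\<^sup>2 = ?q 0" using 2 by auto
  obtain S s where S: "open S" "0 \<in> S" "s holomorphic_on S"
      and s: "\<And>t. t \<in> S \<Longrightarrow> (s t)\<^sup>2 = ?q t \<and> 0 < Re (s t / y)"
      and su: "\<And>t w. t \<in> S \<Longrightarrow> w\<^sup>2 = ?q t \<Longrightarrow> 0 < Re (w / y) \<Longrightarrow> s t = w"
    using local_holomorphic_sqrt[OF q y0] by blast
  let ?h = "\<lambda>t. vec4 (t\<^sup>2) t 1 (s t)"
  let ?N = "(\<lambda>v::cvec. v 1) -` S \<inter> (\<lambda>v. v 3 / y) -` {u. 0 < Re u}"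
  show ?thesis
    unfolding 2(1)
  proof (rule projective_curve_chartI[OF elliptic_points_subset S(1), where k = 2 and \<Phi> = "\<lambda>v. v 1"
        and h = ?h and N = ?N])
    show "open ?N"
      by (intro open_Int open_vimage S(1) open_halfspace_Re_gt continuous_on_coordinate continuous_on_divide
          continuous_on_const) (use y0 in auto)
    show "continuous_on ?N (\<lambda>v. v 1)"
      by (rule continuous_on_coordinate)
    show "(\<lambda>t. ?h t i) holomorphic_on S" for i
      by (intro vec4_holomorphic holomorphic_intros S(3))
    fix t assume t: "t \<in> S"
    show "?h t \<in> nonzero_vecs {0..3} \<and> ?h t 2 = 1 \<and> proj_point (?h t) \<in> elliptic_points \<and> ?h t \<in> ?N \<and> ?h t 1 = t"
      using s[OF t] t by (simp add: vec4_nonzero_vecs proj_point_in_elliptic_points elliptic_cone_infinity)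
    show "\<exists>i j. ?h t i * deriv (\<lambda>u. ?h u j) t \<noteq> ?h t j * deriv (\<lambda>u. ?h u i) t"
      by (intro exI[of _ 2] exI[of _ 1]) simp
  next
    fix v assume v: "v \<in> nonzero_vecs {0..3}" "v 2 = 1" "v \<in> ?N" "proj_point v \<in> elliptic_points"
    then have e: "v \<in> elliptic_cone" by (simp add: proj_point_in_elliptic_points)
    then have "v 0 = (v 1)\<^sup>2" using v(2) by (simp add: elliptic_cone_def)
    then have v': "v = vec4 ((v 1)\<^sup>2) (v 1) 1 (v 3)" using vec4_eta[OF v(1)] v(2) by simp
    then have "(v 3)\<^sup>2 = ?q (v 1)" using e elliptic_cone_infinity by metis
    then have "s (v 1) = v 3" using su v(3) by auto
    then show "v 1 \<in> S \<and> ?h (v 1) = v" using v(3) v' by simp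
  next
    show "proj_point (vec4 0 0 1 y) \<in> elliptic_points"
      using elliptic_cone_infinity[of 0 y] y0 by (simp add: vec4_nonzero_vecs proj_point_in_elliptic_points)
  qed (use S y0 in \<open>auto simp: vec4_nonzero_vecs\<close>)
qed

lemma riemann_surface_elliptic: "riemann_surface (projective_curve {0..3} elliptic_points)"
proof (rule riemann_surface_projective_curve[OF _ _ elliptic_points_subset connected_elliptic_points elliptic_chart])
  have "proj_point (vec4 1 0 (0\<^sup>2) 0) \<in> affine_elliptic_points"
    unfolding affine_elliptic_points_def by (intro image_eqI[of _ _ "(0, 0)"]) (auto simp: elliptic_poly_def)
  then show "elliptic_points \<noteq> {}" using affine_elliptic_points_subset by blast
qed auto

section \<open>Bring's curve\<close>

text \<open>Naming all five positions turns the sums over \<open>{1..5}\<close> into polynomials in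
  five variables, on which ideal membership can be decided whatever the positions are.\<close>

definition labelling :: "nat \<Rightarrow> nat \<Rightarrow> nat \<Rightarrow> nat \<Rightarrow> nat \<Rightarrow> bool" where
  "labelling a b c d e \<longleftrightarrow> distinct [a, b, c, d, e] \<and> {1..5} = {a, b, c, d, e}"

lemma labelling_sum:
  assumes "labelling a b c d e"
  shows "(\<Sum>i=1..5. f i) = f a + f b + f c + f d + (f e :: complex)"
  using assms by (simp add: labelling_def add.assoc)

lemma labelling_extend3:
  assumes "a \<in> {1..5}" "b \<in> {1..5}" "c \<in> {1..5}" "a \<noteq> b" "a \<noteq> c" "b \<noteq> c"
  shows "\<exists>d e. labelling a b c d e"
proof -
  have "card ({1..5} - {a, b, c}) = 2"
    using assms by (subst card_Diff_subset) auto
  then obtain d e where de: "{1..5} - {a, b, c} = {d, e}" "d \<noteq> e" by (auto simp: card_2_iff)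
  then have "d \<notin> {a, b, c}" "e \<notin> {a, b, c}" by blast+
  moreover have "{1..5} = {a, b, c} \<union> ({1..5} - {a, b, c})" using assms by blast
  ultimately have "labelling a b c d e" using de assms by (auto simp: labelling_def)
  then show ?thesis by blast
qed

lemma labelling_extend2:
  assumes "a \<in> {1..5}" "b \<in> {1..5}" "a \<noteq> b"
  shows "\<exists>c d e. labelling a b c d e"
proof -
  have "card ({1..5} - {a, b}) = 3" using assms by (subst card_Diff_subset) auto
  then have "{1..5} - {a, b} \<noteq> {}" by (metis card.empty zero_neq_numeral)
  then obtain c where "c \<in> {1..5}" "c \<noteq> a" "c \<noteq> b" by blast
  then show ?thesis using labelling_extend3[of a b c] assms by metis
qed

lemma labelling_cases:
  assumes "labelling a b c d e"
  shows "i = a \<or> i = b \<or> i = c \<or> i = d \<or> i = e \<or> i \<notin> {1..5}"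
  using assms unfolding labelling_def by blast

section \<open>The cone over Bring's curve and coincidences among its coordinates\<close>

definition bring_cone :: "cvec set" where
  "bring_cone = {x. (\<Sum>i=1..5. x i) = 0 \<and> (\<Sum>i=1..5. x i ^ 2) = 0 \<and> (\<Sum>i=1..5. x i ^ 3) = 0}"

definition bring_points :: "cvec set set" where
  "bring_points = proj_point ` {x \<in> nonzero_vecs {1..5}. x \<in> bring_cone}"

lemma brings_curve_eq: "brings_curve = projective_curve {1..5} bring_points"
  by (simp add: brings_curve_def bring_points_def bring_cone_def)

lemma bring_cone_labelling:
  assumes "labelling a b c d e"
  shows "x \<in> bring_cone \<longleftrightarrow> x a + x b + x c + x d + x e = 0 \<and>
    x a ^ 2 + x b ^ 2 + x c ^ 2 + x d ^ 2 + x e ^ 2 = 0 \<and>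
    x a ^ 3 + x b ^ 3 + x c ^ 3 + x d ^ 3 + x e ^ 3 = 0"
  unfolding bring_cone_def labelling_sum[OF assms] by simp

lemma bring_cone_scale: "x \<in> bring_cone \<Longrightarrow> (\<lambda>i. c * x i) \<in> bring_cone"
  by (simp add: bring_cone_def power_mult_distrib flip: sum_distrib_left)

lemma closed_bring_cone: "closed bring_cone"
  unfolding bring_cone_def
  by (intro closed_Collect_conj closed_Collect_eq continuous_on_sum continuous_on_power
      continuous_on_const continuous_on_coordinate)

lemma bring_points_subset: "bring_points \<subseteq> topspace (projective_space {1..5})"
  by (auto simp: bring_points_def topspace_projective_space)

lemma proj_point_in_bring_points:
  assumes "v \<in> nonzero_vecs {1..5}"
  shows "proj_point v \<in> bring_points \<longleftrightarrow> v \<in> bring_cone"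
proof
  assume "proj_point v \<in> bring_points"
  then obtain w where w: "w \<in> bring_cone" "proj_point w = proj_point v" by (auto simp: bring_points_def)
  with proj_point_eqD[OF w(2) assms] bring_cone_scale show "v \<in> bring_cone" by metis
qed (use assms in \<open>auto simp: bring_points_def\<close>)

lemma labelling_nonzero:
  assumes "labelling a b c d e" "v \<in> nonzero_vecs {1..5}"
  shows "v a \<noteq> 0 \<or> v b \<noteq> 0 \<or> v c \<noteq> 0 \<or> v d \<noteq> 0 \<or> v e \<noteq> 0"
  using assms labelling_cases[OF assms(1)] unfolding nonzero_vecs_def by (smt (verit) mem_Collect_eq)

text \<open>By Newton's identities all elementary symmetric functions vanish, so the three numbers
  are roots of \<open>T^3\<close>.\<close>

lemma power_sums_3_zero:
  fixes p q r :: complex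
  assumes "p + q + r = 0" "p ^ 2 + q ^ 2 + r ^ 2 = 0" "p ^ 3 + q ^ 3 + r ^ 3 = 0"
  shows "p = 0" "q = 0" "r = 0"
proof -
  have "p ^ 4 = 0" "q ^ 4 = 0" "r ^ 4 = 0" using assms by algebra+
  then show "p = 0" "q = 0" "r = 0" by simp_all
qed

text \<open>The five numbers are the roots of some \<open>T^5 + \<alpha> T + \<beta>\<close>. A
  triple root annihilates the second derivative \<open>20 T^3\<close>, hence is 0, and then
  \<open>\<alpha> = \<beta> = 0\<close>.\<close>

lemma power_sums_triple_zero:
  fixes x q r :: complex
  assumes "x + x + x + q + r = 0" "x ^ 2 + x ^ 2 + x ^ 2 + q ^ 2 + r ^ 2 = 0"
    "x ^ 3 + x ^ 3 + x ^ 3 + q ^ 3 + r ^ 3 = 0"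
  shows "x = 0" "q = 0" "r = 0"
proof -
  have "x ^ 4 = 0" "q ^ 4 = 0" "r ^ 4 = 0" using assms by algebra+
  then show "x = 0" "q = 0" "r = 0" by simp_all
qed

text \<open>A double root of \<open>T^5 + \<alpha> T + \<beta>\<close> satisfies
  \<open>4 \<alpha> T + 5 \<beta> = 0\<close>, so two different ones force
  \<open>\<alpha> = \<beta> = 0\<close>; two equal ones form a multiple root as in the case of a
  triple.\<close>

lemma power_sums_double_pair_zero:
  fixes x p r :: complex
  assumes "x + x + p + p + r = 0" "x ^ 2 + x ^ 2 + p ^ 2 + p ^ 2 + r ^ 2 = 0"
    "x ^ 3 + x ^ 3 + p ^ 3 + p ^ 3 + r ^ 3 = 0"
  shows "x = 0" "p = 0" "r = 0"
proof -
  have "x ^ 4 = 0" "p ^ 4 = 0" "r ^ 4 = 0" using assms by algebra+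
  then show "x = 0" "p = 0" "r = 0" by simp_all
qed

text \<open>At most one pair of coordinates coincides, so deleting a suitable coordinate leaves four
  distinct ones.\<close>

lemma bring_simple_coordinate:
  assumes v: "v \<in> nonzero_vecs {1..5}" "v \<in> bring_cone"
  shows "\<exists>k\<in>{1..5}. v k \<noteq> 0 \<and> inj_on v ({1..5} - {k})"
proof (cases "inj_on v {1..5}")
  case True
  moreover obtain k where "v k \<noteq> 0" using v(1) by (auto simp: nonzero_vecs_def)
  ultimately show ?thesis using v(1) by (intro bexI[of _ k]) (auto simp: nonzero_vecs_def intro: inj_on_subset)
next
  case False
  then obtain i j where ij: "i \<in> {1..5}" "j \<in> {1..5}" "i \<noteq> j" "v i = v j" by (auto simp: inj_on_def)
  have triple: False if t: "l \<in> {1..5}" "l \<noteq> i" "l \<noteq> j" "v l = v i" for l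
  proof -
    obtain q r where l: "labelling i j l q r" using labelling_extend3[of i j l] ij t by metis
    have "v i = 0" "v q = 0" "v r = 0"
      using v(2) power_sums_triple_zero[of "v i" "v q" "v r"] ij that
      unfolding bring_cone_labelling[OF l] by auto
    then show False using labelling_nonzero[OF l v(1)] ij that by auto
  qed
  have double: False if pq: "p \<in> {1..5}" "q \<in> {1..5}" "p \<noteq> q" "{p, q} \<inter> {i, j} = {}" "v p = v q" for p q
  proof -
    \<comment> \<open>After \<open>i, j, p\<close> the index \<open>q\<close> is one of the two
      remaining labels; if it is the last, these two are exchanged.\<close>
    obtain q' r where l: "labelling i j p q' r" using labelling_extend3[of i j p] ij pq by blast
    then have "q \<in> {q', r}" using labelling_cases[OF l, of q] pq by auto
    then obtain r where l: "labelling i j p q r"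
    proof
      assume "q \<in> {r}"
      then show thesis using l that[of q'] by (auto simp: labelling_def insert_commute)
    qed (use l in auto)
    have "v i = 0" "v p = 0" "v r = 0"
      using v(2) power_sums_double_pair_zero[of "v i" "v p" "v r"] ij that
      unfolding bring_cone_labelling[OF l] by auto
    then show False using labelling_nonzero[OF l v(1)] ij that by auto
  qed
  \<comment> \<open>The deleted position is one of the two equal ones. If its coordinate were 0, so
    would be the other, and the remaining three would have vanishing power sums.\<close>
  have "v i \<noteq> 0"
  proof
    assume 0: "v i = 0"
    obtain p q r where l: "labelling i j p q r" using labelling_extend2[of i j] ij by metis
    have "v p = 0" "v q = 0" "v r = 0"
      using v(2) power_sums_3_zero[of "v p" "v q" "v r"] ij 0
      unfolding bring_cone_labelling[OF l] by auto
    then show False using labelling_nonzero[OF l v(1)] ij 0 by auto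
  qed
  moreover have "inj_on v ({1..5} - {i})"
  proof (rule inj_onI, rule ccontr)
    fix p q assume pq: "p \<in> {1..5} - {i}" "q \<in> {1..5} - {i}" "v p = v q" "p \<noteq> q"
    show False
    proof (cases "p = j \<or> q = j")
      case True
      then show False using triple[of p] triple[of q] pq ij by auto
    next
      case False
      then show False using double[of p q] pq by auto
    qed
  qed
  ultimately show ?thesis using ij by blast
qed

text \<open>The coordinates of a point of Bring's curve are the roots of some \<open>T\<^sup>5 + \<alpha> T + \<beta>\<close>.  If one of
  them is \<open>1\<close>, the others are the roots of \<open>(T\<^sup>5 - 1) / (T - 1) = - \<alpha>\<close>, and \<open>- \<alpha>\<close> is a local parameter
  as long as these four roots are simple.\<close>

definition quintic_quotient :: "complex \<Rightarrow> complex" where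
  "quintic_quotient T = T ^ 4 + T ^ 3 + T ^ 2 + T + 1"

lemma quintic_quotient_holomorphic: "quintic_quotient holomorphic_on S"
  unfolding quintic_quotient_def by (intro holomorphic_intros)

lemma quintic_quotient_deriv: "deriv quintic_quotient T = 4 * T ^ 3 + 3 * T ^ 2 + 2 * T + 1"
  unfolding quintic_quotient_def
  by (rule DERIV_imp_deriv) (auto simp: algebra_simps intro!: derivative_eq_intros)

text \<open>The numbers \<open>A, B, C, D\<close> are the four roots of
  \<open>quintic_quotient T + \<alpha>\<close>, a monic polynomial whose derivative at
  \<open>A\<close> is therefore the product of the differences.\<close>

lemma quintic_quotient_power_sums:
  fixes A B C D :: complex
  assumes "1 + A + B + C + D = 0" "1 + A ^ 2 + B ^ 2 + C ^ 2 + D ^ 2 = 0" "1 + A ^ 3 + B ^ 3 + C ^ 3 + D ^ 3 = 0"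
  shows "quintic_quotient A = quintic_quotient B"
    and "4 * A ^ 3 + 3 * A ^ 2 + 2 * A + 1 = (A - B) * (A - C) * (A - D)"
  using assms unfolding quintic_quotient_def by algebra+

text \<open>Divided differences: \<open>q1\<close> and \<open>q2\<close> are those of first and
  second order of \<open>quintic_quotient\<close>, and the third is
  \<open>1 + A + B + C + D\<close>. All vanish because the four values agree at distinct arguments;
  the power sums are combinations of them.\<close>

lemma power_sums_quintic_quotient:
  fixes A B C D :: complex
  assumes "quintic_quotient A = w" "quintic_quotient B = w" "quintic_quotient C = w" "quintic_quotient D = w"
    and ne: "A \<noteq> B" "A \<noteq> C" "A \<noteq> D" "B \<noteq> C" "B \<noteq> D" "C \<noteq> D"
  shows "1 + A + B + C + D = 0" "1 + A ^ 2 + B ^ 2 + C ^ 2 + D ^ 2 = 0" "1 + A ^ 3 + B ^ 3 + C ^ 3 + D ^ 3 = 0"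
proof -
  define q1 :: "complex \<Rightarrow> complex \<Rightarrow> complex" where "q1 X Y = X^3 + X^2*Y + X*Y^2 + Y^3 + X^2 + X*Y + Y^2 + X + Y + 1" for X Y
  define q2 :: "complex \<Rightarrow> complex \<Rightarrow> complex \<Rightarrow> complex" where
    "q2 X Y Z = X^2 + Y^2 + Z^2 + X*Y + X*Z + Y*Z + X + Y + Z + 1" for X Y Z
  have 1: "q1 X Y = 0" if "quintic_quotient X = w" "quintic_quotient Y = w" "X \<noteq> Y" for X Y
  proof -
    have "(X - Y) * q1 X Y = quintic_quotient X - quintic_quotient Y"
      unfolding q1_def quintic_quotient_def by algebra
    then show ?thesis using that by simp
  qed
  have 2: "q2 X Y Z = 0" if "q1 X Y = 0" "q1 X Z = 0" "Y \<noteq> Z" for X Y Z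
  proof -
    have "(Y - Z) * q2 X Y Z = q1 X Y - q1 X Z"
      unfolding q1_def q2_def by algebra
    then show ?thesis using that by simp
  qed
  have a: "q1 A B = 0" "q1 A C = 0" "q1 A D = 0" using 1 assms by auto
  have b: "q2 A B C = 0" "q2 A B D = 0" using 2 a ne by auto
  have "(C - D) * (1 + A + B + C + D) = q2 A B C - q2 A B D"
    unfolding q2_def by algebra
  then show c: "1 + A + B + C + D = 0" using b ne by simp
  show "1 + A ^ 2 + B ^ 2 + C ^ 2 + D ^ 2 = 0"
    using b(1) c unfolding q2_def by algebra
  show "1 + A ^ 3 + B ^ 3 + C ^ 3 + D ^ 3 = 0"
    using a(1) b(1) c unfolding q1_def q2_def by algebra
qed

lemma bring_quintic_quotient:
  assumes "v \<in> bring_cone" "v k = 1" "k \<in> {1..5}" "i \<in> {1..5} - {k}" "j \<in> {1..5} - {k}"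
  shows "quintic_quotient (v i) = quintic_quotient (v j)"
proof (cases "i = j")
  case False
  then obtain p q where l: "labelling k i j p q" using labelling_extend3[of k i j] assms by blast
  show ?thesis
    using assms(1,2) quintic_quotient_power_sums(1)[of "v i" "v j" "v p" "v q"]
    unfolding bring_cone_labelling[OF l] by simp
qed simp

lemma bring_regular:
  assumes "v \<in> bring_cone" "v k = 1" "k \<in> {1..5}" "i \<in> {1..5} - {k}" "inj_on v ({1..5} - {k})"
  shows "deriv quintic_quotient (v i) \<noteq> 0"
proof -
  obtain p q r where l: "labelling k i p q r" using labelling_extend2[of k i] assms by blast
  then have "{i, p, q, r} \<subseteq> {1..5} - {k}" "distinct [i, p, q, r]" unfolding labelling_def by auto
  then have "v i \<noteq> v p" "v i \<noteq> v q" "v i \<noteq> v r" using inj_onD[OF assms(5)] by auto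
  then show ?thesis
    using assms(1,2) quintic_quotient_power_sums(2)[of "v i" "v p" "v q" "v r"]
    unfolding bring_cone_labelling[OF l] by (simp add: quintic_quotient_deriv)
qed

text \<open>With one coordinate normalized to 1, each of the other four is a local inverse branch of
  \<open>quintic_quotient\<close> at the common value \<open>w\<close>, which is the parameter.
  Conversely such branches yield a point of the curve only while they are distinct, hence the
  disjoint discs.\<close>

lemma bring_chart:
  assumes L: "L \<in> bring_points"
  shows "\<exists>U \<phi>. (U, \<phi>) \<in> surf_atlas (projective_curve {1..5} bring_points) \<and> L \<in> U"
proof -
  obtain u where u: "u \<in> nonzero_vecs {1..5}" "u \<in> bring_cone" "L = proj_point u"
    using L by (auto simp: bring_points_def)
  obtain k where k: "k \<in> {1..5}" "u k \<noteq> 0" "inj_on u ({1..5} - {k})"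
    using bring_simple_coordinate[OF u(1,2)] by blast
  define v0 where "v0 = (\<lambda>i. inverse (u k) * u i)"
  have v0: "v0 \<in> nonzero_vecs {1..5}" "v0 \<in> bring_cone" "L = proj_point v0" "v0 k = 1"
    using nonzero_vecs_scale[OF u(1), of "inverse (u k)"] bring_cone_scale[OF u(2), of "inverse (u k)"]
      proj_point_scale[of "inverse (u k)" u] k u by (auto simp: v0_def)
  define J where "J = {1..5} - {k}"
  have finJ: "finite J" by (simp add: J_def)
  have inj0: "inj_on v0 J" using k unfolding v0_def J_def inj_on_def by auto
  let ?g = quintic_quotient
  have "\<exists>r>0. inj_on ?g (ball (v0 i) r)" if "i \<in> J" for i
    using has_complex_derivative_locally_invertible[OF quintic_quotient_holomorphic[of UNIV] UNIV_I open_UNIV]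
      bring_regular[OF v0(2,4) k(1)] that inj0 unfolding J_def by metis
  then obtain r where r: "\<And>i. i \<in> J \<Longrightarrow> r i > 0 \<and> inj_on ?g (ball (v0 i) (r i))" by metis
  have ev: "eventually (\<lambda>\<delta>. \<delta> < c) (at_right 0)" if "c > 0" for c :: real
    using that eventually_at_right[of 0 c "\<lambda>\<delta>. \<delta> < c"] by auto
  \<comment> \<open>A common radius: small enough for injectivity at each of the four values, and
    below half of their mutual distances to keep the discs disjoint.\<close>
  have "eventually (\<lambda>\<delta>. 0 < \<delta> \<and> (\<forall>i\<in>J. \<delta> < r i) \<and> (\<forall>i\<in>J. \<forall>j\<in>J - {i}. \<delta> < dist (v0 i) (v0 j) / 2)) (at_right 0)"
  proof (intro eventually_conj eventually_ball_finite ballI finJ)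
    show "eventually (\<lambda>\<delta>. \<delta> < r i) (at_right 0)" if "i \<in> J" for i using r that ev by blast
    show "finite (J - {i})" for i using finJ by simp
    show "eventually (\<lambda>\<delta>. \<delta> < dist (v0 i) (v0 j) / 2) (at_right 0)" if "i \<in> J" "j \<in> J - {i}" for i j
      using inj_onD[OF inj0, of i j] that by (intro ev) auto
  qed (simp add: eventually_at_right_less)
  then obtain \<delta> where \<delta>: "0 < \<delta>" "\<And>i. i \<in> J \<Longrightarrow> \<delta> < r i"
      "\<And>i j. i \<in> J \<Longrightarrow> j \<in> J \<Longrightarrow> i \<noteq> j \<Longrightarrow> \<delta> < dist (v0 i) (v0 j) / 2"
    using eventually_happens'[OF trivial_limit_at_right_real] by (smt (verit, best) DiffI singletonD)
  let ?B = "\<lambda>i. ball (v0 i) \<delta>"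
  have injB: "inj_on ?g (?B i)" if "i \<in> J" for i
    using r[OF that] \<delta>(2)[OF that] by (meson inj_on_subset less_imp_le subset_ball)
  have disj: "z \<noteq> z'" if "i \<in> J" "j \<in> J" "i \<noteq> j" "z \<in> ?B i" "z' \<in> ?B j" for i j z z'
    using \<delta>(3)[OF that(1-3)] that(4,5) dist_triangle_half_r[of z "v0 i" "2 * \<delta>" "v0 j"]
    by (auto simp: dist_commute)
  define \<rho> where "\<rho> i = inv_into (?B i) ?g" for i
  have \<rho>g: "\<rho> i (?g z) = z" if "i \<in> J" "z \<in> ?B i" for i z
    unfolding \<rho>_def by (rule inv_into_f_f[OF injB[OF that(1)] that(2)])
  have oB: "open (?g ` ?B i)" if "i \<in> J" for i
    by (rule open_mapping_thm3[OF quintic_quotient_holomorphic open_ball injB[OF that]])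
  have h\<rho>: "\<rho> i holomorphic_on ?g ` ?B i" if "i \<in> J" for i
    by (rule holomorphic_inv_of_holomorphic[OF quintic_quotient_holomorphic open_ball \<rho>g[OF that]])
  \<comment> \<open>On \<open>D\<close> all four inverse branches are defined.\<close>
  define D where "D = (\<Inter>i\<in>J. ?g ` ?B i)"
  have oD: "open D" unfolding D_def using oB finJ by blast
  have \<rho>D: "\<rho> i w \<in> ?B i" "?g (\<rho> i w) = w" if "i \<in> J" "w \<in> D" for i w
    using that \<rho>g by (auto simp: D_def)
  define h :: "complex \<Rightarrow> cvec" where "h w = (\<lambda>i. if i = k then 1 else if i \<in> J then \<rho> i w else 0)" for w
  have hk: "h w k = 1" for w by (simp add: h_def)
  have hJ: "h w i = \<rho> i w" if "i \<in> J" for w i using that by (auto simp: h_def J_def)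
  have hnz: "h w \<in> nonzero_vecs {1..5}" for w
    using k hk unfolding nonzero_vecs_def by (auto simp: h_def J_def)
  have "\<exists>a. a \<in> J"
    by (rule exI[of _ "if k = 1 then 2 else 1"]) (auto simp: J_def)
  then obtain a where a: "a \<in> J" ..
  obtain b c d where l: "labelling k a b c d"
    using labelling_extend2[of k a] k a by (auto simp: J_def)
  then have J: "J = {a, b, c, d}" "distinct [a, b, c, d]" by (auto simp: labelling_def J_def)
  have hcone: "h w \<in> bring_cone" if "w \<in> D" for w
  proof -
    have in_J: "a \<in> J" "b \<in> J" "c \<in> J" "d \<in> J" using J by auto
    note e = \<rho>D(2)[OF in_J(1) that] \<rho>D(2)[OF in_J(2) that] \<rho>D(2)[OF in_J(3) that] \<rho>D(2)[OF in_J(4) that]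
    have "\<rho> i w \<noteq> \<rho> j w" if "i \<in> J" "j \<in> J" "i \<noteq> j" for i j
      using disj[OF that] \<rho>D(1) that \<open>w \<in> D\<close> by blast
    then have ne: "\<rho> a w \<noteq> \<rho> b w" "\<rho> a w \<noteq> \<rho> c w" "\<rho> a w \<noteq> \<rho> d w" "\<rho> b w \<noteq> \<rho> c w" "\<rho> b w \<noteq> \<rho> d w" "\<rho> c w \<noteq> \<rho> d w"
      using J(2) in_J by auto
    show ?thesis
      unfolding bring_cone_labelling[OF l] hk hJ[OF in_J(1)] hJ[OF in_J(2)] hJ[OF in_J(3)] hJ[OF in_J(4)]
      using power_sums_quintic_quotient[OF e ne] by simp
  qed
  define N where "N = (\<Inter>i\<in>J. (\<lambda>v::cvec. v i) -` ?B i)"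
  have oN: "open N"
    unfolding N_def by (intro open_INT finJ ballI open_vimage continuous_on_coordinate open_ball)
  have c\<Phi>: "continuous_on N (\<lambda>v. ?g (v a))"
    by (rule continuous_on_compose2[OF holomorphic_on_imp_continuous_on[OF quintic_quotient_holomorphic]
          continuous_on_coordinate subset_UNIV])
  show ?thesis
    unfolding v0(3)
  proof (rule projective_curve_chartI[OF bring_points_subset oD oN c\<Phi>, where k = k and h = h])
    show "(\<lambda>w. h w i) holomorphic_on D" for i
    proof -
      have "\<rho> i holomorphic_on D" if "i \<in> J"
        by (rule holomorphic_on_subset[OF h\<rho>[OF that]]) (use that in \<open>auto simp: D_def\<close>)
      then show ?thesis unfolding h_def by (cases "i = k"; cases "i \<in> J"; simp)
    qed
    fix w assume w: "w \<in> D"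
    show "h w \<in> nonzero_vecs {1..5} \<and> h w k = 1 \<and> proj_point (h w) \<in> bring_points \<and> h w \<in> N \<and> ?g (h w a) = w"
    proof (intro conjI)
      show "proj_point (h w) \<in> bring_points" using proj_point_in_bring_points[OF hnz] hcone[OF w] by blast
      show "h w \<in> N" unfolding N_def using \<rho>D(1)[OF _ w] hJ by (simp del: mem_ball)
      show "?g (h w a) = w" using \<rho>D(2)[OF a w] hJ[OF a] by simp
    qed (rule hnz hk)+
    \<comment> \<open>The \<open>k\<close>-th component is constantly 1, so the minor for
      \<open>k\<close> and \<open>a\<close> is the derivative of the injective function
      \<open>\<rho> a\<close>.\<close>
    show "\<exists>i j. h w i * deriv (\<lambda>u. h u j) w \<noteq> h w j * deriv (\<lambda>u. h u i) w"
    proof (intro exI)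
      have "inj_on (\<rho> a) D" using \<rho>D(2)[OF a] by (metis inj_onI)
      moreover have "\<rho> a holomorphic_on D"
        by (rule holomorphic_on_subset[OF h\<rho>[OF a]]) (use a in \<open>auto simp: D_def\<close>)
      ultimately have "deriv (\<rho> a) w \<noteq> 0" using holomorphic_injective_imp_regular oD w by blast
      then show "h w k * deriv (\<lambda>u. h u a) w \<noteq> h w a * deriv (\<lambda>u. h u k) w"
        by (simp add: hk hJ[OF a])
    qed
  next
    fix v assume v: "v \<in> nonzero_vecs {1..5}" "v k = 1" "v \<in> N" "proj_point v \<in> bring_points"
    then have vc: "v \<in> bring_cone" using proj_point_in_bring_points[OF v(1)] by blast
    have eq: "?g (v a) = ?g (v i)" if "i \<in> J" for i
      using bring_quintic_quotient[OF vc v(2) k(1) a[unfolded J_def] that[unfolded J_def]] .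
    have vB: "v i \<in> ?B i" if "i \<in> J" for i using v(3) that by (auto simp: N_def)
    have "?g (v a) \<in> D"
      unfolding D_def
    proof
      fix i assume "i \<in> J"
      then show "?g (v a) \<in> ?g ` ?B i" using eq vB by auto
    qed
    moreover have "h (?g (v a)) = v"
    proof
      fix i
      show "h (?g (v a)) i = v i"
      proof (cases "i \<in> J")
        case True
        then show ?thesis using hJ \<rho>g[OF True vB[OF True]] eq[OF True] by simp
      next
        case False
        then show ?thesis using v(1,2) by (auto simp: h_def J_def nonzero_vecs_def)
      qed
    qed
    ultimately show "?g (v a) \<in> D \<and> h (?g (v a)) = v" ..
  next
    show "v0 \<in> N" using \<delta>(1) by (auto simp: N_def)
    show "proj_point v0 \<in> bring_points" using v0 L by simp
  qed (use v0 in auto)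
qed

section \<open>Subgroups of the alternating group\<close>

text \<open>The 3-cycle generates a normal subgroup of order 3, so conjugation fixes it or inverts
  it. Relations of this form transfer along the isomorphism to \<open>G\<close>.\<close>

lemma sym_group_3_conjugation:
  defines "c \<equiv> (\<lambda>i::nat. if i = 1 then 2 else if i = 2 then 3 else if i = 3 then 1 else i)"
  shows "c \<in> carrier (sym_group 3)" "c \<circ> c \<circ> c = id" "c \<noteq> id"
    and "p \<in> carrier (sym_group 3) \<Longrightarrow> p \<circ> c = c \<circ> p \<or> p \<circ> c = c \<circ> c \<circ> p"
proof -
  have set3: "{1..3} = {1, 2, 3 :: nat}" by auto
  show c3: "c \<circ> c \<circ> c = id" by (auto simp: c_def fun_eq_iff)
  have "bij c" using c3 by (intro o_bij[of "c \<circ> c"]) (simp_all add: comp_assoc)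
  then show "c \<in> carrier (sym_group 3)"
    unfolding sym_group_carrier by (auto simp: permutes_def c_def bij_iff)
  have "c 1 \<noteq> 1" by (simp add: c_def)
  then show "c \<noteq> id" by auto
  assume "p \<in> carrier (sym_group 3)"
  then have p: "p permutes {1, 2, 3}" unfolding sym_group_carrier set3 .
  have ext: "f = g" if "f 1 = g 1" "f 2 = g 2" "f 3 = g 3" "\<And>i. i \<notin> {1, 2, 3} \<Longrightarrow> f i = g i" for f g :: "nat \<Rightarrow> nat"
    using that by (metis empty_iff ext insert_iff)
  have out: "p i = i" if "i \<notin> {1, 2, 3}" for i using p that by (simp add: permutes_def)
  have "p 1 \<in> {1, 2, 3}" "p 2 \<in> {1, 2, 3}" "p 3 \<in> {1, 2, 3}"
    using permutes_in_image[OF p, of 1] permutes_in_image[OF p, of 2] permutes_in_image[OF p, of 3] by simp_all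
  moreover have "p 1 \<noteq> p 2" "p 1 \<noteq> p 3" "p 2 \<noteq> p 3"
    using injD[OF permutes_inj[OF p], of 1 2] injD[OF permutes_inj[OF p], of 1 3]
      injD[OF permutes_inj[OF p], of 2 3] by auto
  ultimately consider "p 1 = 1" "p 2 = 2" "p 3 = 3" | "p 1 = 2" "p 2 = 3" "p 3 = 1" | "p 1 = 3" "p 2 = 1" "p 3 = 2"
    | "p 1 = 1" "p 2 = 3" "p 3 = 2" | "p 1 = 2" "p 2 = 1" "p 3 = 3" | "p 1 = 3" "p 2 = 2" "p 3 = 1"
    by auto
  then show "p \<circ> c = c \<circ> p \<or> p \<circ> c = c \<circ> c \<circ> p"
  proof cases
    case 1 then show ?thesis by (intro disjI1 ext) (auto simp: c_def out)
  next
    case 2 then show ?thesis by (intro disjI1 ext) (auto simp: c_def out)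
  next
    case 3 then show ?thesis by (intro disjI1 ext) (auto simp: c_def out)
  next
    case 4 then show ?thesis by (intro disjI2 ext) (auto simp: c_def out)
  next
    case 5 then show ?thesis by (intro disjI2 ext) (auto simp: c_def out)
  next
    case 6 then show ?thesis by (intro disjI2 ext) (auto simp: c_def out)
  qed
qed

lemma labelling_permutation_eqI:
  assumes "labelling a b c d e" "p permutes {1..5}" "q permutes {1..5}"
    and "p a = q a" "p b = q b" "p c = q c" "p d = q d" "p e = q e"
  shows "p = q"
proof
  fix i
  show "p i = q i"
    using labelling_cases[OF assms(1), of i] assms(2-) by (auto simp: permutes_def)
qed

text \<open>Covers the candidates that have to be excluded from the alternating group: a single
  transposition, and a 3-cycle, written as two transpositions, combined with a
  transposition.\<close>

lemma odd_transpositions: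
  assumes "u \<noteq> v"
  shows "\<not> evenperm (Transposition.transpose u v)"
    and "w \<noteq> x \<Longrightarrow> y \<noteq> z \<Longrightarrow> \<not> evenperm (Transposition.transpose u v \<circ> Transposition.transpose w x \<circ> Transposition.transpose y z)"
  using assms by (simp_all add: evenperm_comp permutation_swap_id permutation_compose evenperm_swap)

text \<open>An element \<open>t\<close> of order 3 on five letters is a 3-cycle
  \<open>(a b c)\<close>. Each \<open>\<sigma>\<close> in \<open>G\<close> commutes with
  \<open>t\<close> or inverts it, so it preserves \<open>{d, e}\<close> and is determined on
  \<open>a, b, c\<close> by \<open>\<sigma> a\<close>. Evenness makes the commuting elements fix
  \<open>d, e\<close> and the inverting ones exchange them.\<close>

theorem alternating_S3_subgroup:
  assumes G: "subgroup G (alt_group 5)" and iso: "(alt_group 5)\<lparr>carrier := G\<rparr> \<cong> sym_group 3"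
  shows "\<exists>a b c d e. labelling a b c d e \<and>
    (\<lambda>\<sigma>. (\<sigma> a, \<sigma> b, \<sigma> c, \<sigma> d, \<sigma> e)) ` G =
      {(a, b, c, d, e), (b, c, a, d, e), (c, a, b, d, e), (a, c, b, e, d), (c, b, a, e, d), (b, a, c, e, d)}"
proof -
  have Gp: "\<sigma> permutes {1..5}" "evenperm \<sigma>" if "\<sigma> \<in> G" for \<sigma>
    using subgroup.subset[OF G] that alt_group_carrier by blast+
  have G_mult: "\<sigma> \<circ> \<tau> \<in> G" if "\<sigma> \<in> G" "\<tau> \<in> G" for \<sigma> \<tau>
    using subgroup.m_closed[OF G that] by (simp add: alt_group_mult)
  obtain f where f: "f \<in> iso ((alt_group 5)\<lparr>carrier := G\<rparr>) (sym_group 3)"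
    using iso by (auto simp: is_iso_def)
  have f_mult: "f (\<sigma> \<circ> \<tau>) = f \<sigma> \<circ> f \<tau>" if "\<sigma> \<in> G" "\<tau> \<in> G" for \<sigma> \<tau>
    using f that by (simp add: iso_def hom_def alt_group_mult sym_group_mult)
  have f_bij: "bij_betw f G (carrier (sym_group 3))" using f by (simp add: iso_def)
  have f_inj: "\<sigma> = \<tau>" if "\<sigma> \<in> G" "\<tau> \<in> G" "f \<sigma> = f \<tau>" for \<sigma> \<tau>
    using f_bij that by (auto simp: bij_betw_def inj_on_def)
  have card_G: "card G = 6"
    using bij_betw_same_card[OF f_bij] sym_group_card_carrier[of 3] by (simp add: fact_numeral)
  have id_G: "id \<in> G" using subgroup.one_closed[OF G] by (simp add: alt_group_one)
  have f_id: "f id = id"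
  proof -
    have "f id \<circ> f id = f id" using f_mult[OF id_G id_G] by simp
    moreover have "bij (f id)"
      using bij_betw_apply[OF f_bij id_G] permutes_bij unfolding sym_group_carrier by blast
    ultimately show ?thesis by (metis bij_is_inj comp_assoc inv_o_cancel id_comp)
  qed
  define c3 :: "nat \<Rightarrow> nat" where "c3 = (\<lambda>i. if i = 1 then 2 else if i = 2 then 3 else if i = 3 then 1 else i)"
  note c3 = sym_group_3_conjugation[folded c3_def]
  obtain t where t: "t \<in> G" "f t = c3" using f_bij c3(1) by (metis bij_betw_def imageE)
  have t3: "t \<circ> t \<circ> t = id"
    by (rule f_inj) (use t c3(2) f_id in \<open>simp_all add: f_mult G_mult id_G\<close>)
  have t_id: "t \<noteq> id" using c3(3) t f_id by metis
  have conj: "\<sigma> \<circ> t = t \<circ> \<sigma> \<or> \<sigma> \<circ> t = t \<circ> t \<circ> \<sigma>" if \<sigma>: "\<sigma> \<in> G" for \<sigma>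
  proof -
    have "f \<sigma> \<in> carrier (sym_group 3)" using f_bij \<sigma> by (auto simp: bij_betw_def)
    from c3(4)[OF this] have "f (\<sigma> \<circ> t) = f (t \<circ> \<sigma>) \<or> f (\<sigma> \<circ> t) = f (t \<circ> t \<circ> \<sigma>)"
      using \<sigma> t by (simp add: f_mult G_mult)
    then show ?thesis using f_inj G_mult \<sigma> t(1) by meson
  qed
  have t3': "t (t (t i)) = i" for i using t3 by (metis comp_apply id_apply)
  have tI: "t i \<in> {1..5} \<longleftrightarrow> i \<in> {1..5}" for i using permutes_in_image[OF Gp(1)[OF t(1)]] .
  have inj: "\<sigma> i = \<sigma> j \<longleftrightarrow> i = j" if "\<sigma> \<in> G" for \<sigma> i j
    using permutes_inj[OF Gp(1)[OF that]] by (auto dest: injD)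
  obtain a where a: "t a \<noteq> a" using t_id by (metis eq_id_iff)
  then have a5: "a \<in> {1..5}" using Gp(1)[OF t(1)] by (metis permutes_not_in)
  define b where "b = t a"
  define c where "c = t b"
  have tabc: "t a = b" "t b = c" "t c = a" using t3' by (simp_all add: b_def c_def)
  have ne: "a \<noteq> b" "a \<noteq> c" "b \<noteq> c" using a tabc by metis+
  obtain d e where l: "labelling a b c d e"
    using labelling_extend3[of a b c] a5 ne tI tabc by metis
  have dist: "a \<noteq> d" "a \<noteq> e" "b \<noteq> d" "b \<noteq> e" "c \<noteq> d" "c \<noteq> e" "d \<noteq> e"
    using l by (auto simp: labelling_def)
  have in5: "i \<in> {1..5} \<longleftrightarrow> i = a \<or> i = b \<or> i = c \<or> i = d \<or> i = e" for i
    using l by (auto simp: labelling_def)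
  have t_de: "t d \<in> {d, e}" "t e \<in> {d, e}"
  proof -
    have "t i \<in> {d, e}" if i: "i = d \<or> i = e" for i
    proof -
      have "t i \<noteq> b" "t i \<noteq> c" "t i \<noteq> a"
        using inj[OF t(1), of i a] inj[OF t(1), of i b] inj[OF t(1), of i c] tabc dist i by auto
      moreover have "t i \<in> {1..5}" using i in5 tI by blast
      ultimately show ?thesis using in5[of "t i"] by auto
    qed
    then show "t d \<in> {d, e}" "t e \<in> {d, e}" by auto
  qed
  \<comment> \<open>The order of \<open>t\<close> on the pair \<open>d, e\<close> divides both 2 and
    3.\<close>
  have td: "t d = d" "t e = e"
    using t_de t3' dist by (metis empty_iff insert_iff)+
  have fixed: "i = d \<or> i = e" if "t i = i" "i \<in> {1..5}" for i
    using that in5[of i] tabc ne by metis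
  let ?T = "\<lambda>\<sigma>. (\<sigma> a, \<sigma> b, \<sigma> c, \<sigma> d, \<sigma> e)"
  let ?R = "{(a, b, c, d, e), (b, c, a, d, e), (c, a, b, d, e), (a, c, b, e, d), (c, b, a, e, d), (b, a, c, e, d)}"
  have "?T \<sigma> \<in> ?R" if \<sigma>: "\<sigma> \<in> G" for \<sigma>
  proof -
    have \<sigma>5: "\<sigma> i \<in> {1..5} \<longleftrightarrow> i \<in> {1..5}" for i using permutes_in_image[OF Gp(1)[OF \<sigma>]] .
    have cj: "(\<forall>i. \<sigma> (t i) = t (\<sigma> i)) \<or> (\<forall>i. \<sigma> (t i) = t (t (\<sigma> i)))"
      using conj[OF \<sigma>] by (metis comp_apply)
    \<comment> \<open>Since \<open>\<sigma>\<close> normalizes the group generated by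
      \<open>t\<close>, it preserves the fixed points of that group.\<close>
    have "t (\<sigma> i) = \<sigma> i" if "t i = i" for i using cj t3' that by metis
    then have de: "\<sigma> d = d \<or> \<sigma> d = e" "\<sigma> e = d \<or> \<sigma> e = e"
      using fixed td \<sigma>5 in5 by metis+
    then have de: "(\<sigma> d = d \<and> \<sigma> e = e) \<or> (\<sigma> d = e \<and> \<sigma> e = d)"
      using inj[OF \<sigma>] dist by metis
    have abc: "\<sigma> a = a \<or> \<sigma> a = b \<or> \<sigma> a = c"
      using de \<sigma>5[of a] in5 inj[OF \<sigma>] dist by metis
    \<comment> \<open>An unwanted case is refuted by an explicit odd permutation having the same
      five values as the even \<open>\<sigma>\<close>.\<close>
    have odd: False if "q permutes {1..5}" "\<not> evenperm q"
      "\<sigma> a = q a" "\<sigma> b = q b" "\<sigma> c = q c" "\<sigma> d = q d" "\<sigma> e = q e" for q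
      using labelling_permutation_eqI[OF l Gp(1)[OF \<sigma>] that(1,3-)] that(2) Gp(2)[OF \<sigma>] by simp
    have tr: "Transposition.transpose u v permutes {1..5}" if "u \<in> {1..5}" "v \<in> {1..5}" for u v
      by (rule permutes_swap_id[OF that])
    have mem: "a \<in> {1..5}" "b \<in> {1..5}" "c \<in> {1..5}" "d \<in> {1..5}" "e \<in> {1..5}"
      unfolding in5 by simp_all
    note ev = ne dist ne[symmetric] dist[symmetric]
    from cj show ?thesis
    proof
      assume "\<forall>i. \<sigma> (t i) = t (\<sigma> i)"
      then have bc: "\<sigma> b = t (\<sigma> a)" "\<sigma> c = t (t (\<sigma> a))" using tabc by metis+
      from de show ?thesis
      proof
        assume "\<sigma> d = d \<and> \<sigma> e = e"
        with abc bc tabc show ?thesis by (elim disjE) simp_all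
      next
        assume de: "\<sigma> d = e \<and> \<sigma> e = d"
        from abc show ?thesis
        proof (elim disjE)
          assume "\<sigma> a = a"
          then have False
            using odd[OF tr[OF mem(4,5)] odd_transpositions(1)] de bc tabc ev by (simp add: Transposition.transpose_def)
          then show ?thesis ..
        next
          assume "\<sigma> a = b"
          then have False
            using odd[OF permutes_compose[OF tr[OF mem(4,5)] permutes_compose[OF tr[OF mem(2,3)] tr[OF mem(1,2)]]]]
             odd_transpositions(2)[of a b b c d e] de bc tabc ev by (simp add: Transposition.transpose_def comp_assoc)
          then show ?thesis ..
        next
          assume "\<sigma> a = c"
          then have False
            using odd[OF permutes_compose[OF tr[OF mem(4,5)] permutes_compose[OF tr[OF mem(1,2)] tr[OF mem(2,3)]]]]
             odd_transpositions(2)[of b c a b d e] de bc tabc ev by (simp add: Transposition.transpose_def comp_assoc)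
          then show ?thesis ..
        qed
      qed
    next
      assume "\<forall>i. \<sigma> (t i) = t (t (\<sigma> i))"
      then have bc: "\<sigma> b = t (t (\<sigma> a))" "\<sigma> c = t (\<sigma> a)" using tabc t3' by metis+
      from de show ?thesis
      proof
        assume "\<sigma> d = e \<and> \<sigma> e = d"
        with abc bc tabc show ?thesis by (elim disjE) simp_all
      next
        assume de: "\<sigma> d = d \<and> \<sigma> e = e"
        from abc show ?thesis
        proof (elim disjE)
          assume "\<sigma> a = a"
          then have False
            using odd[OF tr[OF mem(2,3)] odd_transpositions(1)] de bc tabc ev by (simp add: Transposition.transpose_def)
          then show ?thesis ..
        next
          assume "\<sigma> a = b"
          then have False
            using odd[OF tr[OF mem(1,2)] odd_transpositions(1)] de bc tabc ev by (simp add: Transposition.transpose_def)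
          then show ?thesis ..
        next
          assume "\<sigma> a = c"
          then have False
            using odd[OF tr[OF mem(1,3)] odd_transpositions(1)] de bc tabc ev by (simp add: Transposition.transpose_def)
          then show ?thesis ..
        qed
      qed
    qed
  qed
  then have "?T ` G \<subseteq> ?R" by (rule image_subsetI)
  \<comment> \<open>The five values determine an element, so the six elements of \<open>G\<close>
    exhaust the six candidates.\<close>
  moreover have "inj_on ?T G"
    by (rule inj_onI, rule labelling_permutation_eqI[OF l Gp(1) Gp(1)]) simp_all
  then have "card (?T ` G) = 6" using card_G by (simp only: card_image)
  moreover have "card ?R \<le> 6" by (intro card_insert_le_m1) auto
  ultimately have "?T ` G = ?R" by (intro card_seteq) auto
  with l show ?thesis by (intro exI conjI)
qed

section \<open>Newton's identities and the discriminant of the cubic\<close>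

lemma cubic_discriminant:
  fixes A B C :: complex
  assumes "e1 = A + B + C" "e2 = A*B + B*C + C*A" "e3 = A*B*C"
  shows "((A - B) * (B - C) * (C - A))\<^sup>2 = e1^2*e2^2 - 4*e2^3 - 4*e1^3*e3 + 18*e1*e2*e3 - 27*e3^2"
  unfolding assms by algebra

text \<open>The power sums of \<open>A, B, C\<close> are the negatives of those of
  \<open>D, E\<close>, and Newton's identities turn them into elementary symmetric functions;
  \<open>D^2 + E^2\<close> is half the sum of the squares of \<open>D + E\<close> and
  \<open>D - E\<close>.\<close>

lemma bring_relations:
  fixes A B C D E :: complex
  assumes "A + B + C + D + E = 0" "A ^ 2 + B ^ 2 + C ^ 2 + D ^ 2 + E ^ 2 = 0" "A ^ 3 + B ^ 3 + C ^ 3 + D ^ 3 + E ^ 3 = 0"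
  shows "A + B + C = - (D + E)" "A * B + B * C + C * A = ((D - E)^2 + 3 * (D + E)^2) / 4"
    "A * B * C = (D + E)^3 - (D + E) * ((D - E)^2 + 3 * (D + E)^2) / 2"
proof -
  show "A + B + C = - (D + E)" using assms(1) by algebra
  have "4 * (A * B + B * C + C * A) = (D - E)^2 + 3 * (D + E)^2" using assms by algebra
  then show "A * B + B * C + C * A = ((D - E)^2 + 3 * (D + E)^2) / 4"
    by (metis nonzero_mult_div_cancel_left zero_neq_numeral)
  have "2 * (A * B * C) = 2 * (D + E)^3 - (D + E) * ((D - E)^2 + 3 * (D + E)^2)" using assms by algebra
  then show "A * B * C = (D + E)^3 - (D + E) * ((D - E)^2 + 3 * (D + E)^2) / 2" by (simp add: field_simps)
qed

lemma bring_discriminant: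
  fixes A B C D E :: complex
  assumes "A + B + C = - s" "A * B + B * C + C * A = (d^2 + 3 * s^2) / 4"
    "A * B * C = s^3 - s * (d^2 + 3 * s^2) / 2"
  shows "(4 * \<i> * ((A - B) * (B - C) * (C - A)) * d)^2 = d^8 + 80 * s^2 * d^6 + 125 * s^4 * d^4 + 50 * s^6 * d^2"
proof -
  \<comment> \<open>The constants 80, 125 and 50 originate here, from inserting the elementary
    symmetric functions into the discriminant.\<close>
  have "16 * ((A - B) * (B - C) * (C - A))\<^sup>2 = - (d^6 + 80 * s^2 * d^4 + 125 * s^4 * d^2 + 50 * s^6)"
    unfolding cubic_discriminant[OF assms(1)[symmetric] assms(2)[symmetric] assms(3)[symmetric]]
    by (simp add: field_simps power_numeral_reduce power2_eq_square)
  moreover have "(4 * \<i> * X * d)^2 = - (16 * X\<^sup>2) * d^2" for X by (simp add: power_mult_distrib)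
  ultimately have "(4 * \<i> * ((A - B) * (B - C) * (C - A)) * d)^2 =
      (d^6 + 80 * s^2 * d^4 + 125 * s^4 * d^2 + 50 * s^6) * d^2"
    by (simp only: minus_minus)
  also have "\<dots> = d^8 + 80 * s^2 * d^6 + 125 * s^4 * d^4 + 50 * s^6 * d^2"
    by (simp add: algebra_simps flip: power_add)
  finally show ?thesis .
qed

section \<open>The quotient map\<close>

text \<open>A map \<open>F\<close> that preserves holomorphic families of vectors carries local
  lifts of a parametrization to local lifts of its image, which the charts of the target read
  holomorphically. Continuity descends because over a closed \<open>C\<close> the projection from
  vectors is still a quotient map.\<close>

lemma holomorphic_map_projective_curve:
  assumes C: "closedin (projective_space I) C"
    and cont: "continuous_on UNIV F"
    and F: "\<And>v. v \<in> nonzero_vecs I \<Longrightarrow> proj_point v \<in> C \<Longrightarrow>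
      F v \<in> nonzero_vecs I' \<and> proj_point (F v) \<in> C' \<and> f (proj_point v) = proj_point (F v)"
    and hol: "\<And>h W i. (\<And>i. (\<lambda>t. h t i) holomorphic_on W) \<Longrightarrow> (\<lambda>t. F (h t) i) holomorphic_on W"
  shows "holomorphic_map (projective_curve I C) (projective_curve I' C') f"
proof -
  let ?X = "subtopology (projective_space I) C" and ?Y = "subtopology (projective_space I') C'"
  let ?V = "{v \<in> nonzero_vecs I. proj_point v \<in> C}"
  have "quotient_map (subtopology (top_of_set (nonzero_vecs I)) ?V) ?X proj_point"
    by (rule quotient_map_restriction[OF quotient_map_proj_point]) (use C in auto)
  moreover have "subtopology (top_of_set (nonzero_vecs I)) ?V = top_of_set ?V"
    by (simp add: subtopology_subtopology Int_absorb1 Collect_mono_iff subset_eq)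
  ultimately have qm: "quotient_map (top_of_set ?V) ?X proj_point" by simp
  have "continuous_map (top_of_set ?V) (projective_space I') (\<lambda>v. proj_point (F v))"
    using continuous_on_subset[OF cont subset_UNIV]
      continuous_map_compose[of "top_of_set ?V" "top_of_set (nonzero_vecs I')" F "projective_space I'" proj_point]
      quotient_imp_continuous_map[OF quotient_map_proj_point[of I']] F
    by (auto simp: continuous_map_in_subtopology o_def)
  then have "continuous_map (top_of_set ?V) ?Y (\<lambda>v. proj_point (F v))"
    using F by (auto simp: continuous_map_in_subtopology)
  then have "continuous_map (top_of_set ?V) ?Y (f \<circ> proj_point)"
    by (rule continuous_map_eq) (use F in auto)
  then have cf: "continuous_map ?X ?Y f"
    by (rule continuous_compose_quotient_map[OF qm])
  show ?thesis
    unfolding holomorphic_map_def surf_top_projective_curve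
  proof (intro conjI cf; clarify)
    fix U \<phi> V \<psi>
    assume U: "(U, \<phi>) \<in> surf_atlas (projective_curve I C)" and V: "(V, \<psi>) \<in> surf_atlas (projective_curve I' C')"
    have Uc: "complex_chart ?X U \<phi>" and Vc: "complex_chart ?Y V \<psi>"
      using U V by (simp_all add: surf_atlas_projective_curve)
    let ?A = "{x \<in> U. f x \<in> V}"
    have UX: "U \<subseteq> topspace ?X" by (rule complex_chart_subset[OF Uc])
    have "?A = U \<inter> {x \<in> topspace ?X. f x \<in> V}" using UX by auto
    then have "openin ?X ?A"
      using openin_Int[OF complex_chart_openin[OF Uc]
          openin_continuous_map_preimage[OF cf complex_chart_openin[OF Vc]]] by simp
    then have oA: "open (\<phi> ` ?A)" by (rule complex_chart_open_subimage[OF Uc]) auto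
    have "projective_holomorphic I (\<phi> ` U) (inv_into U \<phi>)"
      using U projective_holomorphic_immersion by (simp add: surf_atlas_projective_curve)
    then have ph: "projective_holomorphic I (\<phi> ` ?A) (inv_into U \<phi>)"
      by (rule projective_holomorphic_subset[OF _ oA]) auto
    have "projective_holomorphic I' (\<phi> ` ?A) (f \<circ> inv_into U \<phi>)"
      unfolding projective_holomorphic_def
    proof
      fix t0 assume "t0 \<in> \<phi> ` ?A"
      then obtain W h where W: "open W" "t0 \<in> W" "W \<subseteq> \<phi> ` ?A" "\<And>i. (\<lambda>t. h t i) holomorphic_on W"
          and h: "\<And>t. t \<in> W \<Longrightarrow> h t \<in> nonzero_vecs I \<and> inv_into U \<phi> t = proj_point (h t)"
        using ph unfolding projective_holomorphic_def by meson
      have Fh: "F (h t) \<in> nonzero_vecs I' \<and> (f \<circ> inv_into U \<phi>) t = proj_point (F (h t))" if t: "t \<in> W" for t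
      proof -
        have "t \<in> \<phi> ` U" using t W(3) by auto
        then have "inv_into U \<phi> t \<in> C" using complex_chart_inv(3)[OF Uc] UX by auto
        then show ?thesis using F[of "h t"] h[OF t] by simp
      qed
      show "\<exists>W (h :: complex \<Rightarrow> cvec). open W \<and> t0 \<in> W \<and> W \<subseteq> \<phi> ` ?A \<and>
          (\<forall>i. (\<lambda>t. h t i) holomorphic_on W) \<and>
          (\<forall>t \<in> W. h t \<in> nonzero_vecs I' \<and> (f \<circ> inv_into U \<phi>) t = proj_point (h t))"
        by (rule exI[of _ W], rule exI[of _ "\<lambda>t. F (h t)"]) (use W hol[of h W] Fh in simp)
    qed
    moreover have "(f \<circ> inv_into U \<phi>) ` \<phi> ` ?A \<subseteq> V" using complex_chart_inv(1)[OF Uc] by auto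
    ultimately have "(\<psi> \<circ> (f \<circ> inv_into U \<phi>)) holomorphic_on \<phi> ` ?A"
      by (rule projective_chart_holomorphic[OF V])
    then show "(\<psi> \<circ> f \<circ> inv_into U \<phi>) holomorphic_on \<phi> ` ?A" by (simp add: comp_assoc)
  qed
qed

section \<open>The forms of degree four on coordinate vectors\<close>

definition s3_orbit :: "'a \<Rightarrow> 'a \<Rightarrow> 'a \<Rightarrow> 'a \<Rightarrow> 'a \<Rightarrow> ('a \<times> 'a \<times> 'a \<times> 'a \<times> 'a) set" where
  "s3_orbit a b c d e =
     {(a, b, c, d, e), (b, c, a, d, e), (c, a, b, d, e), (a, c, b, e, d), (c, b, a, e, d), (b, a, c, e, d)}"

definition bring_map :: "nat \<Rightarrow> nat \<Rightarrow> nat \<Rightarrow> nat \<Rightarrow> nat \<Rightarrow> cvec \<Rightarrow> cvec" where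
  "bring_map a b c d e v = vec4 ((v d + v e) ^ 4) ((v d + v e)\<^sup>2 * (v d - v e)\<^sup>2) ((v d - v e) ^ 4)
     (4 * \<i> * ((v a - v b) * (v b - v c) * (v c - v a)) * (v d - v e))"

lemma bring_map_scale: "bring_map a b c d e (\<lambda>i. k * v i) = (\<lambda>i. k ^ 4 * bring_map a b c d e v i)"
proof -
  have "k * v d + k * v e = k * (v d + v e)" "k * v d - k * v e = k * (v d - v e)"
    "k * v a - k * v b = k * (v a - v b)" "k * v b - k * v c = k * (v b - v c)" "k * v c - k * v a = k * (v c - v a)"
    by (simp_all add: algebra_simps)
  then show ?thesis
    unfolding bring_map_def vec4_scale by (simp add: power_mult_distrib power_numeral_reduce mult_ac)
qed

lemma vec4_cong: "a = a' \<Longrightarrow> b = b' \<Longrightarrow> c = c' \<Longrightarrow> d = d' \<Longrightarrow> vec4 a b c d = vec4 a' b' c' d'"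
  by simp

lemma s3_orbit_cases:
  assumes "(a', b', c', d', e') \<in> s3_orbit a b c d e"
  shows "(a' = a \<and> b' = b \<and> c' = c \<and> d' = d \<and> e' = e) \<or>
    (a' = b \<and> b' = c \<and> c' = a \<and> d' = d \<and> e' = e) \<or>
    (a' = c \<and> b' = a \<and> c' = b \<and> d' = d \<and> e' = e) \<or>
    (a' = a \<and> b' = c \<and> c' = b \<and> d' = e \<and> e' = d) \<or>
    (a' = c \<and> b' = b \<and> c' = a \<and> d' = e \<and> e' = d) \<or>
    (a' = b \<and> b' = a \<and> c' = c \<and> d' = e \<and> e' = d)"
  using assms by (simp only: s3_orbit_def insert_iff empty_iff prod.inject simp_thms)

text \<open>A 3-cycle leaves the product of differences unchanged; a transposition reverses its
  sign, and so does the accompanying exchange of \<open>d\<close> and \<open>e\<close> for their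
  difference.\<close>

lemma bring_map_invariant:
  assumes "(\<sigma> a, \<sigma> b, \<sigma> c, \<sigma> d, \<sigma> e) \<in> s3_orbit a b c d e"
  shows "bring_map a b c d e (v \<circ> \<sigma>) = bring_map a b c d e v"
proof -
  have *: "vec4 ((D' + E') ^ 4) ((D' + E')\<^sup>2 * (D' - E')\<^sup>2) ((D' - E') ^ 4)
        (4 * \<i> * ((A' - B') * (B' - C') * (C' - A')) * (D' - E')) =
      vec4 ((D + E) ^ 4) ((D + E)\<^sup>2 * (D - E)\<^sup>2) ((D - E) ^ 4)
        (4 * \<i> * ((A - B) * (B - C) * (C - A)) * (D - E))"
    if "(A', B', C', D', E') \<in> s3_orbit A B C D E" for A B C D E A' B' C' D' E' :: complex
    using s3_orbit_cases[OF that]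
  proof (elim disjE conjE)
  qed (simp only: simp_thms; (rule vec4_cong; simp add: algebra_simps power2_eq_square power4_eq_xxxx)?)+
  have "(v (\<sigma> a), v (\<sigma> b), v (\<sigma> c), v (\<sigma> d), v (\<sigma> e)) \<in> s3_orbit (v a) (v b) (v c) (v d) (v e)"
    using s3_orbit_cases[OF assms]
  proof (elim disjE conjE)
  qed (simp_all add: s3_orbit_def)
  from *[OF this] show ?thesis by (simp only: bring_map_def comp_apply)
qed

lemma bring_map_in_cone:
  assumes "labelling a b c d e" "v \<in> bring_cone"
  shows "bring_map a b c d e v \<in> elliptic_cone"
proof -
  let ?s = "v d + v e" and ?d = "v d - v e"
  have r: "v a + v b + v c = - ?s" "v a * v b + v b * v c + v c * v a = (?d^2 + 3 * ?s^2) / 4"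
    "v a * v b * v c = ?s^3 - ?s * (?d^2 + 3 * ?s^2) / 2"
    using bring_relations assms(2) unfolding bring_cone_labelling[OF assms(1)] by blast+
  have "(4 * \<i> * ((v a - v b) * (v b - v c) * (v c - v a)) * ?d)^2 =
      ?d^8 + 80 * ?s^2 * ?d^6 + 125 * ?s^4 * ?d^4 + 50 * ?s^6 * ?d^2"
    by (rule bring_discriminant[OF r])
  \<comment> \<open>The form of degree 8 is regrouped as a quadratic form in \<open>s^4\<close>,
    \<open>s^2 d^2\<close> and \<open>d^4\<close>.\<close>
  also have "\<dots> = (?d^4)^2 + 80 * (?s^2 * ?d^2) * ?d^4 + 125 * (?s^2 * ?d^2)^2 + 50 * ?s^4 * (?s^2 * ?d^2)"
    by algebra
  finally show ?thesis
    unfolding elliptic_cone_def bring_map_def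
    by (simp add: power_mult_distrib flip: power_mult)
qed

text \<open>At a base point both the sum and the difference of the last two coordinates vanish; the
  other three then have vanishing power sums.\<close>

lemma bring_map_nonzero:
  assumes l: "labelling a b c d e" and v: "v \<in> nonzero_vecs {1..5}" "v \<in> bring_cone"
  shows "bring_map a b c d e v \<in> nonzero_vecs {0..3}"
proof (rule ccontr)
  assume "\<not> ?thesis"
  then have "(v d + v e) ^ 4 = 0" "(v d - v e) ^ 4 = 0" unfolding bring_map_def vec4_nonzero_vecs by blast+
  then have "v d + v e = 0" "v d - v e = 0"
    using power_not_zero[of "v d + v e" 4] power_not_zero[of "v d - v e" 4] by blast+
  then have "2 * v d = 0" "2 * v e = 0" by algebra+
  then have de: "v d = 0" "v e = 0" by simp_all
  then have "v a = 0 \<and> v b = 0 \<and> v c = 0"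
    using v(2) power_sums_3_zero[of "v a" "v b" "v c"] unfolding bring_cone_labelling[OF l] by simp
  then show False using labelling_nonzero[OF l v(1)] de by simp
qed

text \<open>Both triples are the roots of the same monic cubic; removing a common root leaves the
  same statement for a quadratic.\<close>

lemma roots_of_symmetric_functions:
  fixes A B C A' B' C' :: complex
  assumes "A' + B' + C' = A + B + C" "A' * B' + B' * C' + C' * A' = A * B + B * C + C * A" "A' * B' * C' = A * B * C"
  shows "(A', B', C') \<in> {(A, B, C), (B, C, A), (C, A, B), (A, C, B), (C, B, A), (B, A, C)}"
proof -
  have two: "Q' = Q \<and> R' = R \<or> Q' = R \<and> R' = Q" if "Q' + R' = Q + R" "Q' * R' = Q * R" for Q R Q' R' :: complex
  proof -
    have "(Q' - Q) * (Q' - R) = 0" using that by algebra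
    then show ?thesis using that(1) by auto
  qed
  have "(A' - A) * (A' - B) * (A' - C) = 0" using assms by algebra
  then consider "A' = A" | "A' = B" | "A' = C" by auto
  then show ?thesis
  proof cases
    case 1
    have "B' + C' = B + C" "B' * C' = B * C" using assms 1 by algebra+
    from two[OF this] 1 show ?thesis by auto
  next
    case 2
    have "B' + C' = C + A" "B' * C' = C * A" using assms 2 by algebra+
    from two[OF this] 2 show ?thesis by auto
  next
    case 3
    have "B' + C' = A + B" "B' * C' = A * B" using assms 3 by algebra+
    from two[OF this] 3 show ?thesis by auto
  qed
qed

text \<open>If the parities of the permutations of \<open>A, B, C\<close> and of \<open>D, E\<close> disagree, then the product of the
  differences equals its negative, so two of \<open>A, B, C\<close> coincide or \<open>D = E\<close>, and the parity of one of
  the two permutations can be adjusted.\<close>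

lemma s3_orbit_of_invariants:
  fixes A B C D E A' B' C' D' E' :: complex
  assumes abc: "(A', B', C') \<in> {(A, B, C), (B, C, A), (C, A, B), (A, C, B), (C, B, A), (B, A, C)}"
    and de: "(D', E') \<in> {(D, E), (E, D)}"
    and disc: "(A' - B') * (B' - C') * (C' - A') * (D' - E') = (A - B) * (B - C) * (C - A) * (D - E)"
  shows "(A', B', C', D', E') \<in> s3_orbit A B C D E"
proof (rule ccontr)
  assume n: "\<not> ?thesis"
  note unf = s3_orbit_def insert_iff empty_iff prod.inject simp_thms
  have "(A', B', C', D', E') \<in> s3_orbit A B C D E \<or>
      (A' - B') * (B' - C') * (C' - A') * (D' - E') = - ((A - B) * (B - C) * (C - A) * (D - E))"
    using abc de unfolding unf
  proof (elim disjE conjE)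
  qed (simp only: simp_thms; (rule disjI2, simp add: algebra_simps)?)+
  with n have m: "(A' - B') * (B' - C') * (C' - A') * (D' - E') = - ((A - B) * (B - C) * (C - A) * (D - E))"
    by simp
  have "(A - B) * (B - C) * (C - A) * (D - E) = 0" using disc m by simp
  then have "A = B \<or> B = C \<or> C = A \<or> D = E" by simp
  with abc de n show False unfolding unf
  proof (elim disjE conjE)
  qed simp_all
qed

text \<open>The forms determine \<open>s\<close> up to a fourth root of unity. Rescaling
  \<open>y\<close> by a suitable one makes \<open>s\<close> and \<open>D^2\<close> agree, so that
  both points have the same cubic for \<open>a, b, c\<close> and the same pair for
  \<open>d, e\<close> up to order. The form \<open>\<Delta> D\<close> is unaffected, having degree
  4, and decides the parity.\<close>

lemma bring_map_fibre:
  assumes l: "labelling a b c d e" and x: "x \<in> bring_cone" and y: "y \<in> bring_cone"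
    and eq: "bring_map a b c d e y = bring_map a b c d e x"
  shows "\<exists>k. k \<noteq> 0 \<and> (k * y a, k * y b, k * y c, k * y d, k * y e) \<in> s3_orbit (x a) (x b) (x c) (x d) (x e)"
proof -
  define s d' where "s = x d + x e" and "d' = x d - x e"
  define s1 d1 where "s1 = y d + y e" and "d1 = y d - y e"
  have inv: "s1 ^ 4 = s ^ 4" "s1\<^sup>2 * d1\<^sup>2 = s\<^sup>2 * d'\<^sup>2" "d1 ^ 4 = d' ^ 4"
    "4 * \<i> * ((y a - y b) * (y b - y c) * (y c - y a)) * d1 = 4 * \<i> * ((x a - x b) * (x b - x c) * (x c - x a)) * d'"
    using fun_cong[OF eq, of 0] fun_cong[OF eq, of 1] fun_cong[OF eq, of 2] fun_cong[OF eq, of 3]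
    unfolding bring_map_def s_def d'_def s1_def d1_def by simp_all
  have "\<exists>k. k ^ 4 = 1 \<and> k * s1 = s \<and> (k * d1)\<^sup>2 = d'\<^sup>2"
  proof (cases "s1 = 0")
    case True
    then have s: "s = 0" using inv(1) by simp
    have "(d1\<^sup>2 - d'\<^sup>2) * (d1\<^sup>2 + d'\<^sup>2) = 0" using inv(3) by algebra
    then consider "d1\<^sup>2 = d'\<^sup>2" | "(\<i> * d1)\<^sup>2 = d'\<^sup>2"
      by (auto simp: power_mult_distrib add_eq_0_iff)
    then show ?thesis
    proof cases
      case 1 then show ?thesis using True s by (intro exI[of _ 1]) simp
    next
      \<comment> \<open>With \<open>s = 0\<close> only the squares of the differences must agree,
        and \<open>\<i>\<close> is a fourth root of unity that reverses their sign.\<close>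
      case 2 then show ?thesis using True s by (intro exI[of _ \<i>]) simp
    qed
  next
    case False
    define k where "k = s / s1"
    have k4: "k ^ 4 = 1" unfolding k_def power_divide inv(1)[symmetric] using False by simp
    have ks: "k * s1 = s" using False by (simp add: k_def)
    have "s1\<^sup>2 * d1\<^sup>2 = s1\<^sup>2 * (k\<^sup>2 * d'\<^sup>2)" using inv(2) ks by algebra
    then have "d1\<^sup>2 = k\<^sup>2 * d'\<^sup>2" using False by simp
    then have "(k * d1)\<^sup>2 = d'\<^sup>2" using k4 by algebra
    then show ?thesis using k4 ks by blast
  qed
  then obtain k where k: "k ^ 4 = 1" "k * s1 = s" "(k * d1)\<^sup>2 = d'\<^sup>2" by blast
  define z where "z = (\<lambda>i. k * y i)"
  have zc: "z \<in> bring_cone" unfolding z_def by (rule bring_cone_scale[OF y])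
  have zs: "z d + z e = s" and zd: "(z d - z e)\<^sup>2 = d'\<^sup>2"
    using k(2,3) by (simp_all add: z_def s1_def d1_def algebra_simps)
  have rx: "x a + x b + x c = - s" "x a * x b + x b * x c + x c * x a = (d'\<^sup>2 + 3 * s\<^sup>2) / 4"
      "x a * x b * x c = s^3 - s * (d'\<^sup>2 + 3 * s\<^sup>2) / 2"
    using bring_relations[of "x a" "x b" "x c" "x d" "x e"] x
    unfolding bring_cone_labelling[OF l] s_def d'_def by simp_all
  have rz: "z a + z b + z c = - s" "z a * z b + z b * z c + z c * z a = (d'\<^sup>2 + 3 * s\<^sup>2) / 4"
      "z a * z b * z c = s^3 - s * (d'\<^sup>2 + 3 * s\<^sup>2) / 2"
    using bring_relations[of "z a" "z b" "z c" "z d" "z e"] zc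
    unfolding bring_cone_labelling[OF l] zs zd by simp_all
  have "(z a, z b, z c) \<in> {(x a, x b, x c), (x b, x c, x a), (x c, x a, x b), (x a, x c, x b), (x c, x b, x a), (x b, x a, x c)}"
    by (rule roots_of_symmetric_functions) (simp_all only: rx rz)
  moreover have "(z d, z e) \<in> {(x d, x e), (x e, x d)}"
  proof -
    have "(z d - x d) * (z d - x e) = 0" using zs zd unfolding s_def d'_def by algebra
    then show ?thesis using zs unfolding s_def by auto
  qed
  moreover have "(z a - z b) * (z b - z c) * (z c - z a) * (z d - z e) = (x a - x b) * (x b - x c) * (x c - x a) * (x d - x e)"
  proof -
    have "(z a - z b) * (z b - z c) * (z c - z a) * (z d - z e) =
        k ^ 4 * ((y a - y b) * (y b - y c) * (y c - y a) * d1)"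
      unfolding z_def d1_def by algebra
    then show ?thesis using inv(4) k(1) by (simp add: d'_def mult.assoc)
  qed
  ultimately have "(z a, z b, z c, z d, z e) \<in> s3_orbit (x a) (x b) (x c) (x d) (x e)"
    by (rule s3_orbit_of_invariants)
  moreover have "k \<noteq> 0" using k(1) by auto
  ultimately show ?thesis unfolding z_def by blast
qed

text \<open>The fundamental theorem of algebra provides one root; the other two come from the
  quadratic formula for the cofactor with sum \<open>S\<close> and product \<open>P\<close> of its
  roots.\<close>

lemma cubic_roots_exist:
  "\<exists>A B C :: complex. A + B + C = e1 \<and> A * B + B * C + C * A = e2 \<and> A * B * C = e3"
proof -
  have "\<not> constant (poly [:- e3, e2, - e1, 1:])" by (simp add: constant_degree)
  then obtain A where "poly [:- e3, e2, - e1, 1:] A = 0" using fundamental_theorem_of_algebra by blast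
  then have A: "A ^ 3 - e1 * A ^ 2 + e2 * A - e3 = 0"
    by (simp add: algebra_simps power_numeral_reduce)
  define S P where "S = e1 - A" and "P = e2 - A * S"
  define r where "r = csqrt (S\<^sup>2 - 4 * P)"
  have r: "r\<^sup>2 = S\<^sup>2 - 4 * P" by (simp add: r_def)
  have BC: "(S + r) / 2 + (S - r) / 2 = S" "(S + r) / 2 * ((S - r) / 2) = P"
    using r by (simp_all add: field_simps power2_eq_square)
  have "A + (S + r) / 2 + (S - r) / 2 = e1" using BC(1) by (simp add: S_def add.assoc)
  moreover have "A * ((S + r) / 2) + (S + r) / 2 * ((S - r) / 2) + (S - r) / 2 * A = e2"
  proof -
    have "A * ((S + r) / 2) + (S + r) / 2 * ((S - r) / 2) + (S - r) / 2 * A =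
      A * ((S + r) / 2 + (S - r) / 2) + (S + r) / 2 * ((S - r) / 2)" by (simp only: algebra_simps)
    then show ?thesis unfolding BC by (simp add: P_def)
  qed
  moreover have "A * ((S + r) / 2) * ((S - r) / 2) = e3"
    unfolding mult.assoc BC using A unfolding P_def S_def by algebra
  ultimately show ?thesis by blast
qed

text \<open>The coordinates of \<open>X\<close> give \<open>s\<close> and \<open>D\<close> by taking
  roots, these prescribe the elementary symmetric functions of \<open>A, B, C\<close>, and the
  second quadric leaves only the sign of the last coordinate open.\<close>

lemma bring_map_surj:
  assumes l: "labelling a b c d e" and X: "X \<in> nonzero_vecs {0..3}" "X \<in> elliptic_cone"
  shows "\<exists>v. v \<in> nonzero_vecs {1..5} \<and> v \<in> bring_cone \<and> bring_map a b c d e v = X"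
proof -
  have X1: "X 0 * X 2 = (X 1)\<^sup>2" and X3: "(X 3)\<^sup>2 = (X 2)\<^sup>2 + 80 * X 1 * X 2 + 125 * (X 1)\<^sup>2 + 50 * X 0 * X 1"
    using X(2) by (simp_all add: elliptic_cone_def)
  have root4: "\<exists>z. z ^ 4 = u" for u :: complex
  proof -
    have "z ^ 4 = (z\<^sup>2)\<^sup>2" for z :: complex by (simp flip: power_mult)
    then have "csqrt (csqrt u) ^ 4 = u" by (simp only: power2_csqrt)
    then show ?thesis by blast
  qed
  have "\<exists>s d. s ^ 4 = X 0 \<and> s\<^sup>2 * d\<^sup>2 = X 1 \<and> d ^ 4 = X 2"
  proof (cases "X 0 = 0")
    case True
    obtain d where "d ^ 4 = X 2" using root4 by blast
    then show ?thesis using True X1 by (intro exI[of _ 0] exI[of _ d]) simp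
  next
    case False
    obtain s where s: "s ^ 4 = X 0" using root4 by blast
    then have s0: "s \<noteq> 0" using False by auto
    let ?d = "csqrt (X 1 / s\<^sup>2)"
    have d2: "s\<^sup>2 * ?d\<^sup>2 = X 1" using s0 by simp
    \<comment> \<open>Once \<open>s\<close> and the square of \<open>?d\<close> are chosen, the
      first quadric makes the fourth power of \<open>?d\<close> come out as
      \<open>X 2\<close>.\<close>
    have "s ^ 4 * w ^ 4 = (s\<^sup>2 * w\<^sup>2)\<^sup>2" for w by algebra
    from this[of ?d]
    have "X 0 * ?d ^ 4 = X 0 * X 2" unfolding d2 s X1 .
    then show ?thesis using False s d2 by (intro exI[of _ s] exI[of _ ?d]) simp
  qed
  then obtain s d' where sd: "s ^ 4 = X 0" "s\<^sup>2 * d'\<^sup>2 = X 1" "d' ^ 4 = X 2" by blast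
  obtain A B C where r: "A + B + C = - s" "A * B + B * C + C * A = (d'\<^sup>2 + 3 * s\<^sup>2) / 4"
      "A * B * C = s^3 - s * (d'\<^sup>2 + 3 * s\<^sup>2) / 2"
    using cubic_roots_exist by blast
  have "(4 * \<i> * ((A - B) * (B - C) * (C - A)) * d')\<^sup>2 = d'^8 + 80 * s^2 * d'^6 + 125 * s^4 * d'^4 + 50 * s^6 * d'^2"
    by (rule bring_discriminant[OF r])
  also have "\<dots> = (d'^4)^2 + 80 * (s^2 * d'^2) * d'^4 + 125 * (s^2 * d'^2)^2 + 50 * s^4 * (s^2 * d'^2)"
    by algebra
  also have "\<dots> = (X 3)\<^sup>2" unfolding sd X3 ..
  finally have "4 * \<i> * ((A - B) * (B - C) * (C - A)) * d' = X 3 \<or> 4 * \<i> * ((A - B) * (B - C) * (C - A)) * d' = - X 3"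
    by (simp only: power2_eq_iff)
  \<comment> \<open>Exchanging \<open>A\<close> and \<open>B\<close> keeps the symmetric functions
    and corrects the sign of the last coordinate.\<close>
  moreover have "4 * \<i> * ((B - A) * (A - C) * (C - B)) * d' = - (4 * \<i> * ((A - B) * (B - C) * (C - A)) * d')"
    by algebra
  ultimately have "\<exists>A B C. A + B + C = - s \<and> A * B + B * C + C * A = (d'\<^sup>2 + 3 * s\<^sup>2) / 4 \<and>
      A * B * C = s^3 - s * (d'\<^sup>2 + 3 * s\<^sup>2) / 2 \<and> 4 * \<i> * ((A - B) * (B - C) * (C - A)) * d' = X 3"
  proof (elim disjE)
    assume "4 * \<i> * ((A - B) * (B - C) * (C - A)) * d' = X 3"
    then show ?thesis using r by (intro exI[of _ A] exI[of _ B] exI[of _ C]) simp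
  next
    assume m: "4 * \<i> * ((A - B) * (B - C) * (C - A)) * d' = - X 3"
      and n: "4 * \<i> * ((B - A) * (A - C) * (C - B)) * d' = - (4 * \<i> * ((A - B) * (B - C) * (C - A)) * d')"
    have "4 * \<i> * ((B - A) * (A - C) * (C - B)) * d' = X 3" unfolding n m by simp
    moreover have "B + A + C = - s" "B * A + A * C + C * B = (d'\<^sup>2 + 3 * s\<^sup>2) / 4"
      "B * A * C = s^3 - s * (d'\<^sup>2 + 3 * s\<^sup>2) / 2" unfolding r[symmetric] by (simp_all only: ac_simps)
    ultimately show ?thesis by (intro exI[of _ B] exI[of _ A] exI[of _ C] conjI)
  qed
  then obtain A B C where r: "A + B + C = - s" "A * B + B * C + C * A = (d'\<^sup>2 + 3 * s\<^sup>2) / 4"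
      "A * B * C = s^3 - s * (d'\<^sup>2 + 3 * s\<^sup>2) / 2" and x3: "4 * \<i> * ((A - B) * (B - C) * (C - A)) * d' = X 3"
    by blast
  define D E where "D = (s + d') / 2" and "E = (s - d') / 2"
  have DE: "D + E = s" "D - E = d'" by (simp_all add: D_def E_def field_simps)
  define v where "v = (\<lambda>i. if i = a then A else if i = b then B else if i = c then C else if i = d then D else if i = e then E else 0)"
  have v: "v a = A" "v b = B" "v c = C" "v d = D" "v e = E"
    using l by (auto simp: v_def labelling_def)
  have "A + B + C + D + E = 0" using r(1) DE(1) by algebra
  moreover have "A^2 + B^2 + C^2 + D^2 + E^2 = 0"
  proof -
    have "4 * (A * B + B * C + C * A) = d'\<^sup>2 + 3 * s\<^sup>2" unfolding r(2) by simp
    with r(1) show ?thesis unfolding DE[symmetric] by algebra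
  qed
  moreover have "A^3 + B^3 + C^3 + D^3 + E^3 = 0"
  proof -
    have "4 * (A * B + B * C + C * A) = d'\<^sup>2 + 3 * s\<^sup>2" unfolding r(2) by simp
    moreover have "2 * (A * B * C) = 2 * s^3 - s * (d'\<^sup>2 + 3 * s\<^sup>2)" unfolding r(3) by (simp add: field_simps)
    ultimately show ?thesis using r(1) unfolding DE[symmetric] by algebra
  qed
  ultimately have vc: "v \<in> bring_cone" unfolding bring_cone_labelling[OF l] v by simp
  have vX: "bring_map a b c d e v = X"
    unfolding bring_map_def v DE sd x3 using vec4_eta[OF X(1)] by simp
  have "\<exists>i. v i \<noteq> 0"
  proof (rule ccontr)
    assume "\<not> ?thesis"
    then have "bring_map a b c d e v = vec4 0 0 0 0" unfolding bring_map_def by simp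
    then show False using X(1) vX vec4_nonzero_vecs[of 0 0 0 0] by simp
  qed
  moreover have "v i = 0" if "i \<notin> {1..5}" for i
    using that unfolding conjunct2[OF l[unfolded labelling_def]] by (simp add: v_def)
  ultimately have "v \<in> nonzero_vecs {1..5}" by (simp add: nonzero_vecs_def)
  then show ?thesis using vc vX by blast
qed

text \<open>The choice of representative is immaterial, since rescaling a vector multiplies its
  image by a fourth power.\<close>

definition bring_quotient :: "nat \<Rightarrow> nat \<Rightarrow> nat \<Rightarrow> nat \<Rightarrow> nat \<Rightarrow> cvec set \<Rightarrow> cvec set" where
  "bring_quotient a b c d e L = proj_point (bring_map a b c d e (SOME v. v \<in> nonzero_vecs {1..5} \<and> proj_point v = L))"

lemma bring_quotient_proj_point:
  assumes "v \<in> nonzero_vecs {1..5}"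
  shows "bring_quotient a b c d e (proj_point v) = proj_point (bring_map a b c d e v)"
proof -
  define w where "w = (SOME w. w \<in> nonzero_vecs {1..5} \<and> proj_point w = proj_point v)"
  have "w \<in> nonzero_vecs {1..5} \<and> proj_point w = proj_point v"
    unfolding w_def by (rule someI[of _ v]) (use assms in simp)
  then obtain k where k: "k \<noteq> 0" "v = (\<lambda>i. k * w i)" using proj_point_eqD[OF _ assms, of w] by auto
  then have "proj_point (bring_map a b c d e v) = proj_point (bring_map a b c d e w)"
    by (simp add: bring_map_scale proj_point_scale)
  then show ?thesis unfolding bring_quotient_def w_def by simp
qed

lemma closedin_bring_points: "closedin (projective_space {1..5}) bring_points"
  unfolding bring_points_def using closed_bring_cone bring_cone_scale by (rule closedin_projective_cone)

lemma holomorphic_map_bring_quotient: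
  assumes "labelling a b c d e"
  shows "holomorphic_map (projective_curve {1..5} bring_points) (projective_curve {0..3} elliptic_points)
    (bring_quotient a b c d e)"
proof (rule holomorphic_map_projective_curve[OF closedin_bring_points, where F = "bring_map a b c d e"])
  show "continuous_on UNIV (bring_map a b c d e)"
    unfolding bring_map_def by (intro vec4_continuous continuous_intros continuous_on_coordinate)
  fix v assume v: "v \<in> nonzero_vecs {1..5}" "proj_point v \<in> bring_points"
  then have vc: "v \<in> bring_cone" using proj_point_in_bring_points by blast
  have nz: "bring_map a b c d e v \<in> nonzero_vecs {0..3}" by (rule bring_map_nonzero[OF assms v(1) vc])
  show "bring_map a b c d e v \<in> nonzero_vecs {0..3} \<and> proj_point (bring_map a b c d e v) \<in> elliptic_points \<and>
      bring_quotient a b c d e (proj_point v) = proj_point (bring_map a b c d e v)"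
    using nz proj_point_in_elliptic_points[OF nz] bring_map_in_cone[OF assms vc] bring_quotient_proj_point[OF v(1)]
    by blast
next
  fix h :: "complex \<Rightarrow> cvec" and W i
  assume "\<And>i. (\<lambda>t. h t i) holomorphic_on W"
  then show "(\<lambda>t. bring_map a b c d e (h t) i) holomorphic_on W"
    unfolding bring_map_def by (intro vec4_holomorphic holomorphic_intros)
qed

section \<open>The action on points and the isomorphism of the quotient\<close>

lemma permute_point_proj_point: "permute_point \<sigma> (proj_point v) = proj_point (v \<circ> Hilbert_Choice.inv \<sigma>)"
  unfolding permute_point_def proj_point_def by (auto simp: image_image o_def)

lemma permuted_nonzero_vecs:
  assumes "v \<in> nonzero_vecs {1..5}" "\<sigma> permutes {1..5}"
  shows "v \<circ> \<sigma> \<in> nonzero_vecs {1..5}"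
proof -
  obtain i where "v i \<noteq> 0" using assms(1) by (auto simp: nonzero_vecs_def)
  then have "(v \<circ> \<sigma>) (Hilbert_Choice.inv \<sigma> i) \<noteq> 0" by (simp add: permutes_inverses[OF assms(2)])
  moreover have "(v \<circ> \<sigma>) i = 0" if "i \<notin> {1..5}" for i
    using assms(1) permutes_not_in[OF assms(2) that] that by (simp add: nonzero_vecs_def)
  ultimately show ?thesis unfolding nonzero_vecs_def by blast
qed

theorem proposition6p2:
  fixes G :: "(nat \<Rightarrow> nat) set"
  assumes "subgroup G (alt_group 5)"
    and "(alt_group 5)\<lparr>carrier := G\<rparr> \<cong> sym_group 3"
  shows "isomorphic_surfaces
           (quotient_surface brings_curve G permute_point)
           (square_root_curve [:0, 50, 125, 80, 1:])"
proof -
  obtain a b c d e where l: "labelling a b c d e"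
      and T: "(\<lambda>\<sigma>. (\<sigma> a, \<sigma> b, \<sigma> c, \<sigma> d, \<sigma> e)) ` G = s3_orbit a b c d e"
    using alternating_S3_subgroup[OF assms] unfolding s3_orbit_def by (elim exE conjE)
  have perm: "\<sigma> permutes {1..5}" if "\<sigma> \<in> G" for \<sigma>
    using subsetD[OF subgroup.subset[OF assms(1)] that] by (simp add: alt_group_carrier)
  have G_mult: "\<sigma> \<circ> \<tau> \<in> G" if "\<sigma> \<in> G" "\<tau> \<in> G" for \<sigma> \<tau>
    using subgroup.m_closed[OF assms(1) that] by (simp add: alt_group_mult)
  have G_inv: "Hilbert_Choice.inv \<sigma> \<in> G" if "\<sigma> \<in> G" for \<sigma>
    using subgroup.m_inv_closed[OF assms(1) that]
      alt_group_inv_equality[OF subsetD[OF subgroup.subset[OF assms(1)] that]] by simp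
  have id_G: "id \<in> G" using subgroup.one_closed[OF assms(1)] by (simp add: alt_group_one)
  have finG: "finite G"
    by (rule finite_subset[OF _ finite_permutations[of "{1..5::nat}"]]) (use perm in auto)
  let ?F = "bring_quotient a b c d e" and ?O = "group_orbit G permute_point"
  \<comment> \<open>The action composes with inverse permutations; closure of \<open>G\<close> under
    inversion allows listing the orbit by the elements themselves.\<close>
  have orbit: "?O (proj_point v) = (\<lambda>\<sigma>. proj_point (v \<circ> \<sigma>)) ` G" for v
  proof -
    have "Hilbert_Choice.inv ` G = G"
    proof
      show "G \<subseteq> Hilbert_Choice.inv ` G"
      proof
        fix \<sigma> assume "\<sigma> \<in> G"
        then show "\<sigma> \<in> Hilbert_Choice.inv ` G"
          using G_inv permutes_inv_inv[OF perm] by (metis imageI)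
      qed
    qed (use G_inv in auto)
    then show ?thesis
      unfolding group_orbit_def permute_point_proj_point by (metis (no_types, lifting) image_cong image_image)
  qed
  have F_inv: "?F (proj_point (v \<circ> \<sigma>)) = ?F (proj_point v)" if "\<sigma> \<in> G" "v \<in> nonzero_vecs {1..5}" for \<sigma> v
  proof -
    have "(\<sigma> a, \<sigma> b, \<sigma> c, \<sigma> d, \<sigma> e) \<in> s3_orbit a b c d e" using T that(1) by blast
    then show ?thesis
      using bring_map_invariant bring_quotient_proj_point[OF that(2)]
        bring_quotient_proj_point[OF permuted_nonzero_vecs[OF that(2) perm[OF that(1)]]] by metis
  qed
  have orbit_eq: "?O (proj_point (v \<circ> \<tau>)) = ?O (proj_point v)" if "\<tau> \<in> G" for v \<tau>
  proof -
    have "(\<lambda>\<sigma>. \<tau> \<circ> \<sigma>) ` G = G"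
    proof
      show "G \<subseteq> (\<lambda>\<sigma>. \<tau> \<circ> \<sigma>) ` G"
      proof
        fix \<sigma> assume "\<sigma> \<in> G"
        moreover have "\<sigma> = \<tau> \<circ> (Hilbert_Choice.inv \<tau> \<circ> \<sigma>)"
          by (simp add: o_assoc permutes_inv_o[OF perm[OF that]])
        ultimately show "\<sigma> \<in> (\<lambda>\<sigma>. \<tau> \<circ> \<sigma>) ` G" using G_mult G_inv that by blast
      qed
    qed (use G_mult that in auto)
    then have "(\<lambda>\<sigma>. proj_point (v \<circ> \<sigma>)) ` G = (\<lambda>\<sigma>. proj_point (v \<circ> (\<tau> \<circ> \<sigma>))) ` G"
      by (metis (no_types, lifting) image_cong image_image)
    then show ?thesis unfolding orbit by (simp add: comp_assoc)
  qed
  have ts: "topspace (surf_top brings_curve) = bring_points"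
    unfolding brings_curve_eq surf_top_projective_curve using bring_points_subset by (simp add: inf_absorb2)
  have rep: "\<exists>v. v \<in> nonzero_vecs {1..5} \<and> v \<in> bring_cone \<and> x = proj_point v" if "x \<in> bring_points" for x
    using that by (auto simp: bring_points_def)
  have fibre: "?F x = ?F y \<longleftrightarrow> ?O x = ?O y" if xy: "x \<in> bring_points" "y \<in> bring_points" for x y
  proof
    obtain v w where v: "v \<in> nonzero_vecs {1..5}" "v \<in> bring_cone" "x = proj_point v"
      and w: "w \<in> nonzero_vecs {1..5}" "w \<in> bring_cone" "y = proj_point w"
      using rep[OF xy(1)] rep[OF xy(2)] by (elim exE conjE)
    {
      assume "?F x = ?F y"
      then have "proj_point (bring_map a b c d e v) = proj_point (bring_map a b c d e w)"
        by (simp only: v(3) w(3) bring_quotient_proj_point[OF v(1)] bring_quotient_proj_point[OF w(1)])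
      from proj_point_eqD[OF this bring_map_nonzero[OF l w(1,2)]]
      obtain k where k: "k \<noteq> 0" "bring_map a b c d e w = (\<lambda>i. k * bring_map a b c d e v i)" by (elim exE conjE)
      \<comment> \<open>Degree 4 lets a fourth root of the factor \<open>k\<close> be absorbed into
        \<open>v\<close>, which turns equality of points into equality of vectors.\<close>
      define m where "m = csqrt (csqrt k)"
      have "m ^ 4 = (m\<^sup>2)\<^sup>2" by (simp flip: power_mult)
      then have m: "m ^ 4 = k" by (simp only: m_def power2_csqrt)
      have m0: "m \<noteq> 0" using k(1) by (simp add: m_def)
      define u where "u = (\<lambda>i. m * v i)"
      have "bring_map a b c d e w = bring_map a b c d e u" unfolding u_def bring_map_scale m k(2) ..
      from bring_map_fibre[OF l bring_cone_scale[OF v(2), of m, folded u_def] w(2) this]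
      obtain n where n: "n \<noteq> 0" "(n * w a, n * w b, n * w c, n * w d, n * w e) \<in> s3_orbit (u a) (u b) (u c) (u d) (u e)"
        by (elim exE conjE)
      \<comment> \<open>Rearranged values come from rearranged positions, so a match is realized by
        an element of \<open>G\<close> even if some coordinates coincide.\<close>
      have "s3_orbit (u a) (u b) (u c) (u d) (u e) = (\<lambda>(i, j, p, q, r). (u i, u j, u p, u q, u r)) ` s3_orbit a b c d e"
        by (simp add: s3_orbit_def)
      also have "\<dots> = (\<lambda>\<sigma>. (u (\<sigma> a), u (\<sigma> b), u (\<sigma> c), u (\<sigma> d), u (\<sigma> e))) ` G"
        unfolding T[symmetric] by (simp add: image_image)
      finally obtain \<sigma> where \<sigma>: "\<sigma> \<in> G" "n * w a = u (\<sigma> a)" "n * w b = u (\<sigma> b)" "n * w c = u (\<sigma> c)"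
          "n * w d = u (\<sigma> d)" "n * w e = u (\<sigma> e)"
        using n(2) by auto
      have "(\<lambda>i. n * w i) = (\<lambda>i. m * (v \<circ> \<sigma>) i)"
      proof
        fix i
        show "n * w i = m * (v \<circ> \<sigma>) i"
        proof (cases "i \<in> {1..5}")
          case True
          then show ?thesis using labelling_cases[OF l, of i] \<sigma> by (auto simp: u_def)
        next
          case False
          then show ?thesis
            using permutes_not_in[OF perm[OF \<sigma>(1)] False] v(1) w(1) by (simp add: nonzero_vecs_def)
        qed
      qed
      then have "y = proj_point (v \<circ> \<sigma>)"
        using proj_point_scale[OF n(1), of w] proj_point_scale[OF m0, of "v \<circ> \<sigma>"] w(3) by simp
      then show "?O x = ?O y" using orbit_eq[OF \<sigma>(1)] v(3) by simp
    next
      assume "?O x = ?O y"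
      moreover have "x \<in> ?O x" unfolding v(3) orbit by (rule image_eqI[OF _ id_G]) simp
      ultimately have "x \<in> (\<lambda>\<sigma>. proj_point (w \<circ> \<sigma>)) ` G" unfolding w(3) orbit by simp
      then obtain \<sigma> where "\<sigma> \<in> G" "x = proj_point (w \<circ> \<sigma>)" by auto
      then show "?F x = ?F y" using F_inv w by simp
    }
  qed
  have mem_orbit: "x \<in> ?O x" if x: "x \<in> bring_points" for x
  proof -
    obtain v where v: "x = proj_point v" using rep[OF x] by (elim exE conjE)
    show ?thesis unfolding v orbit by (rule image_eqI[OF _ id_G]) simp
  qed
  show ?thesis
    unfolding square_root_curve_elliptic
  proof (rule quotient_surface_iso[where F = ?F, OF riemann_surface_elliptic])
    show "compact_space (surf_top brings_curve)"
      unfolding brings_curve_eq surf_top_projective_curve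
      by (rule compact_space_subtopology)
         (unfold bring_points_def, rule compactin_projective_cone, simp, rule closed_bring_cone, rule bring_cone_scale)
    show "complex_chart (surf_top brings_curve) U \<phi>" if "(U, \<phi>) \<in> surf_atlas brings_curve" for U \<phi>
      using that by (simp add: brings_curve_eq surf_top_projective_curve surf_atlas_projective_curve)
    show "topspace (surf_top brings_curve) \<subseteq> (\<Union>(U, \<phi>)\<in>surf_atlas brings_curve. U)"
      unfolding ts using bring_chart unfolding brings_curve_eq by blast
    show "holomorphic_map brings_curve (projective_curve {0..3} elliptic_points) ?F"
      unfolding brings_curve_eq by (rule holomorphic_map_bring_quotient[OF l])
    show "?F ` topspace (surf_top brings_curve) = topspace (surf_top (projective_curve {0..3} elliptic_points))"
    proof -
      have "?F ` bring_points = elliptic_points"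
      proof
        show "?F ` bring_points \<subseteq> elliptic_points"
        proof (rule image_subsetI)
          fix x assume "x \<in> bring_points"
          from rep[OF this] obtain v where
            v: "v \<in> nonzero_vecs {1..5}" "v \<in> bring_cone" "x = proj_point v" by (elim exE conjE)
          show "?F x \<in> elliptic_points"
            unfolding v(3) bring_quotient_proj_point[OF v(1)]
              proj_point_in_elliptic_points[OF bring_map_nonzero[OF l v(1,2)]]
            by (rule bring_map_in_cone[OF l v(2)])
        qed
        show "elliptic_points \<subseteq> ?F ` bring_points"
        proof
          fix L assume "L \<in> elliptic_points"
          then obtain X where X: "X \<in> nonzero_vecs {0..3}" "X \<in> elliptic_cone" "L = proj_point X"
            by (auto simp: elliptic_points_def)
          from bring_map_surj[OF l X(1,2)] obtain v where
            v: "v \<in> nonzero_vecs {1..5}" "v \<in> bring_cone" "bring_map a b c d e v = X" by (elim exE conjE)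
          have "L = ?F (proj_point v)" unfolding bring_quotient_proj_point[OF v(1)] v(3) X(3) ..
          moreover have "proj_point v \<in> bring_points" using v by (auto simp: bring_points_def)
          ultimately show "L \<in> ?F ` bring_points" by blast
        qed
      qed
      then show ?thesis
        unfolding ts surf_top_projective_curve using elliptic_points_subset by (simp add: inf_absorb2)
    qed
    show "?F x = ?F y \<longleftrightarrow> ?O x = ?O y"
      if "x \<in> topspace (surf_top brings_curve)" "y \<in> topspace (surf_top brings_curve)" for x y
      using fibre that unfolding ts .
    show "finite {y \<in> topspace (surf_top brings_curve). ?F y = ?F x}"
      if "x \<in> topspace (surf_top brings_curve)" for x
    proof (rule finite_subset)
      \<comment> \<open>Points with equal orbits lie in each other's orbits, and orbits of the
        finite group are finite.\<close>
      show "{y \<in> topspace (surf_top brings_curve). ?F y = ?F x} \<subseteq> ?O x"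
        using mem_orbit fibre that unfolding ts by blast
      show "finite (?O x)" using finG by (simp add: group_orbit_def)
    qed
  qed
qed

end
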